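(* In general there is no embedding of colored graphs of the left weak Bruhat graph $B_L(W)$ into the skeleton of $\Gamma_{\mathfrak{g}}$ which is compatible with the inclusion $\iota_W : w \mapsto b_{w\rho}$. That is, there exists a finite-dimensional complex semisimple Lie algebra $\mathfrak{g}$, with Weyl group $W$, for which no embedding of colored graphs of $B_L(W)$ into the skeleton of $\Gamma_{\mathfrak{g}}$ is given on vertices by $\iota_W$.
   Context: **Lie algebra and crystals.** $\mathfrak{g}$ is a finite-dimensional complex semisimple Lie algebra of rank $r$, $I=\{1,\dots,r\}$, simple roots $\alpha_i$, fundamental weights $\omega_i$, dominant weights $\mathsf{P}^+$, $\rho=\omega_1+\cdots+\omega_r$. $W$ is the Weyl group with simple reflections $s_i$ and length function $\ell$. For $\lambda\in\mathsf{P}^+$, $\mathcal{B}(\lambda)$ is the (connected) Kashiwara crystal of the irreducible module of highest weight $\lambda$, with Kashiwara operators $\tilde E_i,\tilde F_i:\mathcal{B}\to\mathcal{B}\sqcup\{0\}$ and $\varepsilon_i(b)=\max\{k:\tilde E_i^k b\in\mathcal{B}\}$, $\varphi_i(b)=\max\{k:\tilde F_i^k b\in\mathcal{B}\}$. Tensor products $\mathcal{B}\otimes\mathcal{B}'$ (as a set $\mathcal{B}\times\mathcal{B}'$) use the convention: $\tilde E_i(b\otimes b')=\tilde E_i b\otimes b'$ if $\varphi_i(b)\ge\varepsilon_i(b')$ and $b\otimes\tilde E_i b'$ otherwise; $\tilde F_i(b\otimes b')=\tilde F_i b\otimes b'$ if $\varphi_i(b)>\varepsilon_i(b')$ and $b\otimes\tilde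 F_i b'$ otherwise (with $0\otimes b'=b\otimes 0=0$). For $w\in W$, $b_{w\lambda}$ is the unique element of $\mathcal{B}(\lambda)$ of weight $w\lambda$. The Cartan component of $\mathcal{B}(\lambda_1)\otimes\cdots\otimes\mathcal{B}(\lambda_n)$ is its unique connected component isomorphic to $\mathcal{B}(\lambda_1+\cdots+\lambda_n)$. **Right ends.** For $\lambda,\mu\in\mathsf{P}^+$ with $\lambda-\mu\in\mathsf{P}^+$, the right end map $\mathsf{R}_\mu:\mathcal{B}(\lambda)\to\mathcal{B}(\mu)$ is $\mathsf{R}_\mu(b):=b''$, where $b\mapsto b'\otimes b''$ is the unique inclusion of crystals $\mathcal{B}(\lambda)\hookrightarrow\mathcal{B}(\lambda-\mu)\otimes\mathcal{B}(\mu)$ as the Cartan component. For an element of the Cartan component of a tensor product $\mathcal{B}(\lambda_1)\otimes\cdots\otimes\mathcal{B}(\lambda_n)$, identify this component with $\mathcal{B}(\lambda_1+\cdots+\lambda_n)$ and apply the same definition; elements outside the Cartan component have right end $0$. Write $\mathsf{R}_i:=\mathsf{R}_{\omega_i}$ and $\mathsf{R}(b):=(\mathsf{R}_1(b),\dots,\mathsf{R}_r(b))$. **The higher-rank graph $\Gamma_{\mathfrak{g}}$.** Its vertices are the tuples $\mathsf{R}(c)$, $c\in\mathcal{B}(\rho)$. Its paths of color (degree) $\lambda\in\mathsf{P}^+\cong\mathbb{N}^r$ are the pairs $(v,b)$ with $v$ a vertex and $b\in\mathcal{B}(\lambda)$ such that, writing $v=\mathsf{R}(c)$ with $c\in\mathcal{B}(\rho)$,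 the element $c\otimes b$ is in the Cartan component of $\mathcal{B}(\rho)\otimes\mathcal{B}(\lambda)$. The path $(v,b)$ has range $v$ and source $\mathsf{R}(c\otimes b)$ (this is independent of the choice of $c$). Composition is $(v,b)\cdot(v',b')=(v,\phi(b\otimes b'))$ with $\phi:\mathcal{B}(\lambda)\otimes\mathcal{B}(\lambda')\to\mathcal{B}(\lambda+\lambda')$ the projection onto the Cartan component. The map $w\mapsto\mathsf{R}(b_{w\rho})=(b_{w\omega_1},\dots,b_{w\omega_r})$ is injective from $W$ to the vertex set; the vertex $\mathsf{R}(b_{w\rho})$ is denoted simply $b_{w\rho}$, and $\iota_W$ denotes this map $w\mapsto b_{w\rho}$. The skeleton of $\Gamma_{\mathfrak{g}}$ is the colored directed graph consisting of all vertices and all paths of color $\omega_i$, $i\in I$ (called edges of color $\omega_i$), each directed from its source to its range. **Left weak Bruhat graph.** $B_L(W)$ has vertex set $W$ and an edge $u\to w$ whenever $w=s_iu$ for some $i\in I$ with $\ell(w)>\ell(u)$; this edge is given the color $i$. Colors $i$ and $\omega_i$ are identified. An embedding of colored graphs is an injective map on vertices and edges preserving sources, ranges and colors. *)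

theory Defs
  imports
    Complex_Main
    "HOL-Library.FuncSet"
    "HOL-Library.Function_Algebras"
    "HOL-Computational_Algebra.Polynomial"
    "HOL-Computational_Algebra.Fraction_Field"
begin

section \<open>Coordinate vector spaces\<close>

text \<open>
  All vector spaces occurring below are subspaces of the space of sequences over a field.
  Every space of finite (or countable) dimension is isomorphic to one of these, so this is no
  restriction; nothing below depends on the embedding, since brackets and actions are arbitrary
  maps on the subspace.
\<close>

definition smul :: "'k::field \<Rightarrow> (nat \<Rightarrow> 'k) \<Rightarrow> (nat \<Rightarrow> 'k)"  (infixr "\<cdot>" 75)
  where "c \<cdot> x = (\<lambda>n. c * x n)"

interpretation coord: vector_space "smul :: 'k::field \<Rightarrow> (nat \<Rightarrow> 'k) \<Rightarrow> (nat \<Rightarrow> 'k)"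
  by unfold_locales (auto simp: smul_def fun_eq_iff algebra_simps)

definition linear_on :: "(nat \<Rightarrow> 'k::field) set \<Rightarrow> ((nat \<Rightarrow> 'k) \<Rightarrow> (nat \<Rightarrow> 'k)) \<Rightarrow> bool"
  where "linear_on V T \<longleftrightarrow> T ` V \<subseteq> V \<and>
    (\<forall>x\<in>V. \<forall>y\<in>V. T (x + y) = T x + T y) \<and> (\<forall>c. \<forall>x\<in>V. T (c \<cdot> x) = c \<cdot> T x)"


section \<open>Complex semisimple Lie algebras\<close>

type_synonym cvec = "nat \<Rightarrow> complex"

record lie_alg =
  lspace :: "cvec set"
  bracket :: "cvec \<Rightarrow> cvec \<Rightarrow> cvec"

definition lie_algebra :: "lie_alg \<Rightarrow> bool"
  where "lie_algebra g \<longleftrightarrow>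
    coord.subspace (lspace g) \<and>
    (\<forall>x\<in>lspace g. linear_on (lspace g) (\<lambda>y. bracket g x y) \<and> linear_on (lspace g) (\<lambda>y. bracket g y x)) \<and>
    (\<forall>x\<in>lspace g. bracket g x x = 0) \<and>
    (\<forall>x\<in>lspace g. \<forall>y\<in>lspace g. \<forall>z\<in>lspace g.
       bracket g x (bracket g y z) + bracket g y (bracket g z x) + bracket g z (bracket g x y) = 0)"

definition finite_dimensional :: "lie_alg \<Rightarrow> bool"
  where "finite_dimensional g \<longleftrightarrow> (\<exists>B. finite B \<and> coord.span B = lspace g)"

definition bracket_span :: "lie_alg \<Rightarrow> cvec set \<Rightarrow> cvec set \<Rightarrow> cvec set"
  where "bracket_span g X Y = coord.span {bracket g x y |x y. x \<in> X \<and> y \<in> Y}"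

definition lie_ideal :: "lie_alg \<Rightarrow> cvec set \<Rightarrow> bool"
  where "lie_ideal g J \<longleftrightarrow> coord.subspace J \<and> J \<subseteq> lspace g \<and>
    (\<forall>x\<in>lspace g. \<forall>y\<in>J. bracket g x y \<in> J)"

definition solvable :: "lie_alg \<Rightarrow> cvec set \<Rightarrow> bool"
  where "solvable g X \<longleftrightarrow> (\<exists>n. ((\<lambda>Y. bracket_span g Y Y) ^^ n) X = {0})"

definition nilpotent :: "lie_alg \<Rightarrow> cvec set \<Rightarrow> bool"
  where "nilpotent g X \<longleftrightarrow> (\<exists>n. ((\<lambda>Y. bracket_span g X Y) ^^ n) X = {0})"

definition semisimple :: "lie_alg \<Rightarrow> bool"
  where "semisimple g \<longleftrightarrow> lie_algebra g \<and> (\<forall>J. lie_ideal g J \<and> solvable g J \<longrightarrow> J = {0})"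

definition cartan_subalgebra :: "lie_alg \<Rightarrow> cvec set \<Rightarrow> bool"
  where "cartan_subalgebra g H \<longleftrightarrow>
    coord.subspace H \<and> H \<subseteq> lspace g \<and> (\<forall>x\<in>H. \<forall>y\<in>H. bracket g x y \<in> H) \<and>
    nilpotent g H \<and> {x \<in> lspace g. \<forall>h\<in>H. bracket g x h \<in> H} = H"

text \<open>
  A functional on \<open>H\<close> is a function of which only the values on \<open>H\<close> matter. Linearity on \<open>H\<close>
  need not be required of a root: it is forced by a nonzero root vector.
\<close>

definition root_space :: "lie_alg \<Rightarrow> cvec set \<Rightarrow> (cvec \<Rightarrow> complex) \<Rightarrow> cvec set"
  where "root_space g H \<beta> = {x \<in> lspace g. \<forall>h\<in>H. bracket g h x = \<beta> h \<cdot> x}"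

definition is_root :: "lie_alg \<Rightarrow> cvec set \<Rightarrow> (cvec \<Rightarrow> complex) \<Rightarrow> bool"
  where "is_root g H \<beta> \<longleftrightarrow> (\<exists>h\<in>H. \<beta> h \<noteq> 0) \<and> root_space g H \<beta> \<noteq> {0}"

definition simple_roots :: "lie_alg \<Rightarrow> cvec set \<Rightarrow> nat \<Rightarrow> (nat \<Rightarrow> cvec \<Rightarrow> complex) \<Rightarrow> bool"
  where "simple_roots g H r \<alpha> \<longleftrightarrow>
    (\<forall>i\<in>{1..r}. is_root g H (\<alpha> i)) \<and>
    (\<forall>c :: nat \<Rightarrow> complex. (\<forall>h\<in>H. (\<Sum>i\<in>{1..r}. c i * \<alpha> i h) = 0) \<longrightarrow> (\<forall>i\<in>{1..r}. c i = 0)) \<and>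
    (\<forall>\<beta>. is_root g H \<beta> \<longrightarrow>
       (\<exists>n :: nat \<Rightarrow> int. (\<forall>h\<in>H. \<beta> h = (\<Sum>i\<in>{1..r}. of_int (n i) * \<alpha> i h)) \<and>
          ((\<forall>i\<in>{1..r}. n i \<ge> 0) \<or> (\<forall>i\<in>{1..r}. n i \<le> 0))))"

definition coroot :: "lie_alg \<Rightarrow> cvec set \<Rightarrow> (cvec \<Rightarrow> complex) \<Rightarrow> cvec"
  where "coroot g H \<beta> = (THE t.
    t \<in> bracket_span g (root_space g H \<beta>) (root_space g H (\<lambda>h. - \<beta> h)) \<and> \<beta> t = 2)"

text \<open>The entry at \<open>i, j\<close> is \<open>\<alpha>\<^sub>j\<close> evaluated at the coroot of \<open>\<alpha>\<^sub>i\<close>.\<close>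

definition cartan_matrix :: "lie_alg \<Rightarrow> cvec set \<Rightarrow> (nat \<Rightarrow> cvec \<Rightarrow> complex) \<Rightarrow> nat \<Rightarrow> nat \<Rightarrow> int"
  where "cartan_matrix g H \<alpha> i j = (THE n. of_int n = \<alpha> j (coroot g H (\<alpha> i)))"


section \<open>Data attached to a Cartan matrix\<close>

text \<open>
  A weight \<open>\<mu>\<close> is represented by its coordinates with respect to the fundamental weights, that is,
  by its values \<open>\<mu> i\<close> on the simple coroots; the coordinates outside the index set are zero.
\<close>

type_synonym weight = "nat \<Rightarrow> int"

type_synonym qfield = "rat poly fract"

type_synonym qvec = "nat \<Rightarrow> qfield"

definition qq :: qfield
  where "qq = Fract [:0, 1:] 1"

definition reg0 :: "qfield set"  \<comment> \<open>rational functions without pole at \<open>q = 0\<close>\<close>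
  where "reg0 = {Fract f h |f h. poly h 0 \<noteq> 0}"

record uq_module =
  mspace :: "qvec set"
  Kop :: "nat \<Rightarrow> qvec \<Rightarrow> qvec"
  Eop :: "nat \<Rightarrow> qvec \<Rightarrow> qvec"
  Fop :: "nat \<Rightarrow> qvec \<Rightarrow> qvec"

text \<open>In the maps of a crystal, \<open>None\<close> plays the role of the additional element \<open>0\<close>.\<close>

record 'b crystal =
  elts :: "'b set"
  Et :: "nat \<Rightarrow> 'b \<Rightarrow> 'b option"
  Ft :: "nat \<Rightarrow> 'b \<Rightarrow> 'b option"
  wt :: "'b \<Rightarrow> weight"

record ('v, 'p) path_category =
  vertices :: "'v set"
  paths :: "'p set"
  degree_of :: "'p \<Rightarrow> weight"
  range_of :: "'p \<Rightarrow> 'v"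
  source_of :: "'p \<Rightarrow> 'v"
  compose :: "'p \<Rightarrow> 'p \<Rightarrow> 'p"

record ('v, 'e, 'c) cgraph =
  verts :: "'v set"
  edges :: "'e set"
  tail :: "'e \<Rightarrow> 'v"
  head :: "'e \<Rightarrow> 'v"
  colour :: "'e \<Rightarrow> 'c"

definition cgraph_embedding ::
  "('v, 'e, 'c) cgraph \<Rightarrow> ('w, 'f, 'c) cgraph \<Rightarrow> ('v \<Rightarrow> 'w) \<Rightarrow> ('e \<Rightarrow> 'f) \<Rightarrow> bool"
  where "cgraph_embedding G G' fV fE \<longleftrightarrow>
    fV ` verts G \<subseteq> verts G' \<and> inj_on fV (verts G) \<and>
    fE ` edges G \<subseteq> edges G' \<and> inj_on fE (edges G) \<and>
    (\<forall>e\<in>edges G. tail G' (fE e) = fV (tail G e) \<and> head G' (fE e) = fV (head G e) \<and>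
       colour G' (fE e) = colour G e)"

locale cartan_datum =
  fixes r :: nat and a :: "nat \<Rightarrow> nat \<Rightarrow> int"
begin

definition I :: "nat set"
  where "I = {1..r}"


subsection \<open>Weights and the Weyl group\<close>

definition weights :: "weight set"
  where "weights = {\<mu>. \<forall>i. i \<notin> I \<longrightarrow> \<mu> i = 0}"

definition dominant :: "weight set"
  where "dominant = {\<mu> \<in> weights. \<forall>i\<in>I. \<mu> i \<ge> 0}"

definition fund :: "nat \<Rightarrow> weight"
  where "fund i = (\<lambda>j. if j = i then 1 else 0)"

definition rho :: weight
  where "rho = (\<Sum>i\<in>I. fund i)"

definition simple_root :: "nat \<Rightarrow> weight"
  where "simple_root i = (\<lambda>j. if j \<in> I then a j i else 0)"

definition refl :: "nat \<Rightarrow> weight \<Rightarrow> weight"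
  where "refl i \<mu> = (\<lambda>j. \<mu> j - \<mu> i * simple_root i j)"

definition word :: "nat list \<Rightarrow> weight \<Rightarrow> weight"
  where "word is = foldr (\<lambda>i f. refl i \<circ> f) is id"

text \<open>The Weyl group, in its faithful action on weights.\<close>

definition weyl :: "(weight \<Rightarrow> weight) set"
  where "weyl = word ` lists I"

definition len :: "(weight \<Rightarrow> weight) \<Rightarrow> nat"
  where "len w = (LEAST n. \<exists>is\<in>lists I. length is = n \<and> word is = w)"

text \<open>
  The edge \<open>u \<rightarrow> s\<^sub>i u\<close> is the triple \<open>(u, i, s\<^sub>i u)\<close>. Its colour \<open>i\<close> is recorded as the \<open>i\<close>-th
  fundamental weight, which is the identification of the two sets of colours.
\<close>

definition left_weak_bruhat ::
  "(weight \<Rightarrow> weight, (weight \<Rightarrow> weight) \<times> nat \<times> (weight \<Rightarrow> weight), weight) cgraph"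
  where "left_weak_bruhat =
    \<lparr> verts = weyl,
      edges = {(u, i, w). u \<in> weyl \<and> w \<in> weyl \<and> i \<in> I \<and> w = refl i \<circ> u \<and> len w > len u},
      tail = (\<lambda>(u, i, w). u),
      head = (\<lambda>(u, i, w). w),
      colour = (\<lambda>(u, i, w). fund i) \<rparr>"


subsection \<open>Modules over the quantized enveloping algebra\<close>

text \<open>
  The primitive symmetrizer: \<open>symd i\<close> is half the squared length of the \<open>i\<close>-th simple root,
  normalized on each component of the Dynkin diagram to the smallest possible positive integers.
\<close>

definition symd :: "nat \<Rightarrow> nat"
  where "symd i = (LEAST n. \<exists>d. (\<forall>j\<in>I. d j > 0) \<and>
    (\<forall>j\<in>I. \<forall>k\<in>I. int (d j) * a j k = int (d k) * a k j) \<and> d i = n)"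

definition qi :: "nat \<Rightarrow> qfield"
  where "qi i = qq ^ symd i"

definition qint :: "nat \<Rightarrow> nat \<Rightarrow> qfield"
  where "qint i n = (qi i powi int n - qi i powi (- int n)) / (qi i - inverse (qi i))"

definition qfact :: "nat \<Rightarrow> nat \<Rightarrow> qfield"
  where "qfact i n = (\<Prod>k\<in>{1..n}. qint i k)"

definition divpow :: "(nat \<Rightarrow> qvec \<Rightarrow> qvec) \<Rightarrow> nat \<Rightarrow> nat \<Rightarrow> qvec \<Rightarrow> qvec"
  where "divpow X i n x = inverse (qfact i n) \<cdot> (X i ^^ n) x"

definition q_serre :: "qvec set \<Rightarrow> (nat \<Rightarrow> qvec \<Rightarrow> qvec) \<Rightarrow> bool"
  where "q_serre V X \<longleftrightarrow> (\<forall>i\<in>I. \<forall>j\<in>I. i \<noteq> j \<longrightarrow> (\<forall>x\<in>V.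
    (\<Sum>k\<in>{0..nat (1 - a i j)}.
       (-1) ^ k \<cdot> divpow X i k (X j (divpow X i (nat (1 - a i j) - k) x))) = 0))"

definition is_uq_module :: "uq_module \<Rightarrow> bool"
  where "is_uq_module M \<longleftrightarrow>
    coord.subspace (mspace M) \<and>
    (\<forall>i\<in>I. linear_on (mspace M) (Kop M i) \<and> bij_betw (Kop M i) (mspace M) (mspace M) \<and>
       linear_on (mspace M) (Eop M i) \<and> linear_on (mspace M) (Fop M i)) \<and>
    (\<forall>i\<in>I. \<forall>j\<in>I. \<forall>x\<in>mspace M.
       Kop M i (Kop M j x) = Kop M j (Kop M i x) \<and>
       Kop M i (Eop M j x) = qi i powi (a i j) \<cdot> Eop M j (Kop M i x) \<and>
       Kop M i (Fop M j x) = qi i powi (- a i j) \<cdot> Fop M j (Kop M i x) \<and>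
       (i \<noteq> j \<longrightarrow> Eop M i (Fop M j x) = Fop M j (Eop M i x)) \<and>
       (i = j \<longrightarrow> Eop M i (Fop M i x) - Fop M i (Eop M i x) =
          inverse (qi i - inverse (qi i)) \<cdot> (Kop M i x - inv_into (mspace M) (Kop M i) x))) \<and>
    q_serre (mspace M) (Eop M) \<and> q_serre (mspace M) (Fop M)"

definition is_submodule :: "uq_module \<Rightarrow> qvec set \<Rightarrow> bool"
  where "is_submodule M S \<longleftrightarrow> coord.subspace S \<and> S \<subseteq> mspace M \<and>
    (\<forall>i\<in>I. Kop M i ` S = S \<and> Eop M i ` S \<subseteq> S \<and> Fop M i ` S \<subseteq> S)"

definition irreducible_module :: "uq_module \<Rightarrow> bool"
  where "irreducible_module M \<longleftrightarrow> is_uq_module M \<and> mspace M \<noteq> {0} \<and>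
    (\<forall>S. is_submodule M S \<longrightarrow> S = {0} \<or> S = mspace M)"

definition wt_space :: "uq_module \<Rightarrow> weight \<Rightarrow> qvec set"
  where "wt_space M \<mu> = {x \<in> mspace M. \<forall>i\<in>I. Kop M i x = qi i powi (\<mu> i) \<cdot> x}"

definition hw_vector :: "uq_module \<Rightarrow> weight \<Rightarrow> qvec \<Rightarrow> bool"
  where "hw_vector M \<nu> v \<longleftrightarrow> v \<noteq> 0 \<and> v \<in> wt_space M \<nu> \<and> (\<forall>i\<in>I. Eop M i v = 0)"

text \<open>
  For dominant \<open>\<nu>\<close> the irreducible module of highest weight \<open>\<nu>\<close> exists and is unique up to
  isomorphism, and its highest weight vector is unique up to a scalar.
\<close>

definition irr_module :: "weight \<Rightarrow> uq_module"
  where "irr_module \<nu> = (SOME M. irreducible_module M \<and> (\<exists>v. hw_vector M \<nu> v))"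

definition hw_vec :: "weight \<Rightarrow> qvec"
  where "hw_vec \<nu> = (SOME v. hw_vector (irr_module \<nu>) \<nu> v)"


subsection \<open>Kashiwara operators and the crystal of an irreducible module\<close>

text \<open>
  In an integrable module every vector is a sum of vectors \<open>F\<^sub>i\<^sup>(\<^sup>n\<^sup>) x\<close> with \<open>x\<close> of weight \<open>\<mu>\<close>,
  \<open>E\<^sub>i x = 0\<close> and \<open>0 \<le> n \<le> \<mu> i\<close>, essentially uniquely. The Kashiwara operators are the linear
  maps that raise or lower the exponent by one on these vectors.
\<close>

definition kashiwara_E :: "uq_module \<Rightarrow> nat \<Rightarrow> qvec \<Rightarrow> qvec"
  where "kashiwara_E M i = (THE T. linear_on (mspace M) T \<and> (\<forall>x. x \<notin> mspace M \<longrightarrow> T x = 0) \<and>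
    (\<forall>\<mu>\<in>weights. \<forall>x\<in>wt_space M \<mu>. Eop M i x = 0 \<longrightarrow> (\<forall>n. int n \<le> \<mu> i \<longrightarrow>
       T (divpow (Fop M) i n x) = (if n = 0 then 0 else divpow (Fop M) i (n - 1) x))))"

definition kashiwara_F :: "uq_module \<Rightarrow> nat \<Rightarrow> qvec \<Rightarrow> qvec"
  where "kashiwara_F M i = (THE T. linear_on (mspace M) T \<and> (\<forall>x. x \<notin> mspace M \<longrightarrow> T x = 0) \<and>
    (\<forall>\<mu>\<in>weights. \<forall>x\<in>wt_space M \<mu>. Eop M i x = 0 \<longrightarrow> (\<forall>n. int n \<le> \<mu> i \<longrightarrow>
       T (divpow (Fop M) i n x) = divpow (Fop M) i (n + 1) x)))"

definition hw_orbit :: "weight \<Rightarrow> qvec set"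
  where "hw_orbit \<nu> = (\<lambda>is. foldr (kashiwara_F (irr_module \<nu>)) is (hw_vec \<nu>)) ` lists I"

text \<open>The crystal lattice \<open>L(\<nu>)\<close>, and \<open>q L(\<nu>)\<close>; elements of \<open>L(\<nu>)/q L(\<nu>)\<close> are cosets.\<close>

definition lattice :: "weight \<Rightarrow> qvec set"
  where "lattice \<nu> = {(\<Sum>x\<in>S. c x \<cdot> x) |S c. finite S \<and> S \<subseteq> hw_orbit \<nu> \<and> c ` S \<subseteq> reg0}"

definition qlattice :: "weight \<Rightarrow> qvec set"
  where "qlattice \<nu> = (\<lambda>x. qq \<cdot> x) ` lattice \<nu>"

text \<open>
  The map induced on cosets by an operator preserving the lattice, with the zero coset
  replaced by \<open>None\<close>.
\<close>

definition induced :: "weight \<Rightarrow> (qvec \<Rightarrow> qvec) \<Rightarrow> qvec set \<Rightarrow> qvec set option"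
  where "induced \<nu> T b = (let b' = {T x + y |x y. x \<in> b \<and> y \<in> qlattice \<nu>}
    in if b' = qlattice \<nu> then None else Some b')"

definition B :: "weight \<Rightarrow> qvec set crystal"
  where "B \<nu> =
    \<lparr> elts = {{x + y |y. y \<in> qlattice \<nu>} |x. x \<in> hw_orbit \<nu>} - {qlattice \<nu>},
      Et = (\<lambda>i. induced \<nu> (kashiwara_E (irr_module \<nu>) i)),
      Ft = (\<lambda>i. induced \<nu> (kashiwara_F (irr_module \<nu>) i)),
      wt = (\<lambda>b. THE \<mu>. \<mu> \<in> weights \<and> b \<inter> wt_space (irr_module \<nu>) \<mu> \<noteq> {}) \<rparr>"

definition extremal :: "(weight \<Rightarrow> weight) \<Rightarrow> weight \<Rightarrow> qvec set"  \<comment> \<open>\<open>b\<^bsub>w\<nu>\<^esub>\<close>\<close>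
  where "extremal w \<nu> = (THE b. b \<in> elts (B \<nu>) \<and> wt (B \<nu>) b = w \<nu>)"


subsection \<open>Tensor products and Cartan components\<close>

definition iter :: "('b \<Rightarrow> 'b option) \<Rightarrow> nat \<Rightarrow> 'b \<Rightarrow> 'b option"
  where "iter f k b = ((\<lambda>x. Option.bind x f) ^^ k) (Some b)"

definition eps :: "'b crystal \<Rightarrow> nat \<Rightarrow> 'b \<Rightarrow> nat"
  where "eps C i b = Max {k. iter (Et C i) k b \<noteq> None}"

definition phi :: "'b crystal \<Rightarrow> nat \<Rightarrow> 'b \<Rightarrow> nat"
  where "phi C i b = Max {k. iter (Ft C i) k b \<noteq> None}"

definition tensor :: "'b crystal \<Rightarrow> 'c crystal \<Rightarrow> ('b \<times> 'c) crystal"  (infixr "\<otimes>" 70)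
  where "C \<otimes> D =
    \<lparr> elts = elts C \<times> elts D,
      Et = (\<lambda>i (b, b'). if phi C i b \<ge> eps D i b'
              then map_option (\<lambda>x. (x, b')) (Et C i b) else map_option (\<lambda>y. (b, y)) (Et D i b')),
      Ft = (\<lambda>i (b, b'). if phi C i b > eps D i b'
              then map_option (\<lambda>x. (x, b')) (Ft C i b) else map_option (\<lambda>y. (b, y)) (Ft D i b')),
      wt = (\<lambda>(b, b'). wt C b + wt D b') \<rparr>"

definition arrows :: "'b crystal \<Rightarrow> ('b \<times> 'b) set"
  where "arrows C = {(x, y). x \<in> elts C \<and> y \<in> elts C \<and> (\<exists>i\<in>I. Ft C i x = Some y)}"

definition components :: "'b crystal \<Rightarrow> 'b set set"
  where "components C = elts C // (arrows C \<union> (arrows C)\<inverse>)\<^sup>*"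

definition crystal_iso :: "('b \<Rightarrow> 'c) \<Rightarrow> 'b crystal \<Rightarrow> 'c crystal \<Rightarrow> bool"
  where "crystal_iso f C D \<longleftrightarrow> bij_betw f (elts C) (elts D) \<and>
    (\<forall>b\<in>elts C. wt D (f b) = wt C b \<and>
       (\<forall>i\<in>I. Et D i (f b) = map_option f (Et C i b) \<and> Ft D i (f b) = map_option f (Ft C i b)))"

definition cartan_component :: "weight \<Rightarrow> weight \<Rightarrow> (qvec set \<times> qvec set) set"
  where "cartan_component \<nu> \<mu> = (THE X. X \<in> components (B \<nu> \<otimes> B \<mu>) \<and>
    (\<exists>f. crystal_iso f (B (\<nu> + \<mu>)) ((B \<nu> \<otimes> B \<mu>)\<lparr>elts := X\<rparr>)))"

definition cartan_inclusion :: "weight \<Rightarrow> weight \<Rightarrow> qvec set \<Rightarrow> qvec set \<times> qvec set"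
  where "cartan_inclusion \<nu> \<mu> = (THE f. f \<in> extensional (elts (B (\<nu> + \<mu>))) \<and>
    crystal_iso f (B (\<nu> + \<mu>)) ((B \<nu> \<otimes> B \<mu>)\<lparr>elts := cartan_component \<nu> \<mu>\<rparr>))"

text \<open>The projection onto the Cartan component, identified with \<open>B(\<nu> + \<mu>)\<close>.\<close>

definition cartan_projection :: "weight \<Rightarrow> weight \<Rightarrow> qvec set \<times> qvec set \<Rightarrow> qvec set option"
  where "cartan_projection \<nu> \<mu> x = (if x \<in> cartan_component \<nu> \<mu>
    then Some (inv_into (elts (B (\<nu> + \<mu>))) (cartan_inclusion \<nu> \<mu>) x) else None)"


subsection \<open>Right ends and the higher-rank graph\<close>

text \<open>\<open>right_end \<nu> \<mu>\<close> is the right end map from \<open>B(\<nu>)\<close> to \<open>B(\<mu>)\<close>, for dominant \<open>\<mu>\<close> and \<open>\<nu> - \<mu>\<close>.\<close>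

definition right_end :: "weight \<Rightarrow> weight \<Rightarrow> qvec set \<Rightarrow> qvec set"
  where "right_end \<nu> \<mu> b = snd (cartan_inclusion (\<nu> - \<mu>) \<mu> b)"

definition right_ends :: "weight \<Rightarrow> qvec set \<Rightarrow> nat \<Rightarrow> qvec set"
  where "right_ends \<nu> b = (\<lambda>i\<in>I. right_end \<nu> (fund i) b)"

text \<open>
  A path \<open>(v, b)\<close> of degree \<open>\<nu>\<close> is the triple \<open>(\<nu>, v, b)\<close>: the sets \<open>B(\<nu>)\<close> all live in one type,
  so that \<open>b\<close> alone need not determine \<open>\<nu>\<close>. The source does not depend on the chosen \<open>c\<close>.
\<close>

type_synonym gpath = "weight \<times> (nat \<Rightarrow> qvec set) \<times> qvec set"

definition lifts :: "gpath \<Rightarrow> qvec set \<Rightarrow> bool"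
  where "lifts = (\<lambda>(\<nu>, v, b) c.
    c \<in> elts (B rho) \<and> right_ends rho c = v \<and> (c, b) \<in> cartan_component rho \<nu>)"

definition \<Gamma> :: "(nat \<Rightarrow> qvec set, gpath) path_category"
  where "\<Gamma> =
    \<lparr> vertices = right_ends rho ` elts (B rho),
      paths = {(\<nu>, v, b). \<nu> \<in> dominant \<and> v \<in> right_ends rho ` elts (B rho) \<and> b \<in> elts (B \<nu>) \<and>
                 (\<exists>c. lifts (\<nu>, v, b) c)},
      degree_of = (\<lambda>(\<nu>, v, b). \<nu>),
      range_of = (\<lambda>(\<nu>, v, b). v),
      source_of = (\<lambda>(\<nu>, v, b). let c = (SOME c. lifts (\<nu>, v, b) c)
                     in right_ends (rho + \<nu>) (the (cartan_projection rho \<nu> (c, b)))),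
      compose = (\<lambda>(\<nu>, v, b) (\<nu>', v', b'). (\<nu> + \<nu>', v, the (cartan_projection \<nu> \<nu>' (b, b')))) \<rparr>"

definition skeleton :: "(nat \<Rightarrow> qvec set, gpath, weight) cgraph"
  where "skeleton =
    \<lparr> verts = vertices \<Gamma>,
      edges = {p \<in> paths \<Gamma>. \<exists>i\<in>I. degree_of \<Gamma> p = fund i},
      tail = source_of \<Gamma>,
      head = range_of \<Gamma>,
      colour = degree_of \<Gamma> \<rparr>"

definition iota_W :: "(weight \<Rightarrow> weight) \<Rightarrow> nat \<Rightarrow> qvec set"
  where "iota_W w = right_ends rho (extremal w rho)"

end

end

theory Submission
  imports Defs
begin

text \<open>
  The counterexample is \<open>sl\<^sub>3\<close>. Its Weyl group has six elements, and a single edge of its left weak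
  Bruhat graph has no image: the edge of colour 2 from \<open>u = s\<^sub>1 s\<^sub>2\<close> to the longest element
  \<open>w = s\<^sub>2 s\<^sub>1 s\<^sub>2\<close>. Suppose that it is sent to a path \<open>(v, b)\<close>, and let \<open>c\<close> be an element of
  \<open>B(\<rho>)\<close> with right ends \<open>v\<close>. The range of the path is the vertex of \<open>w\<close>, so that the right ends of
  \<open>c\<close> are those of the lowest element of \<open>B(\<rho>)\<close>, and only this element has them. The second right end
  of \<open>c \<otimes> b\<close> is \<open>b\<close>, and it has to be that of the extremal element of weight \<open>u \<rho>\<close>, which is the
  lowest element of \<open>B(\<omega>\<^sub>2)\<close>. Hence \<open>c \<otimes> b\<close> is the lowest element of \<open>B(\<rho> + \<omega>\<^sub>2)\<close>; all its right
  ends are lowest, and the source of the path is the vertex of \<open>w\<close> and not the one of \<open>u\<close>.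

  The work lies in the crystals. They are defined from irreducible modules that are only chosen by a
  description, through operators and inclusions that are again given by descriptions. Five highest
  weights occur, with crystals of 3, 3, 8, 6 and 15 elements. For each of them a table lists the
  matrices of \<open>E\<^sub>i\<close> and \<open>F\<^sub>i\<close> in a basis whose first vector has the highest weight, and three
  arguments lead from the table to the crystal.

  \<^item> The entries are \<open>q\<close>-integers, hence integer polynomials in \<open>[2]\<close>, so that the relations of the
    quantized enveloping algebra are identities between integers (\<open>valid_V10\<close> and its companions,
    \<open>is_uq_module\<close>).

  \<^item> A module described by a table is irreducible, and every irreducible module with the same highest
    weight has a basis with the same matrices: a formal combination of words in \<open>F\<^sub>1\<close> and \<open>F\<^sub>2\<close>,
    applied to the highest weight vectors, vanishes in one module if and only if it vanishes in the
    other (\<open>irreducible\<close>, \<open>word_sum_zero_transfer\<close>, \<open>transport\<close>).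

  \<^item> For each \<open>i\<close>, subtracting multiples \<open>[m] / [n]\<close> with \<open>m < n\<close> of some basis vectors from others
    turns the basis into a union of strings, on which the Kashiwara operators are shifts. Such quotients
    vanish at \<open>q = 0\<close>, so that modulo \<open>q\<close> the operators act on the given basis in the same way
    (\<open>kashiwara_the\<close>, \<open>crystal_iso_table\<close>).

  A Cartan component is then found by writing down an embedding of one finite crystal into the tensor
  product of two others. No other choice is possible, because the crystal is generated by its highest
  element and the weight of this element occurs only once in the tensor product (\<open>cartan_eqI\<close>,
  \<open>cartan_table\<close>). Finally \<open>no_embedding\<close> inspects the fifteen elements of \<open>B(\<rho> + \<omega>\<^sub>2)\<close>.
\<close>

section \<open>The Lie algebra of traceless matrices\<close>

text \<open>
  A matrix is stored row by row: its entry in row \<open>i\<close> and column \<open>j\<close>, both counted from zero, has the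
  index \<open>3 * i + j\<close>.
\<close>

definition commutator :: "cvec \<Rightarrow> cvec \<Rightarrow> cvec" where
  "commutator x y = (\<lambda>n. if n < 9 then \<Sum>k<3. x (3 * (n div 3) + k) * y (3 * k + n mod 3)
     - y (3 * (n div 3) + k) * x (3 * k + n mod 3) else 0)"

definition sl3 :: lie_alg where
  "sl3 = \<lparr> lspace = {x. (\<forall>n\<ge>9. x n = 0) \<and> x 0 + x 4 + x 8 = 0}, bracket = commutator \<rparr>"

definition diag :: "cvec set" where
  "diag = {x. (\<forall>n. n \<notin> {0, 4, 8} \<longrightarrow> x n = 0) \<and> x 0 + x 4 + x 8 = 0}"

definition matrix_unit :: "nat \<Rightarrow> cvec" where
  "matrix_unit n = (\<lambda>m. if m = n then 1 else 0)"

definition diagonal :: "complex \<Rightarrow> complex \<Rightarrow> complex \<Rightarrow> cvec" where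
  "diagonal a b c = (\<lambda>n. if n = 0 then a else if n = 4 then b else if n = 8 then c else 0)"

definition alpha :: "nat \<Rightarrow> cvec \<Rightarrow> complex" where
  "alpha i h = (if i = 1 then h 0 - h 4 else h 4 - h 8)"

lemma sum3: "(\<Sum>k<3. f k) = f 0 + f 1 + f (2::nat)" for f :: "nat \<Rightarrow> 'a::comm_monoid_add"
  by (simp add: numeral_3_eq_3 numeral_2_eq_2 add.assoc)

lemma commutator_apply:
  "commutator x y 0 = x 1 * y 3 + x 2 * y 6 - y 1 * x 3 - y 2 * x 6"
  "commutator x y (Suc 0) = x 0 * y 1 + x 1 * y 4 + x 2 * y 7 - y 0 * x 1 - y 1 * x 4 - y 2 * x 7"
  "commutator x y 2 = x 0 * y 2 + x 1 * y 5 + x 2 * y 8 - y 0 * x 2 - y 1 * x 5 - y 2 * x 8"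
  "commutator x y 3 = x 3 * y 0 + x 4 * y 3 + x 5 * y 6 - y 3 * x 0 - y 4 * x 3 - y 5 * x 6"
  "commutator x y 4 = x 3 * y 1 + x 5 * y 7 - y 3 * x 1 - y 5 * x 7"
  "commutator x y 5 = x 3 * y 2 + x 4 * y 5 + x 5 * y 8 - y 3 * x 2 - y 4 * x 5 - y 5 * x 8"
  "commutator x y 6 = x 6 * y 0 + x 7 * y 3 + x 8 * y 6 - y 6 * x 0 - y 7 * x 3 - y 8 * x 6"
  "commutator x y 7 = x 6 * y 1 + x 7 * y 4 + x 8 * y 7 - y 6 * x 1 - y 7 * x 4 - y 8 * x 7"
  "commutator x y 8 = x 6 * y 2 + x 7 * y 5 - y 6 * x 2 - y 7 * x 5"
  "9 \<le> n \<Longrightarrow> commutator x y n = 0"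
  by (simp_all add: commutator_def sum3 numeral_2_eq_2)

lemma nat_less_9_cases: "n < 9 \<Longrightarrow> n = 0 \<or> n = 1 \<or> n = 2 \<or> n = 3 \<or> n = 4 \<or> n = 5 \<or> n = 6 \<or> n = 7 \<or> n = (8::nat)"
  by arith

lemma ext9:
  assumes "\<And>n. 9 \<le> n \<Longrightarrow> x n = y n" "x 0 = y 0" "x 1 = y 1" "x 2 = y 2" "x 3 = y 3" "x 4 = y 4"
    "x 5 = y 5" "x 6 = y 6" "x 7 = y 7" "x 8 = y (8::nat)"
  shows "x = y"
proof
  fix n show "x n = y n" using nat_less_9_cases[of n] assms by (cases "n < 9") auto
qed

lemma smul_apply: "(c \<cdot> x) n = c * x n"
  by (simp add: smul_def)

lemma sl3_iff: "x \<in> lspace sl3 \<longleftrightarrow> (\<forall>n\<ge>9. x n = 0) \<and> x 0 + x 4 + x 8 = 0"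
  by (simp add: sl3_def)

lemma bracket_sl3: "bracket sl3 = commutator"
  by (simp add: sl3_def)

lemma trace_linear:
  "(x + y) 0 + (x + y) 4 + (x + y) 8 = (x 0 + x 4 + x 8) + (y 0 + y 4 + y 8 :: complex)"
  "(c \<cdot> x) 0 + (c \<cdot> x) 4 + (c \<cdot> x) 8 = c * (x 0 + x 4 + x 8 :: complex)"
  by (simp_all add: smul_apply algebra_simps)

lemma subspace_sl3: "coord.subspace (lspace sl3)"
  unfolding coord.subspace_def sl3_iff trace_linear by (simp add: smul_apply sl3_iff)

lemma commutator_in: "commutator x y \<in> lspace sl3"
  unfolding sl3_iff by (auto simp: commutator_apply)

lemma commutator_linear:
  "commutator (x + x') y = commutator x y + commutator x' y"
  "commutator x (y + y') = commutator x y + commutator x y'"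
  "commutator (c \<cdot> x) y = c \<cdot> commutator x y"
  "commutator x (c \<cdot> y) = c \<cdot> commutator x y"
  by (rule ext9; simp add: commutator_apply smul_apply algebra_simps)+

lemma commutator_self: "commutator x x = 0"
  by (rule ext9) (simp_all add: commutator_apply)

lemma jacobi:
  "commutator x (commutator y z) + commutator y (commutator z x) + commutator z (commutator x y) = 0"
  by (rule ext9) (simp_all add: commutator_apply algebra_simps)

lemma lie_algebra_sl3: "lie_algebra sl3"
  unfolding lie_algebra_def linear_on_def bracket_sl3
  using subspace_sl3 commutator_in by (auto simp: commutator_linear commutator_self jacobi)

lemma sl3_off_diagonal_in: "n \<in> {1, 2, 3, 5, 6, 7} \<Longrightarrow> matrix_unit n \<in> lspace sl3"
  by (auto simp: sl3_iff matrix_unit_def)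

lemma diagonal_in: "a + b + c = 0 \<Longrightarrow> diagonal a b c \<in> diag"
  by (simp add: diag_def diagonal_def)

lemma diag_subset: "diag \<subseteq> lspace sl3"
  by (auto simp: diag_def sl3_iff)

lemma finite_dimensional_sl3: "finite_dimensional sl3"
  unfolding finite_dimensional_def
proof (intro exI conjI)
  let ?B = "{matrix_unit 1, matrix_unit 2, matrix_unit 3, matrix_unit 5, matrix_unit 6, matrix_unit 7, diagonal 1 (-1) 0, diagonal 0 1 (-1)}"
  show "finite ?B" by simp
  show "coord.span ?B = lspace sl3"
  proof
    have "?B \<subseteq> lspace sl3"
      using sl3_off_diagonal_in diagonal_in[of 1 "-1" 0] diagonal_in[of 0 1 "-1"] diag_subset by auto
    then show "coord.span ?B \<subseteq> lspace sl3" by (rule coord.span_minimal[OF _ subspace_sl3])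
    show "lspace sl3 \<subseteq> coord.span ?B"
    proof
      fix x assume x: "x \<in> lspace sl3"
      then have t: "x 4 = - x 0 - x 8" by (simp add: sl3_iff algebra_simps eq_neg_iff_add_eq_0)
      have "x = x 1 \<cdot> matrix_unit 1 + (x 2 \<cdot> matrix_unit 2 + (x 3 \<cdot> matrix_unit 3 + (x 5 \<cdot> matrix_unit 5 + (x 6 \<cdot> matrix_unit 6 + (x 7 \<cdot> matrix_unit 7 +
          (x 0 \<cdot> diagonal 1 (-1) 0 + (- x 8) \<cdot> diagonal 0 1 (-1)))))))"
        by (rule ext9) (use x in \<open>simp_all add: t smul_apply matrix_unit_def diagonal_def sl3_iff\<close>)
      also have "\<dots> \<in> coord.span ?B"
        by (intro coord.span_add coord.span_scale coord.span_base) simp_all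
      finally show "x \<in> coord.span ?B" .
    qed
  qed
qed

subsection \<open>Semisimplicity\<close>

definition transposed :: "nat \<Rightarrow> nat" where
  "transposed n = 3 * (n mod 3) + n div 3"

text \<open>
  An elementary matrix, its transpose and their commutator span a copy of \<open>sl\<^sub>2\<close>. Since the square of
  \<open>matrix_unit s\<close> is zero, the double commutator with \<open>matrix_unit s\<close> is the map from \<open>x\<close> to \<open>- 2 (matrix_unit s) x (matrix_unit s)\<close>,
  which sees a single entry of \<open>x\<close>.
\<close>

lemma off_diagonal:
  assumes "t \<in> {1, 2, 3, 5, 6, 7}"
  defines "s \<equiv> transposed t"
  shows "s \<in> {1, 2, 3, 5, 6, 7}"
    "commutator (matrix_unit s) (commutator (matrix_unit s) x) = (- 2 * x t) \<cdot> matrix_unit s"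
    "commutator (commutator (matrix_unit s) (matrix_unit t)) (matrix_unit t) = (- 2) \<cdot> matrix_unit t"
    "commutator (commutator (matrix_unit s) (matrix_unit t)) (matrix_unit s) = 2 \<cdot> matrix_unit s"
proof -
  have t: "t = 1 \<or> t = 2 \<or> t = 3 \<or> t = 5 \<or> t = 6 \<or> t = 7" using assms by simp
  then have ts: "t = 1 \<and> s = 3 \<or> t = 2 \<and> s = 6 \<or> t = 3 \<and> s = 1 \<or> t = 5 \<and> s = 7 \<or> t = 6 \<and> s = 2 \<or> t = 7 \<and> s = 5"
    by (auto simp: s_def transposed_def)
  from t show "s \<in> {1, 2, 3, 5, 6, 7}" by (auto simp: s_def transposed_def)
  show "commutator (matrix_unit s) (commutator (matrix_unit s) x) = (- 2 * x t) \<cdot> matrix_unit s"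
    using ts by (elim disjE conjE; intro ext9; simp add: commutator_apply matrix_unit_def smul_apply)
  show "commutator (commutator (matrix_unit s) (matrix_unit t)) (matrix_unit t) = (- 2) \<cdot> matrix_unit t"
    using ts by (elim disjE conjE; intro ext9; simp add: commutator_apply matrix_unit_def smul_apply)
  show "commutator (commutator (matrix_unit s) (matrix_unit t)) (matrix_unit s) = 2 \<cdot> matrix_unit s"
    using ts by (elim disjE conjE; intro ext9; simp add: commutator_apply matrix_unit_def smul_apply)
qed

text \<open>
  A nonzero entry off the diagonal is isolated by a double commutator. If there is none, then two
  neighbouring diagonal entries differ because the trace is zero, and one commutator is enough.
\<close>

lemma ideal_contains_root_vector:
  assumes "lie_ideal sl3 J" "x \<in> J" "x \<noteq> 0"
  shows "\<exists>t\<in>{1, 2, 3, 5, 6, 7}. matrix_unit t \<in> J"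
proof -
  have J: "coord.subspace J" "J \<subseteq> lspace sl3" "\<And>y z. y \<in> lspace sl3 \<Longrightarrow> z \<in> J \<Longrightarrow> commutator y z \<in> J"
    using assms(1) by (auto simp: lie_ideal_def bracket_sl3)
  have scale: "matrix_unit t \<in> J" if "c \<cdot> matrix_unit t \<in> J" "c \<noteq> 0" for c t
    using coord.subspace_scale[OF J(1) that(1), of "inverse c"] that(2) by simp
  show ?thesis
  proof (cases "\<exists>t\<in>{1, 2, 3, 5, 6, 7}. x t \<noteq> 0")
    case True
    then obtain t where t: "t \<in> {1, 2, 3, 5, 6, 7}" "x t \<noteq> 0" by blast
    note o = off_diagonal[OF t(1)]
    have "commutator (matrix_unit (transposed t)) (commutator (matrix_unit (transposed t)) x) \<in> J"
      using J(3) sl3_off_diagonal_in[OF o(1)] assms(2) by blast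
    then have "matrix_unit (transposed t) \<in> J" using scale[of "- 2 * x t" "transposed t"] t(2) unfolding o(2) by simp
    then show ?thesis using o(1) by blast
  next
    case False
    then have z: "x 1 = 0" "x 2 = 0" "x 3 = 0" "x 5 = 0" "x 6 = 0" "x 7 = 0" by auto
    have x: "x 0 + x 4 + x 8 = 0" "\<And>n. 9 \<le> n \<Longrightarrow> x n = 0" using J(2) assms(2) by (auto simp: sl3_iff)
    have "commutator (matrix_unit 1) x = (x 4 - x 0) \<cdot> matrix_unit 1" "commutator (matrix_unit 5) x = (x 8 - x 4) \<cdot> matrix_unit 5"
      using z x by (auto intro!: ext9 simp: commutator_apply matrix_unit_def smul_apply)
    then have c: "(x 4 - x 0) \<cdot> matrix_unit 1 \<in> J" "(x 8 - x 4) \<cdot> matrix_unit 5 \<in> J"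
      using J(3)[OF sl3_off_diagonal_in assms(2), of 1] J(3)[OF sl3_off_diagonal_in assms(2), of 5] by simp_all
    have "x 0 \<noteq> x 4 \<or> x 4 \<noteq> x 8"
    proof (rule ccontr)
      assume "\<not> ?thesis"
      then have e: "x 0 = x 4" "x 8 = x 4" by auto
      then have "3 * x 4 = 0" using x(1) by simp
      then have "x = 0" using z x e by (intro ext9) simp_all
      then show False using assms(3) by simp
    qed
    then have "matrix_unit 1 \<in> J \<or> matrix_unit 5 \<in> J" using scale[OF c(1)] scale[OF c(2)] by auto
    then show ?thesis by auto
  qed
qed

text \<open>
  Inside a nonzero ideal there is a copy of \<open>sl\<^sub>2\<close>. It is spanned by commutators of its own elements,
  so it survives in every term of the derived series.
\<close>

lemma semisimple_sl3: "semisimple sl3"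
  unfolding semisimple_def
proof (intro conjI allI impI lie_algebra_sl3)
  fix J assume J: "lie_ideal sl3 J \<and> solvable sl3 J"
  show "J = {0}"
  proof (rule ccontr)
    assume "J \<noteq> {0}"
    have J': "coord.subspace J" "\<And>y z. y \<in> lspace sl3 \<Longrightarrow> z \<in> J \<Longrightarrow> commutator y z \<in> J"
      using J by (auto simp: lie_ideal_def bracket_sl3)
    then obtain x where "x \<in> J" "x \<noteq> 0" using \<open>J \<noteq> {0}\<close> coord.subspace_0[of J] by blast
    then obtain t where t: "t \<in> {1, 2, 3, 5, 6, 7}" "matrix_unit t \<in> J" using ideal_contains_root_vector J by blast
    define s where "s = transposed t"
    note o = off_diagonal[OF t(1), folded s_def]
    let ?h = "commutator (matrix_unit s) (matrix_unit t)"
    have scale: "matrix_unit k \<in> S" if "c \<cdot> matrix_unit k \<in> S" "c \<noteq> 0" "coord.subspace S" for c k S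
      using coord.subspace_scale[OF that(3,1), of "inverse c"] that(2) by simp
    have "?h \<in> J" "commutator (matrix_unit s) ?h \<in> J" using J'(2) sl3_off_diagonal_in[OF o(1)] t(2) by blast+
    moreover have "commutator (matrix_unit s) ?h = (- 2) \<cdot> matrix_unit s" unfolding o(2) by (simp add: matrix_unit_def)
    ultimately have start: "{matrix_unit t, matrix_unit s, ?h} \<subseteq> J" using scale[OF _ _ J'(1), of "-2" s] t(2) by simp
    have step: "{matrix_unit t, matrix_unit s, ?h} \<subseteq> bracket_span sl3 Y Y" if Y: "{matrix_unit t, matrix_unit s, ?h} \<subseteq> Y" for Y
    proof -
      have b: "commutator y z \<in> bracket_span sl3 Y Y" if "y \<in> Y" "z \<in> Y" for y z
        unfolding bracket_span_def bracket_sl3 using that by (intro coord.span_base) blast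
      have "coord.subspace (bracket_span sl3 Y Y)" unfolding bracket_span_def by (rule coord.subspace_span)
      then have "matrix_unit t \<in> bracket_span sl3 Y Y" "matrix_unit s \<in> bracket_span sl3 Y Y"
        using scale[of "-2" t "bracket_span sl3 Y Y"] scale[of 2 s "bracket_span sl3 Y Y"]
          b[of ?h "matrix_unit t"] b[of ?h "matrix_unit s"] Y unfolding o(3,4) by simp_all
      then show ?thesis using b[of "matrix_unit s" "matrix_unit t"] Y by simp
    qed
    have "{matrix_unit t, matrix_unit s, ?h} \<subseteq> ((\<lambda>Y. bracket_span sl3 Y Y) ^^ n) J" for n
      by (induction n) (use start step in simp_all)
    moreover obtain n where "((\<lambda>Y. bracket_span sl3 Y Y) ^^ n) J = {0}" using J by (auto simp: solvable_def)
    ultimately have "matrix_unit t = 0" by (metis insert_subset singletonD)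
    then have "matrix_unit t t = 0" by simp
    then show False by (simp add: matrix_unit_def)
  qed
qed

subsection \<open>Cartan subalgebra and roots\<close>

lemma diag_iff: "x \<in> diag \<longleftrightarrow> (\<forall>n\<ge>9. x n = 0) \<and> x 1 = 0 \<and> x 2 = 0 \<and> x 3 = 0 \<and> x 5 = 0 \<and> x 6 = 0 \<and> x 7 = 0
    \<and> x 0 + x 4 + x 8 = 0"
proof -
  have "(\<forall>n. n \<notin> {0, 4, 8} \<longrightarrow> x n = 0) \<longleftrightarrow>
    (\<forall>n\<ge>9. x n = 0) \<and> x 1 = 0 \<and> x 2 = 0 \<and> x 3 = 0 \<and> x 5 = 0 \<and> x 6 = 0 \<and> x 7 = 0" (is "?l \<longleftrightarrow> ?r")
  proof
    assume r: ?r
    show ?l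
    proof (intro allI impI)
      fix n :: nat assume "n \<notin> {0, 4, 8}"
      then show "x n = 0" using r nat_less_9_cases[of n] by (cases "n < 9") auto
    qed
  qed auto
  then show ?thesis by (auto simp: diag_def)
qed

lemma commutator_diag:
  assumes "h \<in> diag"
  shows "commutator h x = (\<lambda>n. if n < 9 then (h (4 * (n div 3)) - h (4 * (n mod 3))) * x n else 0)"
  using assms by (intro ext9) (simp_all add: diag_iff commutator_apply algebra_simps)

lemma cartan_subalgebra_sl3: "cartan_subalgebra sl3 diag"
  unfolding cartan_subalgebra_def
proof (intro conjI)
  show "coord.subspace diag" unfolding coord.subspace_def diag_iff trace_linear by (simp add: smul_apply diag_iff)
  show "diag \<subseteq> lspace sl3" by (rule diag_subset)
  have c: "commutator x y = 0" if "x \<in> diag" "y \<in> diag" for x y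
    using that by (intro ext9) (simp_all add: diag_iff commutator_apply)
  have z: "0 \<in> diag" by (simp add: diag_iff)
  show "\<forall>x\<in>diag. \<forall>y\<in>diag. bracket sl3 x y \<in> diag" using c z by (simp add: bracket_sl3)
  have "{bracket sl3 x y |x y. x \<in> diag \<and> y \<in> diag} = {0}"
    using c by (auto simp: bracket_sl3) (use c[OF z z] z in blast)
  then have "bracket_span sl3 diag diag = {0}" by (simp add: bracket_span_def)
  then show "nilpotent sl3 diag" unfolding nilpotent_def by (intro exI[of _ 1]) simp
  show "{x \<in> lspace sl3. \<forall>h\<in>diag. bracket sl3 x h \<in> diag} = diag"
  proof
    show "{x \<in> lspace sl3. \<forall>h\<in>diag. bracket sl3 x h \<in> diag} \<subseteq> diag"
    proof
      fix x assume "x \<in> {x \<in> lspace sl3. \<forall>h\<in>diag. bracket sl3 x h \<in> diag}"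
      \<comment> \<open>The entries of this diagonal matrix are distinct, so every entry of \<open>x\<close> off the diagonal reappears in the commutator.\<close>
      then have x: "x \<in> lspace sl3" "commutator x (diagonal 1 0 (-1)) \<in> diag"
        using diagonal_in[of 1 0 "-1"] by (auto simp: bracket_sl3)
      then show "x \<in> diag" unfolding diag_iff sl3_iff by (simp add: commutator_apply diagonal_def)
    qed
    show "diag \<subseteq> {x \<in> lspace sl3. \<forall>h\<in>diag. bracket sl3 x h \<in> diag}"
      using diag_subset c z by (auto simp: bracket_sl3)
  qed
qed

lemma root_space_coordinate:
  assumes "x \<in> root_space sl3 diag \<beta>" "h \<in> diag" "n < 9" "x n \<noteq> 0"
  shows "\<beta> h = h (4 * (n div 3)) - h (4 * (n mod 3))"
proof -
  have "commutator h x = \<beta> h \<cdot> x" using assms(1,2) by (simp add: root_space_def bracket_sl3)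
  then have "commutator h x n = \<beta> h * x n" by (simp add: smul_apply)
  then show ?thesis using assms(3,4) by (simp add: commutator_diag[OF assms(2)])
qed

lemma root_space_matrix_unit:
  assumes "n < 9" "matrix_unit n \<in> lspace sl3" "\<And>h. h \<in> diag \<Longrightarrow> \<beta> h = h (4 * (n div 3)) - h (4 * (n mod 3))"
  shows "matrix_unit n \<in> root_space sl3 diag \<beta>"
  using assms unfolding root_space_def bracket_sl3
  by (auto simp: commutator_diag matrix_unit_def smul_apply fun_eq_iff)

text \<open>
  The six roots have distinct nonzero values at the diagonal matrix with entries \<open>1, 3, - 4\<close>. One value
  of \<open>\<beta>\<close> thus decides at which single index its root vectors can be nonzero.
\<close>

lemma root_space_line:
  assumes "n < 9" "\<beta> (diagonal 1 3 (-4)) = diagonal 1 3 (-4) (4 * (n div 3)) - diagonal 1 3 (-4) (4 * (n mod 3))"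
    "n \<in> {1, 2, 3, 5, 6, 7}" "x \<in> root_space sl3 diag \<beta>"
  shows "x = x n \<cdot> matrix_unit n"
proof
  fix m
  let ?h = "diagonal 1 3 (-4)"
  have h: "?h \<in> diag" by (rule diagonal_in) simp
  show "x m = (x n \<cdot> matrix_unit n) m"
  proof (cases "m < 9 \<and> x m \<noteq> 0")
    case True
    from root_space_coordinate[OF assms(4) h, of m] True
    have "?h (4 * (m div 3)) - ?h (4 * (m mod 3)) = ?h (4 * (n div 3)) - ?h (4 * (n mod 3))" using assms(2) by simp
    then have "m = n" using nat_less_9_cases[of m] True assms(3) by (auto simp: diagonal_def)
    then show ?thesis by (simp add: smul_apply matrix_unit_def)
  next
    case False
    then have "x m = 0" using assms(4) by (auto simp: root_space_def sl3_iff)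
    then show ?thesis by (auto simp: smul_apply matrix_unit_def)
  qed
qed

lemma alpha_roots:
  "matrix_unit 1 \<in> root_space sl3 diag (alpha 1)" "matrix_unit 3 \<in> root_space sl3 diag (\<lambda>h. - alpha 1 h)"
  "matrix_unit 5 \<in> root_space sl3 diag (alpha 2)" "matrix_unit 7 \<in> root_space sl3 diag (\<lambda>h. - alpha 2 h)"
  by (rule root_space_matrix_unit; simp add: alpha_def sl3_off_diagonal_in)+

lemma matrix_unit_nonzero: "matrix_unit n \<noteq> 0"
proof
  assume "matrix_unit n = 0"
  then have "matrix_unit n n = 0" by simp
  then show False by (simp add: matrix_unit_def)
qed

lemma simple_roots_sl3: "simple_roots sl3 diag 2 alpha"
proof -
  have I: "{1..2::nat} = {1, 2}" by auto
  have h: "diagonal 1 0 (-1) \<in> diag" "diagonal 1 (-1) 0 \<in> diag" by (rule diagonal_in, simp)+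
  show ?thesis unfolding simple_roots_def I
  proof (intro conjI ballI allI impI)
    fix i :: nat assume "i \<in> {1, 2}"
    then have i: "i = 1 \<or> i = 2" by simp
    have "alpha i (diagonal 1 0 (-1)) \<noteq> 0" using i by (auto simp: alpha_def diagonal_def)
    then have "\<exists>h\<in>diag. alpha i h \<noteq> 0" using h(1) by blast
    moreover have "root_space sl3 diag (alpha i) \<noteq> {0}" using i alpha_roots(1,3) matrix_unit_nonzero by blast
    ultimately show "is_root sl3 diag (alpha i)" by (simp add: is_root_def)
  next
    fix c :: "nat \<Rightarrow> complex" and i :: nat
    assume *: "\<forall>h\<in>diag. (\<Sum>i\<in>{1, 2}. c i * alpha i h) = 0" "i \<in> {1, 2}"
    have "c 1 + c 2 = 0" "2 * c 1 - c 2 = 0"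
      using bspec[OF *(1) h(1)] bspec[OF *(1) h(2)] by (simp_all add: alpha_def diagonal_def mult.commute)
    moreover have "3 * c 1 = (c 1 + c 2) + (2 * c 1 - c 2)" by simp
    ultimately have "3 * c 1 = 0" "c 2 = - c 1" by (simp_all add: eq_neg_iff_add_eq_0 add.commute del: One_nat_def)
    then show "c i = 0" using *(2) by auto
  next
    fix \<beta> assume \<beta>: "is_root sl3 diag \<beta>"
    then obtain h0 where h0: "h0 \<in> diag" "\<beta> h0 \<noteq> 0" by (auto simp: is_root_def)
    have "0 \<in> root_space sl3 diag \<beta>"
      using coord.subspace_0[OF subspace_sl3] commutator_linear(4)[of _ 0 0]
      by (simp add: root_space_def bracket_sl3)
    then obtain x where x: "x \<in> root_space sl3 diag \<beta>" "x \<noteq> 0" using \<beta> unfolding is_root_def by blast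
    have "\<exists>n<9. x n \<noteq> 0"
    proof (rule ccontr)
      assume "\<not> ?thesis"
      then have "\<forall>n<9. x n = 0" by simp
      moreover have "\<forall>n\<ge>9. x n = 0" using x(1) by (simp add: root_space_def sl3_iff)
      ultimately have "x = 0" by (intro ext9) simp_all
      then show False using x(2) by simp
    qed
    then obtain n where n: "n < 9" "x n \<noteq> 0" by blast
    have b: "\<beta> h = h (4 * (n div 3)) - h (4 * (n mod 3))" if "h \<in> diag" for h
      by (rule root_space_coordinate[OF x(1) that n])
    have "n \<notin> {0, 4, 8}"
    proof
      assume "n \<in> {0, 4, 8}"
      then have "\<beta> h0 = 0" using b[OF h0(1)] by auto
      then show False using h0(2) by simp
    qed
    then have n': "n = 1 \<or> n = 2 \<or> n = 3 \<or> n = 5 \<or> n = 6 \<or> n = 7" using nat_less_9_cases[OF n(1)] by simp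
    \<comment> \<open>The indices 1, 5 and 2 belong to \<open>\<alpha>\<^sub>1\<close>, \<open>\<alpha>\<^sub>2\<close> and their sum, and 3, 7 and 6 to the transposed positions.\<close>
    define k :: "nat \<Rightarrow> int" where "k = (\<lambda>i. if i = 1
      then (if n = 1 \<or> n = 2 then 1 else if n = 3 \<or> n = 6 then - 1 else 0)
      else (if n = 5 \<or> n = 2 then 1 else if n = 7 \<or> n = 6 then - 1 else 0))"
    have "(\<forall>h\<in>diag. \<beta> h = (\<Sum>i\<in>{1, 2}. of_int (k i) * alpha i h)) \<and> ((\<forall>i\<in>{1, 2}. k i \<ge> 0) \<or> (\<forall>i\<in>{1, 2}. k i \<le> 0))"
      using n' b by (auto simp: k_def alpha_def)
    then show "\<exists>k :: nat \<Rightarrow> int. (\<forall>h\<in>diag. \<beta> h = (\<Sum>i\<in>{1, 2}. of_int (k i) * alpha i h)) \<and>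
       ((\<forall>i\<in>{1, 2}. k i \<ge> 0) \<or> (\<forall>i\<in>{1, 2}. k i \<le> 0))" by blast
  qed
qed

text \<open>
  The brackets of two lines fill the line spanned by \<open>d\<close>, and the normalization \<open>\<beta> t = 2\<close> selects
  \<open>d\<close> on it.
\<close>

lemma coroot_line:
  assumes "\<And>x. x \<in> root_space sl3 diag \<beta> \<Longrightarrow> x = x t \<cdot> matrix_unit t"
    "\<And>x. x \<in> root_space sl3 diag (\<lambda>h. - \<beta> h) \<Longrightarrow> x = x s \<cdot> matrix_unit s"
    "matrix_unit t \<in> root_space sl3 diag \<beta>" "matrix_unit s \<in> root_space sl3 diag (\<lambda>h. - \<beta> h)"
    "commutator (matrix_unit t) (matrix_unit s) = d" "\<And>c. \<beta> (c \<cdot> d) = c * 2"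
  shows "coroot sl3 diag \<beta> = d"
  unfolding coroot_def
proof (rule the_equality)
  let ?S = "{bracket sl3 x y |x y. x \<in> root_space sl3 diag \<beta> \<and> y \<in> root_space sl3 diag (\<lambda>h. - \<beta> h)}"
  have "d \<in> ?S" using assms(3,4,5) by (auto simp: bracket_sl3)
  then show "d \<in> bracket_span sl3 (root_space sl3 diag \<beta>) (root_space sl3 diag (\<lambda>h. - \<beta> h)) \<and> \<beta> d = 2"
    using assms(6)[of 1] coord.span_base[OF \<open>d \<in> ?S\<close>] by (simp add: bracket_span_def)
  fix u assume u: "u \<in> bracket_span sl3 (root_space sl3 diag \<beta>) (root_space sl3 diag (\<lambda>h. - \<beta> h)) \<and> \<beta> u = 2"
  have "?S \<subseteq> coord.span {d}"
  proof
    fix z assume "z \<in> ?S"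
    then obtain x y where xy: "z = commutator x y" "x = x t \<cdot> matrix_unit t" "y = y s \<cdot> matrix_unit s" using assms(1,2) by (auto simp: bracket_sl3)
    have "z = (x t * y s) \<cdot> d" unfolding xy(1) by (subst xy(2), subst xy(3)) (simp add: commutator_linear assms(5) mult.commute)
    then show "z \<in> coord.span {d}" by (simp add: coord.span_base coord.span_scale)
  qed
  then have "coord.span ?S \<subseteq> coord.span {d}" by (rule coord.span_minimal[OF _ coord.subspace_span])
  then have "u \<in> coord.span {d}" using u by (auto simp: bracket_span_def)
  then obtain c where "u = c \<cdot> d" unfolding coord.span_singleton by blast
  then show "u = d" using u assms(6)[of c] by simp
qed

lemma coroots: "coroot sl3 diag (alpha 1) = diagonal 1 (-1) 0" "coroot sl3 diag (alpha 2) = diagonal 0 1 (-1)"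
proof -
  show "coroot sl3 diag (alpha 1) = diagonal 1 (-1) 0"
    by (rule coroot_line[OF root_space_line root_space_line alpha_roots(1,2)])
      (auto simp: alpha_def diagonal_def smul_apply matrix_unit_def commutator_apply intro!: ext9)
  show "coroot sl3 diag (alpha 2) = diagonal 0 1 (-1)"
    by (rule coroot_line[OF root_space_line root_space_line alpha_roots(3,4)])
      (auto simp: alpha_def diagonal_def smul_apply matrix_unit_def commutator_apply intro!: ext9)
qed

lemma cartan_matrix_sl3:
  assumes "i \<in> {1, 2}" "j \<in> {1, 2}"
  shows "cartan_matrix sl3 diag alpha i j = (if i = j then 2 else - 1)"
proof -
  have "alpha j (coroot sl3 diag (alpha i)) = of_int (if i = j then 2 else - 1)"
    using assms coroots by (auto simp: alpha_def diagonal_def)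
  then show ?thesis unfolding cartan_matrix_def by (intro the_equality) (auto simp del: of_int_minus)
qed

section \<open>Rational functions in \<open>q\<close>\<close>

lemma Fract_one_power: "(Fract p (1::rat poly)) ^ n = Fract (p ^ n) 1"
  by (induction n) (simp_all add: One_fract_def)

lemma qq_nonzero [simp]: "qq \<noteq> 0"
  by (simp add: qq_def Zero_fract_def eq_fract)

lemma qq_power_inject: "qq ^ m = qq ^ n \<Longrightarrow> m = n"
proof -
  assume "qq ^ m = qq ^ n"
  then have "[:0, 1:] ^ m = ([:0, 1:] ^ n :: rat poly)"
    by (simp add: qq_def Fract_one_power eq_fract)
  then have "degree ([:0, 1:] ^ m :: rat poly) = degree ([:0, 1:] ^ n :: rat poly)" by simp
  then show "m = n" by (simp add: degree_power_eq)
qed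

lemma qq_powi_eq_1: "qq powi k = 1 \<Longrightarrow> k = 0"
proof (cases "k \<ge> 0")
  case True
  assume "qq powi k = 1"
  then have "qq ^ nat k = qq ^ 0" using True by (simp add: power_int_def)
  from qq_power_inject[OF this] True show ?thesis by simp
next
  case False
  assume "qq powi k = 1"
  then have "qq ^ nat (-k) = qq ^ 0" using False by (simp add: power_int_def power_inverse)
  from qq_power_inject[OF this] False show ?thesis by simp
qed

lemma qq_powi_inject: "qq powi j = qq powi k \<longleftrightarrow> j = k"
proof
  assume "qq powi j = qq powi k"
  then have "qq powi (j - k) = 1" by (simp add: power_int_diff)
  then show "j = k" using qq_powi_eq_1 by fastforce
qed simp

text \<open>The symmetric \<open>q\<close>-integer \<open>[n]\<close>.\<close>

definition qnum :: "int \<Rightarrow> qfield"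
  where "qnum n = (qq powi n - qq powi (- n)) / (qq - inverse qq)"

definition qtwo :: qfield
  where "qtwo = qq + inverse qq"

lemma qq_minus_inverse_nonzero [simp]: "qq - inverse qq \<noteq> 0"
  using qq_powi_inject[of 1 "-1"] by (simp add: power_int_minus)

lemma qq_neq_inverse [simp]: "qq \<noteq> inverse qq"
  using qq_minus_inverse_nonzero by force

lemma qnum_0 [simp]: "qnum 0 = 0"
  by (simp add: qnum_def)

lemma qnum_1 [simp]: "qnum 1 = 1"
  by (simp add: qnum_def power_int_minus)

lemma qnum_minus: "qnum (- n) = - qnum n"
  by (simp add: qnum_def minus_divide_left)

lemma qnum_rec: "qnum (n + 1) = qtwo * qnum n - qnum (n - 1)"
proof -
  have "qq powi (n + 1) - qq powi (- (n + 1)) =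
    qtwo * (qq powi n - qq powi (- n)) - (qq powi (n - 1) - qq powi (- (n - 1)))"
    by (simp add: qtwo_def power_int_add power_int_diff power_int_minus field_simps)
  then show ?thesis by (simp only: qnum_def diff_divide_distrib times_divide_eq_right right_diff_distrib)
qed

lemma qnum_nonzero: "n \<noteq> 0 \<Longrightarrow> qnum n \<noteq> 0"
  by (simp add: qnum_def qq_powi_inject)

text \<open>The maximal ideal of the local ring \<open>reg0\<close>, that is, the functions that vanish at \<open>q = 0\<close>.\<close>

definition qreg :: "qfield set"
  where "qreg = (\<lambda>c. qq * c) ` reg0"

lemma reg0_0 [simp]: "0 \<in> reg0" and reg0_1 [simp]: "1 \<in> reg0"
  unfolding reg0_def Zero_fract_def One_fract_def by (force intro: exI[of _ 1])+

lemma reg0_add: "a \<in> reg0 \<Longrightarrow> b \<in> reg0 \<Longrightarrow> a + b \<in> reg0"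
proof -
  assume "a \<in> reg0" "b \<in> reg0"
  then obtain f h f' h' where *: "a = Fract f h" "poly h 0 \<noteq> 0" "b = Fract f' h'" "poly h' 0 \<noteq> 0"
    by (auto simp: reg0_def)
  then have "a + b = Fract (f * h' + f' * h) (h * h')" by (subst *, subst *(3), subst add_fract) auto
  then show ?thesis using * unfolding reg0_def
    by (smt (verit, best) mem_Collect_eq mult_eq_0_iff poly_mult)
qed

lemma reg0_mult: "a \<in> reg0 \<Longrightarrow> b \<in> reg0 \<Longrightarrow> a * b \<in> reg0"
proof -
  assume "a \<in> reg0" "b \<in> reg0"
  then obtain f h f' h' where *: "a = Fract f h" "poly h 0 \<noteq> 0" "b = Fract f' h'" "poly h' 0 \<noteq> 0"
    by (auto simp: reg0_def)
  then have "a * b = Fract (f * f') (h * h')" by simp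
  then show ?thesis using * unfolding reg0_def
    by (smt (verit, best) mem_Collect_eq mult_eq_0_iff poly_mult)
qed

lemma reg0_Fract: "poly h 0 \<noteq> 0 \<Longrightarrow> Fract f h \<in> reg0"
  by (auto simp: reg0_def)

lemma reg0_uminus: "a \<in> reg0 \<Longrightarrow> - a \<in> reg0"
  by (auto simp: reg0_def) (metis minus_fract)

lemma qq_reg0 [simp]: "qq \<in> reg0"
  unfolding qq_def by (rule reg0_Fract) simp

lemma reg0_power: "a \<in> reg0 \<Longrightarrow> a ^ n \<in> reg0"
  by (induction n) (auto intro: reg0_mult)

lemma reg0_sum: "(\<And>x. x \<in> A \<Longrightarrow> f x \<in> reg0) \<Longrightarrow> sum f A \<in> reg0"
  by (induction A rule: infinite_finite_induct) (auto intro: reg0_add)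

lemma qreg_subset_reg0: "a \<in> qreg \<Longrightarrow> a \<in> reg0"
  by (auto simp: qreg_def intro: reg0_mult)

lemma qreg_0 [simp]: "0 \<in> qreg"
  unfolding qreg_def by (auto intro: image_eqI[of _ _ 0])

lemma qreg_add: "a \<in> qreg \<Longrightarrow> b \<in> qreg \<Longrightarrow> a + b \<in> qreg"
  unfolding qreg_def by (force simp flip: distrib_left intro: reg0_add)

lemma qreg_sum: "(\<And>x. x \<in> A \<Longrightarrow> f x \<in> qreg) \<Longrightarrow> sum f A \<in> qreg"
  by (induction A rule: infinite_finite_induct) (auto intro: qreg_add)

lemma qreg_mult: "a \<in> reg0 \<Longrightarrow> b \<in> qreg \<Longrightarrow> a * b \<in> qreg"
  unfolding qreg_def by (force simp: mult.left_commute intro: reg0_mult)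

lemma qreg_mult': "b \<in> qreg \<Longrightarrow> a \<in> reg0 \<Longrightarrow> b * a \<in> qreg"
  by (metis mult.commute qreg_mult)

lemma qreg_uminus: "a \<in> qreg \<Longrightarrow> - a \<in> qreg"
  unfolding qreg_def by (force intro: reg0_uminus simp flip: mult_minus_right)

lemma one_notin_qreg: "1 \<notin> qreg"
proof
  assume "1 \<in> qreg"
  then obtain f h where *: "1 = qq * Fract f h" "poly h 0 \<noteq> 0" by (auto simp: qreg_def reg0_def)
  then have "h \<noteq> 0" by auto
  with * have "h = [:0,1:] * f" by (simp add: qq_def One_fract_def eq_fract)
  with * show False by simp
qed

text \<open>Once the powers of \<open>q\<close> are split off from numerator and denominator, the rest is a unit.\<close>

lemma reg0_valuation: "a \<in> reg0 \<or> inverse a \<in> reg0"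
proof (cases a)
  case (Fract f h)
  show ?thesis
  proof (cases "f = 0")
    case True
    then show ?thesis using Fract by (simp flip: Zero_fract_def add: fract_collapse)
  next
    case False
    obtain f' where f': "f = [:0, 1:] ^ order 0 f * f'" "\<not> [:0, 1:] dvd f'"
      using order_decomp[OF False, of 0] by auto
    obtain h' where h': "h = [:0, 1:] ^ order 0 h * h'" "\<not> [:0, 1:] dvd h'"
      using order_decomp[OF Fract(2), of 0] by auto
    have nz: "poly f' 0 \<noteq> 0" "poly h' 0 \<noteq> 0"
      using f'(2) h'(2) poly_eq_0_iff_dvd[of _ 0] by auto
    then have nz': "f' \<noteq> 0" "h' \<noteq> 0" by auto
    show ?thesis
    proof (cases "order 0 f \<ge> order 0 h")
      case True
      have "a = Fract ([:0, 1:] ^ (order 0 f - order 0 h) * f') h'"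
        unfolding Fract(1) using nz' Fract(2) True
        by (subst f', subst h') (simp add: eq_fract power_add[symmetric] mult.assoc[symmetric])
      then show ?thesis using reg0_Fract nz by simp
    next
      case F: False
      have "inverse a = Fract ([:0, 1:] ^ (order 0 h - order 0 f) * h') f'"
        unfolding Fract(1) inverse_fract using nz' False F
        by (subst f', subst h') (simp add: eq_fract power_add[symmetric] mult.assoc[symmetric])
      then show ?thesis using reg0_Fract nz by simp
    qed
  qed
qed

text \<open>
  The elements of the fraction field of a valuation ring are ordered by divisibility. Dividing by a
  suitable one of finitely many coefficients makes all of them regular at \<open>q = 0\<close> and one of them
  equal to 1, so that a nonzero vector can be made nonzero modulo \<open>q\<close>.
\<close>

lemma reg0_dominating_coefficient:
  assumes "finite S" "\<exists>b\<in>S. a b \<noteq> (0::qfield)"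
  shows "\<exists>b\<in>S. a b \<noteq> 0 \<and> (\<forall>b'\<in>S. a b' / a b \<in> reg0)"
  using assms
proof (induction S rule: finite_induct)
  case (insert c S)
  show ?case
  proof (cases "\<exists>b\<in>S. a b \<noteq> 0")
    case False
    then show ?thesis using insert by (auto intro!: bexI[of _ c])
  next
    case True
    then obtain b where b: "b \<in> S" "a b \<noteq> 0" "\<forall>b'\<in>S. a b' / a b \<in> reg0" using insert by blast
    show ?thesis
    proof (cases "a c / a b \<in> reg0")
      case True
      then show ?thesis using b by (auto intro!: bexI[of _ b])
    next
      case F: False
      then have nz: "a c \<noteq> 0" by auto
      have "a b / a c \<in> reg0" using reg0_valuation[of "a c / a b"] F by simp
      then have "a b' / a b * (a b / a c) \<in> reg0" if "b' \<in> S" for b' using b that reg0_mult by blast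
      then have "a b' / a c \<in> reg0" if "b' \<in> S" for b' using b that by simp
      then show ?thesis using nz by (auto intro!: bexI[of _ c])
    qed
  qed
qed simp

text \<open>For positive \<open>n\<close> the sum is a unit of \<open>reg0\<close>, so \<open>[n]\<close> has a pole of order \<open>n - 1\<close> at \<open>q = 0\<close>.\<close>

lemma qnum_sum: "qnum (int n) = qq powi (1 - int n) * (\<Sum>k<n. (qq\<^sup>2) ^ k)"
proof (induction n)
  case (Suc n)
  have D: "qq - inverse qq \<noteq> 0" by simp
  have "qnum (int (Suc n)) = inverse qq * qnum (int n) + qq ^ n"
  proof -
    have "qq powi (int n + 1) - qq powi (- (int n + 1)) =
      inverse qq * (qq powi int n - qq powi (- int n)) + qq ^ n * (qq - inverse qq)"
      by (simp add: power_int_add power_int_diff power_int_minus field_simps)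
    then show ?thesis using D unfolding qnum_def
      by (simp add: add_divide_distrib add.commute)
  qed
  also have "\<dots> = qq powi (1 - int (Suc n)) * (\<Sum>k<Suc n. (qq\<^sup>2) ^ k)"
  proof -
    have "qq ^ n = qq powi (- int n) * (qq\<^sup>2) ^ n"
      by (simp add: power_int_minus power_mult[symmetric] power_add[symmetric] mult_2_right field_simps)
    moreover have "inverse qq * qq powi (1 - int n) = qq powi (- int n)"
      by (simp add: power_int_diff power_int_minus field_simps)
    ultimately show ?thesis
      unfolding Suc.IH by (simp add: distrib_left flip: mult.assoc)
  qed
  finally show ?case .
qed simp

lemma poly_sum_powers_0: "0 < n \<Longrightarrow> poly (\<Sum>k<n. [:0, 0, 1:] ^ k) (0::rat) = 1"
  by (cases n) (simp_all add: poly_sum sum.lessThan_Suc_shift del: sum.lessThan_Suc)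

lemma sum_powers_Fract: "(\<Sum>k<n. (qq\<^sup>2) ^ k) = Fract (\<Sum>k<n. [:0, 0, 1:] ^ k) 1"
proof (induction n)
  case (Suc n)
  have "qq\<^sup>2 = Fract [:0, 0, 1:] 1" by (simp add: qq_def power2_eq_square)
  then show ?case using Suc by (simp add: Fract_one_power)
qed (simp add: Zero_fract_def)

lemma qnum_ratio_qreg:
  assumes "m < n"
  shows "qnum (int m) / qnum (int n) \<in> qreg"
proof -
  let ?S = "\<lambda>n. (\<Sum>k<n. [:0, 0, 1:] ^ k) :: rat poly"
  have S: "poly (?S n) 0 = 1" using assms by (intro poly_sum_powers_0) auto
  then have S0: "?S n \<noteq> 0" by auto
  have "qnum (int m) / qnum (int n) = qq powi (int n - int m) * Fract (?S m) (?S n)"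
    unfolding qnum_sum sum_powers_Fract using S0
    by (simp add: power_int_diff field_simps) (simp flip: times_divide_eq_right)
  also have "qq powi (int n - int m) = qq * qq ^ (n - m - 1)"
    using assms by (simp add: power_int_def nat_diff_distrib' Suc_diff_Suc flip: power_Suc)
  finally show ?thesis unfolding qreg_def
    using S by (auto simp: mult.assoc intro!: imageI reg0_mult reg0_power reg0_Fract)
qed

(* Vectors are functions; they are to be rewritten by the vector space laws and not pointwise. *)
declare plus_fun_apply [simp del] zero_fun_apply [simp del] minus_apply [simp del] uminus_apply [simp del]

section \<open>Sparse matrices with entries in \<open>\<int>[[2]]\<close>\<close>

text \<open>
  Integer polynomials in \<open>[2]\<close> are lists of coefficients, the constant one first. All matrix entries
  are \<open>q\<close>-integers and can be written in this way, so that identities between products of matrices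
  become a matter of integer arithmetic.
\<close>

fun ladd :: "int list \<Rightarrow> int list \<Rightarrow> int list" where
  "ladd [] ys = ys"
| "ladd xs [] = xs"
| "ladd (x # xs) (y # ys) = (x + y) # ladd xs ys"

fun lmul :: "int list \<Rightarrow> int list \<Rightarrow> int list" where
  "lmul [] ys = []"
| "lmul (x # xs) ys = ladd (map ((*) x) ys) (0 # lmul xs ys)"

fun lqnum :: "nat \<Rightarrow> int list" where
  "lqnum 0 = []"
| "lqnum (Suc 0) = [1]"
| "lqnum (Suc (Suc n)) = ladd (0 # lqnum (Suc n)) (map uminus (lqnum n))"

fun leval :: "int list \<Rightarrow> qfield" where
  "leval [] = 0"
| "leval (x # xs) = of_int x + qtwo * leval xs"

lemma leval_ladd [simp]: "leval (ladd xs ys) = leval xs + leval ys"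
  by (induction xs ys rule: ladd.induct) (simp_all add: algebra_simps)

lemma leval_scale: "leval (map ((*) x) ys) = of_int x * leval ys"
  by (induction ys) (simp_all add: algebra_simps)

lemma leval_map_uminus [simp]: "leval (map uminus ys) = - leval ys"
  by (induction ys) (simp_all add: algebra_simps)

lemma leval_lmul [simp]: "leval (lmul xs ys) = leval xs * leval ys"
  by (induction xs) (simp_all add: leval_scale algebra_simps)

lemma leval_lqnum [simp]: "leval (lqnum n) = qnum (int n)"
proof (induction n rule: lqnum.induct)
  case (3 n)
  show ?case using 3 qnum_rec[of "int n + 1"] by (simp add: add.commute)
qed simp_all

definition lzero :: "int list \<Rightarrow> bool"
  where "lzero xs \<longleftrightarrow> list_all (\<lambda>x. x = 0) xs"

lemma leval_lzero: "lzero xs \<Longrightarrow> leval xs = 0"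
  unfolding lzero_def by (induction xs) simp_all

text \<open>A formal combination of basis vectors, in which an index may occur several times.\<close>

type_synonym svec = "(nat \<times> int list) list"

text \<open>
  The family \<open>g\<close> is a parameter because the same computations are used in the explicit module of a
  table and in every module isomorphic to it.
\<close>

definition lin :: "(nat \<Rightarrow> qvec) \<Rightarrow> svec \<Rightarrow> qvec"
  where "lin g l = (\<Sum>(b, c)\<leftarrow>l. leval c \<cdot> g b)"

definition qcol :: "(nat \<times> nat) list \<Rightarrow> svec"
  where "qcol l = map (\<lambda>(b, n). (b, lqnum n)) l"

definition sscale :: "int list \<Rightarrow> svec \<Rightarrow> svec"
  where "sscale c l = map (\<lambda>(b, d). (b, lmul c d)) l"

definition sapp :: "(nat \<Rightarrow> (nat \<times> nat) list) \<Rightarrow> svec \<Rightarrow> svec"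
  where "sapp col l = concat (map (\<lambda>(b, c). sscale c (qcol (col b))) l)"

definition scoeff :: "svec \<Rightarrow> nat \<Rightarrow> int list"
  where "scoeff l b = foldr (\<lambda>(b', c) d. if b' = b then ladd c d else d) l []"

definition szero :: "nat \<Rightarrow> svec \<Rightarrow> bool"
  where "szero N l \<longleftrightarrow> list_all (\<lambda>(b, c). b < N) l \<and> list_all (\<lambda>b. lzero (scoeff l b)) [0..<N]"

lemma smul_distribs:
  "c \<cdot> (x + y) = c \<cdot> x + c \<cdot> (y :: nat \<Rightarrow> 'k::field)" "(c + d) \<cdot> x = c \<cdot> x + d \<cdot> x"
  "c \<cdot> d \<cdot> x = (c * d) \<cdot> x" "1 \<cdot> x = x" "0 \<cdot> x = 0" "c \<cdot> 0 = (0 :: nat \<Rightarrow> 'k)"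
  "(- c) \<cdot> x = - (c \<cdot> x)" "c \<cdot> (x - y) = c \<cdot> x - c \<cdot> y"
  by (auto simp: smul_def fun_eq_iff plus_fun_def zero_fun_def fun_diff_def fun_Compl_def algebra_simps)

lemma lin_simps [simp]:
  "lin g [] = 0" "lin g ((b, c) # l) = leval c \<cdot> g b + lin g l" "lin g (l @ l') = lin g l + lin g l'"
  by (simp_all add: lin_def)

lemma sscale_simps [simp]:
  "sscale c [] = []" "sscale c ((b, d) # l) = (b, lmul c d) # sscale c l"
  by (simp_all add: sscale_def)

lemma sapp_simps [simp]:
  "sapp col [] = []" "sapp col ((b, c) # l) = sscale c (qcol (col b)) @ sapp col l"
  by (simp_all add: sapp_def)

lemma lin_sscale [simp]: "lin g (sscale c l) = leval c \<cdot> lin g l"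
proof (induction l)
  case Nil
  show ?case by (simp only: sscale_simps lin_simps smul_distribs)
next
  case (Cons p l)
  then show ?case by (cases p) (simp only: sscale_simps lin_simps smul_distribs leval_lmul)
qed

lemma lin_coeffs:
  "list_all (\<lambda>(b, c). b < N) l \<Longrightarrow> lin g l = (\<Sum>b<N. leval (scoeff l b) \<cdot> g b)"
proof (induction l)
  case (Cons p l)
  obtain b' c where p: "p = (b', c)" by force
  have "(\<Sum>b<N. leval (scoeff (p # l) b) \<cdot> g b) =
      (\<Sum>b<N. (if b = b' then leval c \<cdot> g b else 0) + leval (scoeff l b) \<cdot> g b)"
    by (intro sum.cong) (auto simp: scoeff_def p smul_distribs)
  also have "\<dots> = leval c \<cdot> g b' + lin g l"
    using Cons p by (simp add: sum.distrib)
  finally show ?case using p by simp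
qed (simp add: scoeff_def smul_distribs)

lemma lin_szero: "szero N l \<Longrightarrow> lin g l = 0"
  unfolding szero_def using lin_coeffs[of N l g]
  by (simp add: list_all_iff leval_lzero smul_distribs)

lemma linear_on_0: "linear_on V T \<Longrightarrow> 0 \<in> V \<Longrightarrow> T 0 = 0"
  unfolding linear_on_def by (metis add_cancel_right_right)

lemma subspace_lin:
  assumes "coord.subspace V" "\<And>b. b < N \<Longrightarrow> g b \<in> V" "list_all (\<lambda>(b, c). b < N) l"
  shows "lin g l \<in> V"
  using assms(3) by (induction l) (auto intro!: coord.subspace_add coord.subspace_scale coord.subspace_0 assms)

text \<open>Applying a linear map to a combination can be done formally, from its columns alone.\<close>

lemma lin_sapp:
  assumes "coord.subspace V" "linear_on V T" "\<And>b. b < N \<Longrightarrow> g b \<in> V"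
    and "\<And>b. b < N \<Longrightarrow> T (g b) = lin g (qcol (col b))"
    and "list_all (\<lambda>(b, c). b < N) l"
  shows "T (lin g l) = lin g (sapp col l)"
  using assms(5)
proof (induction l)
  case Nil
  then show ?case using linear_on_0[OF assms(2)] coord.subspace_0[OF assms(1)]
    by (simp only: sapp_simps lin_simps)
next
  case (Cons p l)
  obtain b c where p: "p = (b, c)" by force
  have *: "lin g l \<in> V" "g b \<in> V" "leval c \<cdot> g b \<in> V"
    using Cons p subspace_lin[OF assms(1,3)] assms(3) coord.subspace_scale[OF assms(1)] by auto
  then have "T (lin g (p # l)) = leval c \<cdot> T (g b) + T (lin g l)"
    using assms(2) by (simp add: p linear_on_def)
  then show ?case using Cons p assms(4)[of b]
    by (simp only: sapp_simps lin_simps lin_sscale list.pred_inject prod.case)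
qed

section \<open>Tables of modules\<close>

text \<open>
  The data of a module in a basis numbered from 0, with the highest weight vector at 0. The \<open>b\<close>-th
  member of \<open>tE i\<close> is the image of the \<open>b\<close>-th basis vector under \<open>E\<^sub>i\<close>, where a pair \<open>(c, n)\<close>
  stands for \<open>[n]\<close> times the \<open>c\<close>-th vector; likewise \<open>tF\<close>. The crystal is given by its \<open>i\<close>-strings
  \<open>tstrings i\<close>, each one from top to bottom. An entry \<open>(b, p, m, n)\<close> of \<open>tcorr i\<close> prescribes the
  subtraction of \<open>[m] / [n]\<close> times the \<open>p\<close>-th basis vector from the \<open>b\<close>-th; after all these
  corrections, \<open>E\<^sub>i\<close> and \<open>F\<^sub>i\<close> move the vectors along the strings, up to \<open>q\<close>-integers.
\<close>

record table =
  tsize :: nat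
  twts :: "(int \<times> int) list"
  tE :: "nat \<Rightarrow> (nat \<times> nat) list list"
  tF :: "nat \<Rightarrow> (nat \<times> nat) list list"
  tstrings :: "nat \<Rightarrow> nat list list"
  tcorr :: "nat \<Rightarrow> (nat \<times> nat \<times> nat \<times> nat) list"

definition twt :: "table \<Rightarrow> nat \<Rightarrow> nat \<Rightarrow> int"
  where "twt T b i = (if i = 1 then fst (twts T ! b) else if i = 2 then snd (twts T ! b) else 0)"

definition ecol :: "table \<Rightarrow> nat \<Rightarrow> nat \<Rightarrow> (nat \<times> nat) list"
  where "ecol T i b = tE T i ! b"

definition fcol :: "table \<Rightarrow> nat \<Rightarrow> nat \<Rightarrow> (nat \<times> nat) list"
  where "fcol T i b = tF T i ! b"

fun the_string :: "nat list list \<Rightarrow> nat \<Rightarrow> nat list" where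
  "the_string [] b = []"
| "the_string (s # ss) b = (if List.member s b then s else the_string ss b)"

definition teps :: "table \<Rightarrow> nat \<Rightarrow> nat \<Rightarrow> nat"
  where "teps T i b = length (takeWhile (\<lambda>c. c \<noteq> b) (the_string (tstrings T i) b))"

definition tphi :: "table \<Rightarrow> nat \<Rightarrow> nat \<Rightarrow> nat"
  where "tphi T i b = length (the_string (tstrings T i) b) - 1 - teps T i b"

definition te :: "table \<Rightarrow> nat \<Rightarrow> nat \<Rightarrow> nat option"
  where "te T i b = (if teps T i b = 0 then None
    else Some (the_string (tstrings T i) b ! (teps T i b - 1)))"

definition tf :: "table \<Rightarrow> nat \<Rightarrow> nat \<Rightarrow> nat option"
  where "tf T i b = (if tphi T i b = 0 then None
    else Some (the_string (tstrings T i) b ! (teps T i b + 1)))"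

definition tcor :: "table \<Rightarrow> nat \<Rightarrow> nat \<Rightarrow> (nat \<times> nat \<times> nat) option"
  where "tcor T i b = map_of (tcorr T i) b"

definition tden :: "table \<Rightarrow> nat \<Rightarrow> nat \<Rightarrow> nat"
  where "tden T i b = (case tcor T i b of None \<Rightarrow> 1 | Some (p, m, n) \<Rightarrow> n)"

text \<open>The corrected vector, multiplied by the \<open>q\<close>-integer of \<open>tden T i b\<close> to avoid a denominator.\<close>

definition tadapt :: "table \<Rightarrow> nat \<Rightarrow> nat \<Rightarrow> svec"
  where "tadapt T i b = (case tcor T i b of None \<Rightarrow> [(b, [1])]
    | Some (p, m, n) \<Rightarrow> [(b, lqnum n), (p, map uminus (lqnum m))])"

definition sneg :: "svec \<Rightarrow> svec"
  where "sneg l = sscale [-1] l"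

lemma lin_sneg [simp]: "lin g (sneg l) = - lin g l"
  by (simp add: sneg_def smul_distribs)

definition lint :: "int \<Rightarrow> int list"
  where "lint w = (if w \<ge> 0 then lqnum (nat w) else map uminus (lqnum (nat (- w))))"

lemma leval_lint [simp]: "leval (lint w) = qnum w"
  by (simp add: lint_def qnum_minus)

definition entry_A2 :: "nat \<Rightarrow> nat \<Rightarrow> int"
  where "entry_A2 i j = (if i = j then 2 else - 1)"

text \<open>The condition that \<open>E\<^sub>i\<close> lowers the index makes its action visibly nilpotent.\<close>

definition check_weights :: "table \<Rightarrow> bool" where
  "check_weights T \<longleftrightarrow> list_all (\<lambda>i. list_all (\<lambda>b.
     list_all (\<lambda>(c, n). c < b \<and> list_all (\<lambda>j. twt T c j = twt T b j + entry_A2 j i) [1, 2]) (ecol T i b) \<and>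
     list_all (\<lambda>(c, n). c < tsize T \<and> list_all (\<lambda>j. twt T c j = twt T b j - entry_A2 j i) [1, 2]) (fcol T i b))
     [0..<tsize T]) [1, 2]"

definition check_commutators :: "table \<Rightarrow> bool" where
  "check_commutators T \<longleftrightarrow> list_all (\<lambda>i. list_all (\<lambda>j. list_all (\<lambda>b.
     szero (tsize T) (sapp (ecol T i) (qcol (fcol T j b)) @ sneg (sapp (fcol T j) (qcol (ecol T i b)))
       @ (if i = j then [(b, lint (- twt T b i))] else []))) [0..<tsize T]) [1, 2]) [1, 2]"

definition check_serre :: "table \<Rightarrow> bool" where
  "check_serre T \<longleftrightarrow> list_all (\<lambda>i. list_all (\<lambda>col. list_all (\<lambda>b. let j = 3 - i in
     szero (tsize T) (sapp (col j) (sapp (col i) (qcol (col i b)))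
       @ sneg (sscale (lqnum 2) (sapp (col i) (sapp (col j) (qcol (col i b)))))
       @ sapp (col i) (sapp (col i) (qcol (col j b))))) [0..<tsize T]) [ecol T, fcol T]) [1, 2]"

definition check_strings :: "table \<Rightarrow> bool" where
  "check_strings T \<longleftrightarrow> list_all (\<lambda>i. list_all (\<lambda>b.
     int (tphi T i b) - int (teps T i b) = twt T b i \<and>
     (case te T i b of None \<Rightarrow> teps T i b = 0 | Some c \<Rightarrow> c < tsize T \<and> tf T i c = Some b \<and>
        teps T i b = Suc (teps T i c)) \<and>
     (case tf T i b of None \<Rightarrow> tphi T i b = 0 | Some c \<Rightarrow> c < tsize T \<and> te T i c = Some b \<and>
        tphi T i b = Suc (tphi T i c))) [0..<tsize T]) [1, 2]"

text \<open>
  With \<open>x\<^sub>b\<close> for the corrected vectors, the last two conditions say that \<open>E\<^sub>i x\<^sub>b\<close> is the multiple by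
  \<open>[\<phi>\<^sub>i(b) + 1]\<close> of the next vector up the string, and \<open>F\<^sub>i x\<^sub>b\<close> the multiple by \<open>[\<epsilon>\<^sub>i(b) + 1]\<close> of
  the next one down; the denominators of both sides are cleared.
\<close>

definition check_adapted :: "table \<Rightarrow> bool" where
  "check_adapted T \<longleftrightarrow> list_all (\<lambda>i. list_all (\<lambda>b.
     (case tcor T i b of None \<Rightarrow> True
       | Some (p, m, n) \<Rightarrow> p < tsize T \<and> m < n \<and> tcor T i p = None \<and> list_all (\<lambda>j. twt T p j = twt T b j) [1, 2]) \<and>
     szero (tsize T) (case te T i b of None \<Rightarrow> sapp (ecol T i) (tadapt T i b)
       | Some c \<Rightarrow> sscale (lqnum (tden T i c)) (sapp (ecol T i) (tadapt T i b)) @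
           sneg (sscale (lmul (lqnum (tden T i b)) (lqnum (tphi T i b + 1))) (tadapt T i c))) \<and>
     szero (tsize T) (case tf T i b of None \<Rightarrow> sapp (fcol T i) (tadapt T i b)
       | Some c \<Rightarrow> sscale (lqnum (tden T i c)) (sapp (fcol T i) (tadapt T i b)) @
           sneg (sscale (lmul (lqnum (tden T i b)) (lqnum (teps T i b + 1))) (tadapt T i c))))
     [0..<tsize T]) [1, 2]"

text \<open>
  Each basis vector other than the first is the image of an earlier one under some \<open>F\<^sub>i\<close>, up to a
  \<open>q\<close>-integer, and no correction is involved on either side. This makes the basis lie in the orbit of
  the highest weight vector exactly and not only modulo \<open>q\<close>.
\<close>

definition check_reach :: "table \<Rightarrow> bool" where
  "check_reach T \<longleftrightarrow> tsize T > 0 \<and> list_all (\<lambda>b. list_ex (\<lambda>i. case te T i b of None \<Rightarrow> False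
     | Some c \<Rightarrow> c < b \<and> tcor T i b = None \<and> tcor T i c = None) [1, 2]) [1..<tsize T]"

definition valid :: "table \<Rightarrow> bool" where
  "valid T \<longleftrightarrow> check_weights T \<and> check_commutators T \<and> check_serre T \<and> check_strings T
     \<and> check_adapted T \<and> check_reach T"

text \<open>
  The digits in the name of a table are the coordinates of the highest weight. The bases consist of
  the nonzero vectors among \<open>F\<^sub>1\<^sup>(\<^sup>a\<^sup>) F\<^sub>2\<^sup>(\<^sup>b\<^sup>) F\<^sub>1\<^sup>(\<^sup>c\<^sup>) v\<close> and \<open>F\<^sub>2\<^sup>(\<^sup>a\<^sup>) F\<^sub>1\<^sup>(\<^sup>b\<^sup>) F\<^sub>2\<^sup>(\<^sup>c\<^sup>) v\<close> with
  \<open>b \<ge> a + c\<close>, where \<open>v\<close> is a highest weight vector; they come from the canonical basis of the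
  negative part. In these bases all entries are \<open>q\<close>-integers.
\<close>

definition V10 :: table
  where "V10 = \<lparr> tsize = 3,
    twts = [(1, 0), (-1, 1), (0, -1)],
    tE = (\<lambda>i. if i = 1
      then [[], [(0, 1)], []]
      else [[], [], [(1, 1)]]),
    tF = (\<lambda>i. if i = 1
      then [[(1, 1)], [], []]
      else [[], [(2, 1)], []]),
    tstrings = (\<lambda>i. if i = 1 then [[0, 1], [2]] else [[0], [1, 2]]),
    tcorr = (\<lambda>i. if i = 1 then [] else []) \<rparr>"

definition V01 :: table
  where "V01 = \<lparr> tsize = 3,
    twts = [(0, 1), (1, -1), (-1, 0)],
    tE = (\<lambda>i. if i = 1
      then [[], [], [(1, 1)]]
      else [[], [(0, 1)], []]),
    tF = (\<lambda>i. if i = 1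
      then [[], [(2, 1)], []]
      else [[(1, 1)], [], []]),
    tstrings = (\<lambda>i. if i = 1 then [[0], [1, 2]] else [[0, 1], [2]]),
    tcorr = (\<lambda>i. if i = 1 then [] else []) \<rparr>"

definition V11 :: table
  where "V11 = \<lparr> tsize = 8,
    twts = [(1, 1), (2, -1), (-1, 2), (0, 0), (0, 0), (1, -2), (-2, 1), (-1, -1)],
    tE = (\<lambda>i. if i = 1
      then [[], [], [(0, 1)], [(1, 1)], [(1, 2)], [], [(4, 1)], [(5, 1)]]
      else [[], [(0, 1)], [], [(2, 2)], [(2, 1)], [(3, 1)], [], [(6, 1)]]),
    tF = (\<lambda>i. if i = 1
      then [[(2, 1)], [(4, 1)], [], [(6, 1)], [(6, 2)], [(7, 1)], [], []]
      else [[(1, 1)], [], [(3, 1)], [(5, 2)], [(5, 1)], [], [(7, 1)], []]),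
    tstrings = (\<lambda>i. if i = 1 then [[0, 2], [1, 4, 6], [3], [5, 7]] else [[0, 1], [2, 3, 5], [4], [6, 7]]),
    tcorr = (\<lambda>i. if i = 1 then [(3, 4, 1, 2)] else [(4, 3, 1, 2)]) \<rparr>"

definition V02 :: table
  where "V02 = \<lparr> tsize = 6,
    twts = [(0, 2), (1, 0), (2, -2), (-1, 1), (0, -1), (-2, 0)],
    tE = (\<lambda>i. if i = 1
      then [[], [], [], [(1, 1)], [(2, 2)], [(4, 1)]]
      else [[], [(0, 2)], [(1, 1)], [], [(3, 1)], []]),
    tF = (\<lambda>i. if i = 1
      then [[], [(3, 1)], [(4, 1)], [], [(5, 2)], []]
      else [[(1, 1)], [(2, 2)], [], [(4, 1)], [], []]),
    tstrings = (\<lambda>i. if i = 1 then [[0], [1, 3], [2, 4, 5]] else [[0, 1, 2], [3, 4], [5]]),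
    tcorr = (\<lambda>i. if i = 1 then [] else []) \<rparr>"

definition V12 :: table
  where "V12 = \<lparr> tsize = 15,
    twts = [(1, 2), (2, 0), (-1, 3), (3, -2), (0, 1), (0, 1), (1, -1), (1, -1), (-2, 2), (2, -3), (-1, 0), (-1, 0), (0, -2), (-3, 1), (-2, -1)],
    tE = (\<lambda>i. if i = 1
      then [[], [], [(0, 1)], [], [(1, 1)], [(1, 2)], [(3, 1)], [(3, 3)], [(5, 1)], [], [(6, 1), (7, 1)], [(7, 2)], [(9, 2)], [(11, 1)], [(12, 1)]]
      else [[], [(0, 2)], [], [(1, 1)], [(2, 3)], [(2, 2)], [(4, 2)], [(5, 1)], [], [(6, 1)], [(8, 2)], [(8, 1)], [(10, 1)], [], [(13, 1)]]),
    tF = (\<lambda>i. if i = 1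
      then [[(2, 1)], [(5, 1)], [], [(7, 1)], [(8, 1)], [(8, 2)], [(10, 1)], [(11, 2)], [], [(12, 1)], [(13, 2)], [(13, 3)], [(14, 2)], [], []]
      else [[(1, 1)], [(3, 2)], [(4, 1)], [], [(6, 2)], [(6, 1), (7, 1)], [(9, 3)], [(9, 1)], [(10, 1)], [], [(12, 2)], [(12, 1)], [], [(14, 1)], []]),
    tstrings = (\<lambda>i. if i = 1 then [[0, 2], [1, 5, 8], [4], [3, 7, 11, 13], [6, 10], [9, 12, 14]] else [[0, 1, 3], [2, 4, 6, 9], [5, 7], [8, 10, 12], [11], [13, 14]]),
    tcorr = (\<lambda>i. if i = 1 then [(4, 5, 1, 2), (6, 7, 1, 3), (10, 11, 2, 3)] else [(5, 4, 2, 3), (7, 6, 1, 3), (11, 10, 1, 2)]) \<rparr>"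

lemma valid_V10: "valid V10"
  by code_simp

lemma valid_V01: "valid V01"
  by code_simp

lemma valid_V11: "valid V11"
  by code_simp

lemma valid_V02: "valid V02"
  by code_simp

lemma valid_V12: "valid V12"
  by code_simp

section \<open>Linear maps\<close>

lemma list_allD: "list_all P xs \<Longrightarrow> x \<in> set xs \<Longrightarrow> P x"
  by (simp add: list_all_iff)

lemma funpow_2: "(f ^^ 2) y = f (f y)"
  by (simp add: numeral_2_eq_2)

lemma group_rearrange:
  fixes A B C :: "'a::ab_group_add"
  shows "A + (- B + (C + 0)) = 0 \<Longrightarrow> A - B = - C" "A + (- B + C) = 0 \<Longrightarrow> A - B + C = 0"
    "A + (- B + 0) = 0 \<Longrightarrow> A - B = 0"
  by (simp_all add: algebra_simps eq_neg_iff_add_eq_0)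

lemma linear_onD:
  assumes "linear_on V T"
  shows "x \<in> V \<Longrightarrow> T x \<in> V" "x \<in> V \<Longrightarrow> y \<in> V \<Longrightarrow> T (x + y) = T x + T y" "x \<in> V \<Longrightarrow> T (c \<cdot> x) = c \<cdot> T x"
  using assms by (auto simp: linear_on_def)

lemma linear_on_compose: "linear_on V S \<Longrightarrow> linear_on V T \<Longrightarrow> linear_on V (\<lambda>x. S (T x))"
  unfolding linear_on_def by (auto simp: image_subset_iff)

lemma linear_on_add:
  "coord.subspace V \<Longrightarrow> linear_on V S \<Longrightarrow> linear_on V T \<Longrightarrow> linear_on V (\<lambda>x. S x + T x)"
  unfolding linear_on_def
  by (auto simp: image_subset_iff coord.scale_right_distrib intro: coord.subspace_add)

lemma linear_on_scale: "coord.subspace V \<Longrightarrow> linear_on V T \<Longrightarrow> linear_on V (\<lambda>x. c \<cdot> T x)"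
  unfolding linear_on_def
  by (auto simp: image_subset_iff coord.scale_right_distrib mult.commute intro: coord.subspace_scale)

lemma linear_on_uminus: "coord.subspace V \<Longrightarrow> linear_on V T \<Longrightarrow> linear_on V (\<lambda>x. - T x)"
  using linear_on_scale[of V T "-1"] by simp

lemma linear_on_diff:
  "coord.subspace V \<Longrightarrow> linear_on V S \<Longrightarrow> linear_on V T \<Longrightarrow> linear_on V (\<lambda>x. S x - T x)"
  using linear_on_add[of V S "\<lambda>x. - T x"] linear_on_uminus[of V T] by simp

lemma linear_on_id: "linear_on V (\<lambda>x. x)"
  by (auto simp: linear_on_def)

lemma linear_on_funpow: "linear_on V T \<Longrightarrow> linear_on V (T ^^ n)"
proof (induction n)
  case 0
  then show ?case by (simp add: linear_on_def)
next
  case (Suc n)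
  then show ?case using linear_on_compose[of V T "T ^^ n"] by (simp add: comp_def)
qed

lemma subspace_combination:
  "coord.subspace V \<Longrightarrow> (\<And>b. b \<in> S \<Longrightarrow> g b \<in> V) \<Longrightarrow> (\<Sum>b\<in>S. c b \<cdot> g b) \<in> V"
  by (intro coord.subspace_sum coord.subspace_scale) auto

lemma linear_on_combination:
  assumes "coord.subspace V" "linear_on V T" "finite S" "\<And>b. b \<in> S \<Longrightarrow> g b \<in> V"
  shows "T (\<Sum>b\<in>S. c b \<cdot> g b) = (\<Sum>b\<in>S. c b \<cdot> T (g b))"
  using assms(3,4)
proof (induction S rule: finite_induct)
  case empty
  show ?case using linear_on_0[OF assms(2) coord.subspace_0[OF assms(1)]] by (simp only: sum.empty)
next
  case (insert b S)
  have "c b \<cdot> g b \<in> V" "(\<Sum>b\<in>S. c b \<cdot> g b) \<in> V"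
    using insert assms(1) by (auto intro!: subspace_combination coord.subspace_scale)
  then have "T (c b \<cdot> g b + (\<Sum>b\<in>S. c b \<cdot> g b)) = c b \<cdot> T (g b) + T (\<Sum>b\<in>S. c b \<cdot> g b)"
    using insert linear_onD[OF assms(2)] by simp
  then show ?case using insert.IH insert.prems unfolding sum.insert[OF insert.hyps] by simp
qed

section \<open>Cartan data of type \<open>A\<^sub>2\<close>\<close>

text \<open>
  The Cartan matrix of a Lie algebra is determined only at the indices of the simple roots, so nothing
  is said about its other entries.
\<close>

locale cartan_A2 =
  fixes a :: "nat \<Rightarrow> nat \<Rightarrow> int"
  assumes a_entry_A2: "i \<in> {1, 2} \<Longrightarrow> j \<in> {1, 2} \<Longrightarrow> a i j = entry_A2 i j"

sublocale cartan_A2 \<subseteq> cartan_datum 2 a .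

context cartan_A2
begin

lemma I_eq: "I = {1, 2}"
  by (auto simp: I_def)

lemma a_simps [simp]:
  "a (Suc 0) (Suc 0) = 2" "a 2 2 = 2" "a (Suc 0) 2 = -1" "a 2 (Suc 0) = -1"
  using a_entry_A2[of 1 1] a_entry_A2[of 1 2] a_entry_A2[of 2 1] a_entry_A2[of 2 2] by (simp_all add: entry_A2_def)

lemma symd_eq: "i \<in> I \<Longrightarrow> symd i = 1"
  unfolding symd_def
proof (rule Least_equality)
  assume "i \<in> I"
  then show "\<exists>d. (\<forall>j\<in>I. 0 < d j) \<and> (\<forall>j\<in>I. \<forall>k\<in>I. int (d j) * a j k = int (d k) * a k j) \<and> d i = 1"
    by (intro exI[of _ "\<lambda>_. 1"]) (auto simp: I_eq)
  show "1 \<le> n" if "\<exists>d. (\<forall>j\<in>I. 0 < d j) \<and> (\<forall>j\<in>I. \<forall>k\<in>I. int (d j) * a j k = int (d k) * a k j) \<and> d i = n" for n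
    using that \<open>i \<in> I\<close> by force
qed

lemma qi_eq: "i \<in> I \<Longrightarrow> qi i = qq"
  by (simp add: qi_def symd_eq)

lemma qint_eq: "i \<in> I \<Longrightarrow> qint i n = qnum (int n)"
  by (simp add: qint_def qnum_def qi_eq)

definition qfactorial :: "nat \<Rightarrow> qfield"
  where "qfactorial n = (\<Prod>k\<in>{1..n}. qnum (int k))"

lemma qfact_eq: "i \<in> I \<Longrightarrow> qfact i n = qfactorial n"
  by (simp add: qfact_def qfactorial_def qint_eq)

lemma qfactorial_Suc: "qfactorial (Suc n) = qfactorial n * qnum (int (Suc n))"
  by (simp add: qfactorial_def)

lemma qfactorial_small: "qfactorial 0 = 1" "qfactorial (Suc 0) = 1" "qfactorial 2 = qnum 2"
  by (simp_all add: qfactorial_def numeral_2_eq_2)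

lemma divpow_eq: "i \<in> I \<Longrightarrow> divpow X i n x = inverse (qfactorial n) \<cdot> (X i ^^ n) x"
  by (simp add: divpow_def qfact_eq)

text \<open>For \<open>a i j = - 1\<close> the Serre relation has three terms, and its divided powers share the factor \<open>[2]\<close>.\<close>

lemma serre_sum_eq:
  assumes "i \<in> I" "j \<in> I" "i \<noteq> j" "coord.subspace V" "linear_on V (X i)" "linear_on V (X j)" "x \<in> V"
  shows "(\<Sum>k\<in>{0..nat (1 - a i j)}.
       (-1) ^ k \<cdot> divpow X i k (X j (divpow X i (nat (1 - a i j) - k) x))) =
    inverse (qnum 2) \<cdot> (X j (X i (X i x)) - qnum 2 \<cdot> X i (X j (X i x)) + X i (X i (X j x)))"
proof -
  have n: "nat (1 - a i j) = 2" using assms by (auto simp: I_eq)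
  have s: "{0..2::nat} = {0, 1, 2}" by auto
  have d: "divpow X i 0 y = y" "divpow X i (Suc 0) y = X i y" "divpow X i 2 y = inverse (qnum 2) \<cdot> X i (X i y)" for y
    using assms(1) funpow_2[of "X i" y] by (simp_all add: divpow_eq qfactorial_small)
  have "X j (inverse (qnum 2) \<cdot> X i (X i x)) = inverse (qnum 2) \<cdot> X j (X i (X i x))"
    using assms linear_onD by metis
  moreover have "qnum 2 \<noteq> 0" by (simp add: qnum_nonzero)
  ultimately show ?thesis unfolding n s
    by (simp add: d coord.scale_right_distrib coord.scale_right_diff_distrib algebra_simps)
qed

end

section \<open>Modules described by a table\<close>

lemma check_strings_D:
  assumes "check_strings T" "i \<in> {1, 2}" "b < tsize T"
  shows "te T i b = None \<longleftrightarrow> teps T i b = 0" "tf T i b = None \<longleftrightarrow> tphi T i b = 0"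
    "te T i b = Some c \<Longrightarrow> c < tsize T \<and> tf T i c = Some b \<and> teps T i b = Suc (teps T i c)"
    "tf T i b = Some c \<Longrightarrow> c < tsize T \<and> te T i c = Some b \<and> tphi T i b = Suc (tphi T i c)"
proof -
  have *: "case te T i b of None \<Rightarrow> teps T i b = 0 | Some c \<Rightarrow> c < tsize T \<and> tf T i c = Some b \<and> teps T i b = Suc (teps T i c)"
     "case tf T i b of None \<Rightarrow> tphi T i b = 0 | Some c \<Rightarrow> c < tsize T \<and> te T i c = Some b \<and> tphi T i b = Suc (tphi T i c)"
    using list_allD[OF list_allD[OF assms(1)[unfolded check_strings_def], of i], of b] assms(2,3) by simp_all
  show "te T i b = None \<longleftrightarrow> teps T i b = 0" "tf T i b = None \<longleftrightarrow> tphi T i b = 0"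
    by (simp_all add: te_def tf_def)
  show "te T i b = Some c \<Longrightarrow> c < tsize T \<and> tf T i c = Some b \<and> teps T i b = Suc (teps T i c)" using *(1) by simp
  show "tf T i b = Some c \<Longrightarrow> c < tsize T \<and> te T i c = Some b \<and> tphi T i b = Suc (tphi T i c)" using *(2) by simp
qed

lemma table_weights:
  assumes "check_weights T" "i \<in> {1, 2}" "b < tsize T"
  shows "list_all (\<lambda>(c, n). c < b \<and> list_all (\<lambda>j. twt T c j = twt T b j + entry_A2 j i) [1, 2]) (ecol T i b)"
    "list_all (\<lambda>(c, n). c < tsize T \<and> list_all (\<lambda>j. twt T c j = twt T b j - entry_A2 j i) [1, 2]) (fcol T i b)"
  using list_allD[OF list_allD[OF assms(1)[unfolded check_weights_def], of i], of b] assms(2,3) by simp_all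

lemma table_col_bounds:
  assumes "check_weights T" "i \<in> {1, 2}" "b < tsize T"
  shows "list_all (\<lambda>(c, n). c < b) (ecol T i b)" "list_all (\<lambda>(c, n). c < tsize T) (fcol T i b)"
  by (rule list.pred_mono_strong[OF table_weights(1)[OF assms]], force)
    (rule list.pred_mono_strong[OF table_weights(2)[OF assms]], force)

text \<open>
  A vector space \<open>mspace M\<close> with basis \<open>g\<close> on which the generators act by the matrices of \<open>T\<close>. The
  relations between the generators are not among the assumptions: they follow from the checks.
\<close>

locale table_module = cartan_A2 +
  fixes T :: table and M :: uq_module and g :: "nat \<Rightarrow> qvec"
  assumes valid: "valid T"
    and sub: "coord.subspace (mspace M)"
    and lin_E: "i \<in> {1, 2} \<Longrightarrow> linear_on (mspace M) (Eop M i)"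
    and lin_F: "i \<in> {1, 2} \<Longrightarrow> linear_on (mspace M) (Fop M i)"
    and lin_K: "i \<in> {1, 2} \<Longrightarrow> linear_on (mspace M) (Kop M i)"
    and g_in: "b < tsize T \<Longrightarrow> g b \<in> mspace M"
    and g_span: "y \<in> mspace M \<Longrightarrow> \<exists>c. y = (\<Sum>b<tsize T. c b \<cdot> g b)"
    and g_indep: "(\<Sum>b<tsize T. c b \<cdot> g b) = 0 \<Longrightarrow> b < tsize T \<Longrightarrow> c b = 0"
    and E_g: "i \<in> {1, 2} \<Longrightarrow> b < tsize T \<Longrightarrow> Eop M i (g b) = lin g (qcol (ecol T i b))"
    and F_g: "i \<in> {1, 2} \<Longrightarrow> b < tsize T \<Longrightarrow> Fop M i (g b) = lin g (qcol (fcol T i b))"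
    and K_g: "i \<in> {1, 2} \<Longrightarrow> b < tsize T \<Longrightarrow> Kop M i (g b) = qq powi twt T b i \<cdot> g b"
begin

abbreviation "N \<equiv> tsize T"
abbreviation "V \<equiv> mspace M"

lemma checks: "check_weights T" "check_commutators T" "check_serre T" "check_strings T" "check_adapted T" "check_reach T"
  using valid by (auto simp: valid_def)

lemma col_bounds:
  assumes "i \<in> {1, 2}" "b < N"
  shows "list_all (\<lambda>(c, n). c < N) (ecol T i b)" "list_all (\<lambda>(c, n). c < N) (fcol T i b)"
  using table_col_bounds[OF checks(1) assms] assms(2)
  by (auto intro: list.pred_mono_strong)

lemma svec_bounds:
  assumes "list_all (\<lambda>(c, n). c < N) l"
  shows "list_all (\<lambda>(c, d). c < N) (qcol l)"
  using assms by (auto simp: qcol_def list_all_iff)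

lemma qcol_bounds:
  assumes "i \<in> {1, 2}" "b < N"
  shows "list_all (\<lambda>(c, n). c < N) (qcol (ecol T i b))" "list_all (\<lambda>(c, n). c < N) (qcol (fcol T i b))"
  using col_bounds[OF assms] svec_bounds by blast+

lemma sscale_bounds: "list_all (\<lambda>(c, n). c < N) l \<Longrightarrow> list_all (\<lambda>(c, n). c < N) (sscale d l)"
  by (auto simp: sscale_def list_all_iff)

lemma sapp_bounds:
  assumes "i \<in> {1, 2}" "list_all (\<lambda>(c, n). c < N) l"
  shows "list_all (\<lambda>(c, n). c < N) (sapp (ecol T i) l)" "list_all (\<lambda>(c, n). c < N) (sapp (fcol T i) l)"
  using assms(2) qcol_bounds[OF assms(1)] sscale_bounds by (induction l) auto

lemma E_lin: "i \<in> {1, 2} \<Longrightarrow> list_all (\<lambda>(c, n). c < N) l \<Longrightarrow> Eop M i (lin g l) = lin g (sapp (ecol T i) l)"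
  using lin_sapp[OF sub lin_E g_in E_g] by blast

lemma F_lin: "i \<in> {1, 2} \<Longrightarrow> list_all (\<lambda>(c, n). c < N) l \<Longrightarrow> Fop M i (lin g l) = lin g (sapp (fcol T i) l)"
  using lin_sapp[OF sub lin_F g_in F_g] by blast

lemma K_in: "i \<in> {1, 2} \<Longrightarrow> x \<in> V \<Longrightarrow> Kop M i x \<in> V"
  using linear_onD(1) lin_K by blast

lemma linear_eqI:
  assumes "linear_on V S" "linear_on V S'" "\<And>b. b < N \<Longrightarrow> S (g b) = S' (g b)" "y \<in> V"
  shows "S y = S' y"
proof -
  obtain c where "y = (\<Sum>b<N. c b \<cdot> g b)" using g_span assms(4) by blast
  then show ?thesis
    using linear_on_combination[OF sub assms(1), of "{..<N}" g c] g_in assms(3)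
      linear_on_combination[OF sub assms(2), of "{..<N}" g c] by simp
qed

lemma commutator_g:
  assumes "i \<in> {1, 2}" "j \<in> {1, 2}" "b < N"
  shows "Eop M i (Fop M j (g b)) - Fop M j (Eop M i (g b)) = (if i = j then qnum (twt T b i) else 0) \<cdot> g b"
proof -
  have "szero N (sapp (ecol T i) (qcol (fcol T j b)) @ sneg (sapp (fcol T j) (qcol (ecol T i b)))
       @ (if i = j then [(b, lint (- twt T b i))] else []))"
    using checks(2) assms unfolding check_commutators_def by (auto simp: list_all_iff)
  note lin_szero[OF this, of g]
  moreover have "Eop M i (Fop M j (g b)) = lin g (sapp (ecol T i) (qcol (fcol T j b)))"
    "Fop M j (Eop M i (g b)) = lin g (sapp (fcol T j) (qcol (ecol T i b)))"
    using assms by (simp_all only: E_g F_g E_lin F_lin qcol_bounds)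
  ultimately show ?thesis
    using group_rearrange(1)[of "Eop M i (Fop M j (g b))" "Fop M j (Eop M i (g b))" "- qnum (twt T b i) \<cdot> g b"]
      group_rearrange(3)[of "Eop M i (Fop M j (g b))" "Fop M j (Eop M i (g b))"]
    by (cases "i = j") (auto simp: qnum_minus smul_distribs)
qed

lemma serre_g:
  assumes "i \<in> {1, 2}" "j \<in> {1, 2}" "i \<noteq> j" "b < N"
  shows "Eop M j (Eop M i (Eop M i (g b))) - qnum 2 \<cdot> Eop M i (Eop M j (Eop M i (g b)))
      + Eop M i (Eop M i (Eop M j (g b))) = 0"
    "Fop M j (Fop M i (Fop M i (g b))) - qnum 2 \<cdot> Fop M i (Fop M j (Fop M i (g b)))
      + Fop M i (Fop M i (Fop M j (g b))) = 0"
proof -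
  have j: "j = 3 - i" using assms by auto
  have "szero N (sapp (col j) (sapp (col i) (qcol (col i b)))
       @ sneg (sscale (lqnum 2) (sapp (col i) (sapp (col j) (qcol (col i b)))))
       @ sapp (col i) (sapp (col i) (qcol (col j b))))" if "col = ecol T \<or> col = fcol T" for col
    using checks(3) assms that unfolding check_serre_def j by (auto simp: list_all_iff Let_def)
  note * = this[of "ecol T", THEN lin_szero, of g] this[of "fcol T", THEN lin_szero, of g]
  have "Eop M k (Eop M i (Eop M l (g b))) = lin g (sapp (ecol T k) (sapp (ecol T i) (qcol (ecol T l b))))"
    "Fop M k (Fop M i (Fop M l (g b))) = lin g (sapp (fcol T k) (sapp (fcol T i) (qcol (fcol T l b))))"
    "Eop M i (Eop M k (Eop M l (g b))) = lin g (sapp (ecol T i) (sapp (ecol T k) (qcol (ecol T l b))))"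
    "Fop M i (Fop M k (Fop M l (g b))) = lin g (sapp (fcol T i) (sapp (fcol T k) (qcol (fcol T l b))))"
    if "k \<in> {i, j}" "l \<in> {i, j}" for k l
    using assms that by (auto simp: E_g F_g E_lin F_lin qcol_bounds sapp_bounds)
  with * show "Eop M j (Eop M i (Eop M i (g b))) - qnum 2 \<cdot> Eop M i (Eop M j (Eop M i (g b)))
      + Eop M i (Eop M i (Eop M j (g b))) = 0"
    "Fop M j (Fop M i (Fop M i (g b))) - qnum 2 \<cdot> Fop M i (Fop M j (Fop M i (g b)))
      + Fop M i (Fop M i (Fop M j (g b))) = 0"
    by (simp_all only: lin_simps lin_sneg lin_sscale leval_lqnum insertI1 insertI2 of_nat_numeral refl disj_commute
        simp_thms group_rearrange(2))
qed

lemma weights_g: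
  assumes "i \<in> {1, 2}" "j \<in> {1, 2}" "b < N"
  shows "Kop M j (Eop M i (g b)) = qq powi (twt T b j + entry_A2 j i) \<cdot> Eop M i (g b)"
    "Kop M j (Fop M i (g b)) = qq powi (twt T b j - entry_A2 j i) \<cdot> Fop M i (g b)"
proof -
  have K: "Kop M j (lin g l) = qq powi w \<cdot> lin g l"
    if "list_all (\<lambda>(c, n). c < N \<and> twt T c j = w) l" for l :: svec and w
    using that
  proof (induction l)
    case Nil
    show ?case using linear_on_0[OF lin_K coord.subspace_0[OF sub]] assms(2)
      by (simp only: lin_simps smul_distribs)
  next
    case (Cons p l)
    obtain c d where p: "p = (c, d)" by force
    have *: "leval d \<cdot> g c \<in> V" "g c \<in> V" "lin g l \<in> V"
      using Cons.prems p g_in coord.subspace_scale[OF sub]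
      by (auto intro!: subspace_lin[OF sub g_in] simp: list_all_iff)
    have "Kop M j (lin g (p # l)) = leval d \<cdot> Kop M j (g c) + Kop M j (lin g l)"
      using linear_onD[OF lin_K[OF assms(2)]] * by (simp only: p lin_simps)
    also have "Kop M j (g c) = qq powi w \<cdot> g c" using K_g[OF assms(2)] Cons.prems p by auto
    also have "Kop M j (lin g l) = qq powi w \<cdot> lin g l" using Cons p by auto
    finally show ?case by (simp only: p lin_simps smul_distribs mult.commute)
  qed
  note * = table_weights[OF checks(1) assms(1,3)]
  have "list_all (\<lambda>(c, n). c < N \<and> twt T c j = twt T b j + entry_A2 j i) (qcol (ecol T i b))"
    "list_all (\<lambda>(c, n). c < N \<and> twt T c j = twt T b j - entry_A2 j i) (qcol (fcol T i b))"
    unfolding qcol_def list.pred_map comp_def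
    using assms(2,3) by (safe intro!: list.pred_mono_strong[OF *(1)] list.pred_mono_strong[OF *(2)]) auto
  from this[THEN K] show "Kop M j (Eop M i (g b)) = qq powi (twt T b j + entry_A2 j i) \<cdot> Eop M i (g b)"
    "Kop M j (Fop M i (g b)) = qq powi (twt T b j - entry_A2 j i) \<cdot> Fop M i (g b)"
    unfolding E_g[OF assms(1,3)] F_g[OF assms(1,3)] .
qed

lemma K_combination: "i \<in> {1, 2} \<Longrightarrow> Kop M i (\<Sum>b<N. c b \<cdot> g b) = (\<Sum>b<N. (qq powi twt T b i * c b) \<cdot> g b)"
  by (subst linear_on_combination[OF sub lin_K]) (auto simp: g_in K_g mult.commute intro!: sum.cong)

lemma combination_in: "(\<Sum>b<N. c b \<cdot> g b) \<in> V"
  by (intro subspace_combination[OF sub]) (auto simp: g_in)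

lemma g_coords_unique:
  assumes "(\<Sum>b<N. c b \<cdot> g b) = (\<Sum>b<N. d b \<cdot> g b)" "b < N"
  shows "c b = d b"
proof -
  have "(\<Sum>b<N. (c b - d b) \<cdot> g b) = 0"
    using assms(1) by (simp add: coord.scale_left_diff_distrib sum_subtractf)
  from g_indep[OF this assms(2)] show ?thesis by simp
qed

lemma K_inj: "i \<in> {1, 2} \<Longrightarrow> inj_on (Kop M i) V"
proof (rule inj_onI)
  fix x y assume *: "i \<in> {1, 2}" "x \<in> V" "y \<in> V" "Kop M i x = Kop M i y"
  obtain c d where cd: "x = (\<Sum>b<N. c b \<cdot> g b)" "y = (\<Sum>b<N. d b \<cdot> g b)" using g_span * by meson
  have "(\<Sum>b<N. (qq powi twt T b i * c b) \<cdot> g b) = (\<Sum>b<N. (qq powi twt T b i * d b) \<cdot> g b)"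
    using * cd K_combination by simp
  from g_coords_unique[OF this] have "c b = d b" if "b < N" for b using that by simp
  then show "x = y" unfolding cd by (intro sum.cong) auto
qed

lemma K_inverse:
  assumes "i \<in> {1, 2}"
  shows "inv_into V (Kop M i) (\<Sum>b<N. c b \<cdot> g b) = (\<Sum>b<N. (qq powi (- twt T b i) * c b) \<cdot> g b)"
proof (rule inv_into_f_eq[OF K_inj[OF assms] combination_in])
  show "Kop M i (\<Sum>b<N. (qq powi (- twt T b i) * c b) \<cdot> g b) = (\<Sum>b<N. c b \<cdot> g b)"
    using assms by (simp add: K_combination power_int_minus flip: mult.assoc)
qed

lemma K_bij: "i \<in> {1, 2} \<Longrightarrow> bij_betw (Kop M i) V V"
proof -
  assume i: "i \<in> {1, 2}"
  have "y \<in> Kop M i ` V" if y: "y \<in> V" for y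
  proof -
    obtain c where c: "y = (\<Sum>b<N. c b \<cdot> g b)" using g_span[OF y] by blast
    have "y = Kop M i (\<Sum>b<N. (qq powi (- twt T b i) * c b) \<cdot> g b)"
      using i c by (simp add: K_combination power_int_minus flip: mult.assoc)
    then show ?thesis using combination_in by (rule image_eqI)
  qed
  then show ?thesis using K_inj[OF i] K_in[OF i] by (auto simp: bij_betw_def)
qed

text \<open>All relations are linear, and on the basis they have been verified by computation.\<close>

lemma is_uq_module: "is_uq_module M"
proof -
  have K1: "Kop M j (c \<cdot> g b) = (c * qq powi twt T b j) \<cdot> g b"
    and E1: "Eop M j (c \<cdot> g b) = c \<cdot> Eop M j (g b)"
    and F1: "Fop M j (c \<cdot> g b) = c \<cdot> Fop M j (g b)" if "j \<in> {1, 2}" "b < N" for j b c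
    using linear_onD(3)[OF lin_K[OF that(1)] g_in[OF that(2)]] linear_onD(3)[OF lin_E[OF that(1)] g_in[OF that(2)]]
      linear_onD(3)[OF lin_F[OF that(1)] g_in[OF that(2)]] K_g[OF that] by simp_all
  have KK: "Kop M i (Kop M j x) = Kop M j (Kop M i x)" if ij: "i \<in> {1, 2}" "j \<in> {1, 2}" "x \<in> V" for i j x
  proof (rule linear_eqI[OF linear_on_compose[OF lin_K lin_K] linear_on_compose[OF lin_K lin_K] _ ij(3)])
    fix b assume b: "b < N"
    show "Kop M i (Kop M j (g b)) = Kop M j (Kop M i (g b))"
      unfolding K_g[OF ij(1) b] K_g[OF ij(2) b] K1[OF ij(1) b] K1[OF ij(2) b] by (simp only: mult.commute)
  qed (use ij in auto)
  have KE: "Kop M i (Eop M j x) = qi i powi (a i j) \<cdot> Eop M j (Kop M i x)"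
    and KF: "Kop M i (Fop M j x) = qi i powi (- a i j) \<cdot> Fop M j (Kop M i x)"
    if ij: "i \<in> {1, 2}" "j \<in> {1, 2}" "x \<in> V" for i j x
  proof -
    have aij: "a i j = entry_A2 i j" "qi i = qq" using ij a_entry_A2 qi_eq by (auto simp: I_eq)
    show "Kop M i (Eop M j x) = qi i powi (a i j) \<cdot> Eop M j (Kop M i x)" unfolding aij
    proof (rule linear_eqI[OF linear_on_compose[OF lin_K lin_E] linear_on_scale[OF sub linear_on_compose[OF lin_E lin_K]] _ ij(3)])
      fix b assume b: "b < N"
      show "Kop M i (Eop M j (g b)) = qq powi entry_A2 i j \<cdot> Eop M j (Kop M i (g b))"
        unfolding K_g[OF ij(1) b] E1[OF ij(2) b] weights_g[OF ij(2,1) b]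
        by (simp add: power_int_add mult.commute)
    qed (use ij in auto)
    show "Kop M i (Fop M j x) = qi i powi (- a i j) \<cdot> Fop M j (Kop M i x)" unfolding aij
    proof (rule linear_eqI[OF linear_on_compose[OF lin_K lin_F] linear_on_scale[OF sub linear_on_compose[OF lin_F lin_K]] _ ij(3)])
      fix b assume b: "b < N"
      show "Kop M i (Fop M j (g b)) = qq powi - entry_A2 i j \<cdot> Fop M j (Kop M i (g b))"
        unfolding K_g[OF ij(1) b] F1[OF ij(2) b] weights_g[OF ij(2,1) b]
        by (simp add: power_int_diff power_int_minus divide_inverse mult.commute)
    qed (use ij in auto)
  qed
  have EF: "Eop M i (Fop M j x) - Fop M j (Eop M i x) =
      (if i = j then inverse (qi i - inverse (qi i)) \<cdot> (Kop M i x - inv_into V (Kop M i) x) else 0)"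
    if ij: "i \<in> {1, 2}" "j \<in> {1, 2}" "x \<in> V" for i j x
  proof -
    obtain c where c: "x = (\<Sum>b<N. c b \<cdot> g b)" using g_span ij by blast
    have "Eop M i (Fop M j x) - Fop M j (Eop M i x) =
      (\<Sum>b<N. c b \<cdot> (Eop M i (Fop M j (g b)) - Fop M j (Eop M i (g b))))"
      unfolding c
      by (rule linear_on_combination[OF sub linear_on_diff[OF sub linear_on_compose[OF lin_E lin_F]
            linear_on_compose[OF lin_F lin_E]]]) (use ij g_in in auto)
    also have "\<dots> = (\<Sum>b<N. (c b * (if i = j then qnum (twt T b i) else 0)) \<cdot> g b)"
      using ij by (intro sum.cong) (auto simp: commutator_g)
    also have "\<dots> = (if i = j then inverse (qi i - inverse (qi i)) \<cdot> (Kop M i x - inv_into V (Kop M i) x) else 0)"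
    proof (cases "i = j")
      case True
      have "Kop M i x - inv_into V (Kop M i) x = (\<Sum>b<N. ((qq powi twt T b i - qq powi (- twt T b i)) * c b) \<cdot> g b)"
        unfolding c K_combination[OF ij(1)] K_inverse[OF ij(1)]
        by (simp add: sum_subtractf[symmetric] coord.scale_left_diff_distrib[symmetric] left_diff_distrib)
      moreover have "qi i = qq" using ij qi_eq by (auto simp: I_eq)
      ultimately show ?thesis using True
        by (simp add: coord.scale_sum_right qnum_def divide_inverse mult.commute mult.left_commute)
    qed simp
    finally show ?thesis .
  qed
  have S: "q_serre V (Eop M)" "q_serre V (Fop M)"
    unfolding q_serre_def
  proof safe
    fix i j x assume ij: "i \<in> I" "j \<in> I" "i \<noteq> j" "x \<in> V"
    then have ij': "i \<in> {1, 2}" "j \<in> {1, 2}" by (auto simp: I_eq)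
    have *: "linear_on V (\<lambda>x. X j (X i (X i x)) - qnum 2 \<cdot> X i (X j (X i x)) + X i (X i (X j x)))"
      if "linear_on V (X i)" "linear_on V (X j)" for X :: "nat \<Rightarrow> qvec \<Rightarrow> qvec"
      by (rule linear_on_add[OF sub linear_on_diff[OF sub
              linear_on_compose[OF that(2) linear_on_compose[OF that(1) that(1)]]
              linear_on_scale[OF sub linear_on_compose[OF that(1) linear_on_compose[OF that(2) that(1)]]]]
            linear_on_compose[OF that(1) linear_on_compose[OF that(1) that(2)]]])
    have z: "linear_on V (\<lambda>x. 0)" using sub by (auto simp: linear_on_def coord.subspace_0)
    show "(\<Sum>k\<in>{0..nat (1 - a i j)}.
       (-1) ^ k \<cdot> divpow (Eop M) i k (Eop M j (divpow (Eop M) i (nat (1 - a i j) - k) x))) = 0"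
      unfolding serre_sum_eq[OF ij(1-3) sub lin_E[OF ij'(1)] lin_E[OF ij'(2)] ij(4)]
      using linear_eqI[OF *[OF lin_E[OF ij'(1)] lin_E[OF ij'(2)]] z serre_g(1)[OF ij' ij(3)] ij(4)]
      by (simp only: coord.scale_zero_right)
    show "(\<Sum>k\<in>{0..nat (1 - a i j)}.
       (-1) ^ k \<cdot> divpow (Fop M) i k (Fop M j (divpow (Fop M) i (nat (1 - a i j) - k) x))) = 0"
      unfolding serre_sum_eq[OF ij(1-3) sub lin_F[OF ij'(1)] lin_F[OF ij'(2)] ij(4)]
      using linear_eqI[OF *[OF lin_F[OF ij'(1)] lin_F[OF ij'(2)]] z serre_g(2)[OF ij' ij(3)] ij(4)]
      by (simp only: coord.scale_zero_right)
  qed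
  have EF0: "Eop M i (Fop M j x) = Fop M j (Eop M i x)" if "i \<in> {1, 2}" "j \<in> {1, 2}" "x \<in> V" "i \<noteq> j" for i j x
    using EF[OF that(1-3)] that(4) by simp
  have EF1: "Eop M i (Fop M i x) - Fop M i (Eop M i x) =
      inverse (qi i - inverse (qi i)) \<cdot> (Kop M i x - inv_into V (Kop M i) x)" if "i \<in> {1, 2}" "x \<in> V" for i x
    using EF[OF that(1) that(1) that(2)] by (simp only: if_True refl)
  show ?thesis unfolding is_uq_module_def I_eq
    using sub lin_E lin_F lin_K K_bij KK KE KF EF0 EF1 S by simp
qed

end

section \<open>Bases adapted to strings, and irreducibility\<close>

lemma partial_shift_sum:
  fixes x :: "nat \<Rightarrow> qvec"
  assumes "\<And>b c. b < N \<Longrightarrow> h b = Some c \<Longrightarrow> c < N \<and> h' c = Some b"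
    and "\<And>b c. c < N \<Longrightarrow> h' c = Some b \<Longrightarrow> b < N \<and> h b = Some c"
  shows "(\<Sum>b<N. z b \<cdot> (case h b of None \<Rightarrow> 0 | Some c \<Rightarrow> k b \<cdot> x c)) =
    (\<Sum>c<N. (case h' c of None \<Rightarrow> 0 | Some b \<Rightarrow> z b * k b) \<cdot> x c)"
proof -
  have "(\<Sum>b<N. z b \<cdot> (case h b of None \<Rightarrow> 0 | Some c \<Rightarrow> k b \<cdot> x c)) =
      (\<Sum>b<N. \<Sum>c<N. if h b = Some c then (z b * k b) \<cdot> x c else 0)"
  proof (rule sum.cong[OF refl])
    fix b assume "b \<in> {..<N}"
    then show "z b \<cdot> (case h b of None \<Rightarrow> 0 | Some c \<Rightarrow> k b \<cdot> x c) =
      (\<Sum>c<N. if h b = Some c then (z b * k b) \<cdot> x c else 0)"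
      using assms(1)[of b] by (cases "h b") simp_all
  qed
  also have "\<dots> = (\<Sum>c<N. \<Sum>b<N. if h b = Some c then (z b * k b) \<cdot> x c else 0)"
    by (rule sum.swap)
  also have "\<dots> = (\<Sum>c<N. (case h' c of None \<Rightarrow> 0 | Some b \<Rightarrow> z b * k b) \<cdot> x c)"
  proof (rule sum.cong[OF refl])
    fix c assume c: "c \<in> {..<N}"
    show "(\<Sum>b<N. if h b = Some c then (z b * k b) \<cdot> x c else 0) =
      (case h' c of None \<Rightarrow> 0 | Some b \<Rightarrow> z b * k b) \<cdot> x c"
    proof (cases "h' c")
      case None
      then have "h b \<noteq> Some c" if "b < N" for b using assms(1) that by fastforce
      then show ?thesis using None by (simp add: sum.neutral)
    next
      case (Some b')
      then have b': "b' < N" "h b' = Some c" using assms(2) c by auto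
      have "h b = Some c \<longleftrightarrow> b = b'" if "b < N" for b
        using assms(1)[OF that] b' Some by auto
      then have "(\<Sum>b<N. if h b = Some c then (z b * k b) \<cdot> x c else 0) =
        (\<Sum>b<N. if b = b' then (z b * k b) \<cdot> x c else 0)" by (intro sum.cong) auto
      also have "\<dots> = (z b' * k b') \<cdot> x c" using b' by simp
      finally show ?thesis using Some by simp
    qed
  qed
  finally show ?thesis .
qed

context table_module
begin

definition ccoef :: "nat \<Rightarrow> nat \<Rightarrow> nat \<Rightarrow> qfield"
  where "ccoef i b p = (case tcor T i b of None \<Rightarrow> 0
    | Some (p', m, n) \<Rightarrow> if p' = p then qnum (int m) / qnum (int n) else 0)"

text \<open>
  For fixed \<open>i\<close> these vectors form a basis that consists of strings. It depends on \<open>i\<close>, and it agrees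
  with \<open>g\<close> modulo \<open>q\<close>.
\<close>

definition adapted :: "nat \<Rightarrow> nat \<Rightarrow> qvec"
  where "adapted i b = g b - (\<Sum>p<N. ccoef i b p \<cdot> g p)"

lemma correction:
  assumes "i \<in> {1, 2}" "b < N" "tcor T i b = Some (p, m, n)"
  shows "p < N" "m < n" "tcor T i p = None" "j \<in> {1, 2} \<Longrightarrow> twt T p j = twt T b j"
  using list_allD[OF list_allD[OF checks(5)[unfolded check_adapted_def], of i], of b] assms by auto

lemma ccoef_qreg: "i \<in> {1, 2} \<Longrightarrow> b < N \<Longrightarrow> ccoef i b p \<in> qreg"
  using correction(2)[of i b] by (auto simp: ccoef_def split: option.splits intro: qnum_ratio_qreg)

lemma adapted_None: "tcor T i b = None \<Longrightarrow> adapted i b = g b"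
  by (simp add: adapted_def ccoef_def)

lemma adapted_Some:
  assumes "i \<in> {1, 2}" "b < N" "tcor T i b = Some (p, m, n)"
  shows "adapted i b = g b - (qnum (int m) / qnum (int n)) \<cdot> g p"
proof -
  have "(\<Sum>p<N. ccoef i b p \<cdot> g p) = (\<Sum>p'<N. if p' = p then (qnum (int m) / qnum (int n)) \<cdot> g p else 0)"
    using assms(3) by (intro sum.cong) (auto simp: ccoef_def)
  then show ?thesis using correction(1)[OF assms] by (simp add: adapted_def)
qed

lemma tden_pos: "i \<in> {1, 2} \<Longrightarrow> b < N \<Longrightarrow> tden T i b > 0"
  using correction(2)[of i b] by (fastforce simp: tden_def split: option.splits)

lemma lin_tadapt:
  assumes "i \<in> {1, 2}" "b < N"
  shows "lin g (tadapt T i b) = qnum (int (tden T i b)) \<cdot> adapted i b"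
proof (cases "tcor T i b")
  case None
  then show ?thesis by (simp add: tadapt_def tden_def adapted_None)
next
  case (Some q)
  obtain p m n where q: "tcor T i b = Some (p, m, n)" using Some by (cases q) auto
  have "qnum (int n) \<noteq> 0" using correction(2)[OF assms q] by (simp add: qnum_nonzero)
  then show ?thesis unfolding adapted_Some[OF assms q] using q
    by (simp add: tadapt_def tden_def smul_distribs)
qed

lemma tadapt_bounds:
  assumes "i \<in> {1, 2}" "b < N"
  shows "list_all (\<lambda>(c, n). c < N) (tadapt T i b)"
  using correction(1)[OF assms] assms by (auto simp: tadapt_def split: option.splits)

lemma adapted_in: "i \<in> {1, 2} \<Longrightarrow> b < N \<Longrightarrow> adapted i b \<in> V"
  unfolding adapted_def
  by (intro coord.subspace_diff[OF sub] subspace_combination[OF sub]) (auto simp: g_in)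

lemma strings:
  assumes "i \<in> {1, 2}" "b < N"
  shows "int (tphi T i b) - int (teps T i b) = twt T b i"
    "te T i b = None \<longleftrightarrow> teps T i b = 0" "tf T i b = None \<longleftrightarrow> tphi T i b = 0"
    "te T i b = Some c \<Longrightarrow> c < N \<and> tf T i c = Some b \<and> teps T i b = Suc (teps T i c)"
    "tf T i b = Some c \<Longrightarrow> c < N \<and> te T i c = Some b \<and> tphi T i b = Suc (tphi T i c)"
  using list_allD[OF list_allD[OF checks(4)[unfolded check_strings_def], of i], of b] assms
    check_strings_D[OF checks(4) assms] by simp_all

lemma E_adapted:
  assumes "i \<in> {1, 2}" "b < N"
  shows "Eop M i (adapted i b) = (case te T i b of None \<Rightarrow> 0 | Some c \<Rightarrow> qnum (int (tphi T i b + 1)) \<cdot> adapted i c)"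
    "Fop M i (adapted i b) = (case tf T i b of None \<Rightarrow> 0 | Some c \<Rightarrow> qnum (int (teps T i b + 1)) \<cdot> adapted i c)"
proof -
  have z: "szero N (case te T i b of None \<Rightarrow> sapp (ecol T i) (tadapt T i b)
       | Some c \<Rightarrow> sscale (lqnum (tden T i c)) (sapp (ecol T i) (tadapt T i b)) @
           sneg (sscale (lmul (lqnum (tden T i b)) (lqnum (tphi T i b + 1))) (tadapt T i c)))"
     "szero N (case tf T i b of None \<Rightarrow> sapp (fcol T i) (tadapt T i b)
       | Some c \<Rightarrow> sscale (lqnum (tden T i c)) (sapp (fcol T i) (tadapt T i b)) @
           sneg (sscale (lmul (lqnum (tden T i b)) (lqnum (teps T i b + 1))) (tadapt T i c)))"
    using list_allD[OF list_allD[OF checks(5)[unfolded check_adapted_def], of i], of b] assms by auto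
  have d: "qnum (int (tden T i c)) \<noteq> 0" if "c < N" for c
    using tden_pos[OF assms(1) that] by (simp add: qnum_nonzero)
  have lE: "lin g (sapp (ecol T i) (tadapt T i b)) = qnum (int (tden T i b)) \<cdot> Eop M i (adapted i b)"
    using E_lin[OF assms(1) tadapt_bounds[OF assms]] linear_onD(3)[OF lin_E[OF assms(1)] adapted_in[OF assms]]
    by (simp only: lin_tadapt[OF assms])
  have lF: "lin g (sapp (fcol T i) (tadapt T i b)) = qnum (int (tden T i b)) \<cdot> Fop M i (adapted i b)"
    using F_lin[OF assms(1) tadapt_bounds[OF assms]] linear_onD(3)[OF lin_F[OF assms(1)] adapted_in[OF assms]]
    by (simp only: lin_tadapt[OF assms])
  have cancel: "u = k \<cdot> w" if "d' \<cdot> d \<cdot> u + - ((d * k) \<cdot> d' \<cdot> w) = 0" "d \<noteq> 0" "d' \<noteq> 0" for u w :: qvec and d d' k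
  proof -
    have "(d' * d) \<cdot> u = (d' * d) \<cdot> k \<cdot> w"
      using that(1) by (simp add: mult.commute mult.left_commute)
    then show ?thesis using that(2,3) by (metis coord.scale_left_imp_eq mult_eq_0_iff)
  qed
  show "Eop M i (adapted i b) = (case te T i b of None \<Rightarrow> 0 | Some c \<Rightarrow> qnum (int (tphi T i b + 1)) \<cdot> adapted i c)"
  proof (cases "te T i b")
    case None
    then show ?thesis using lin_szero[OF z(1), of g] lE d[OF assms(2)] by simp
  next
    case (Some c)
    then have c: "c < N" using strings(4)[OF assms] by simp
    show ?thesis using lin_szero[OF z(1), of g] d[OF assms(2)] d[OF c] Some
      by (auto intro!: cancel simp: lE lin_tadapt[OF assms(1) c] simp del: coord.scale_scale)
  qed
  show "Fop M i (adapted i b) = (case tf T i b of None \<Rightarrow> 0 | Some c \<Rightarrow> qnum (int (teps T i b + 1)) \<cdot> adapted i c)"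
  proof (cases "tf T i b")
    case None
    then show ?thesis using lin_szero[OF z(2), of g] lF d[OF assms(2)] by simp
  next
    case (Some c)
    then have c: "c < N" using strings(5)[OF assms] by simp
    show ?thesis using lin_szero[OF z(2), of g] d[OF assms(2)] d[OF c] Some
      by (auto intro!: cancel simp: lF lin_tadapt[OF assms(1) c] simp del: coord.scale_scale)
  qed
qed

lemma K_adapted:
  assumes "i \<in> {1, 2}" "j \<in> {1, 2}" "b < N"
  shows "Kop M j (adapted i b) = qq powi twt T b j \<cdot> adapted i b"
proof (cases "tcor T i b")
  case None
  then show ?thesis using assms by (simp add: adapted_None K_g)
next
  case (Some q)
  obtain p m n where q: "tcor T i b = Some (p, m, n)" using Some by (cases q) auto
  note p = correction[OF assms(1,3) q]
  have ad: "adapted i b = g b + (- (qnum (int m) / qnum (int n))) \<cdot> g p"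
    using adapted_Some[OF assms(1,3) q] by simp
  have "Kop M j (adapted i b) = Kop M j (g b) + (- (qnum (int m) / qnum (int n))) \<cdot> Kop M j (g p)"
    unfolding ad using linear_onD[OF lin_K[OF assms(2)]] g_in p(1) assms(3) coord.subspace_scale[OF sub]
    by metis
  also have "\<dots> = qq powi twt T b j \<cdot> adapted i b"
    unfolding ad K_g[OF assms(2,3)] K_g[OF assms(2) p(1)] p(4)[OF assms(2)]
    by (simp only: smul_distribs(1,3) mult.commute)
  finally show ?thesis .
qed

text \<open>
  A vector that is subtracted from another one is itself left unchanged. So the change of basis has the
  form \<open>1 - C\<close> with \<open>C\<^sup>2 = 0\<close>, and its inverse is \<open>1 + C\<close>.
\<close>

lemma ccoef_ccoef:
  assumes "i \<in> {1, 2}" "b < N" "ccoef i b p \<noteq> 0"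
  shows "tcor T i p = None" "ccoef i p p' = 0" "adapted i p = g p"
proof -
  show *: "tcor T i p = None"
    using assms correction(3)[OF assms(1,2)] by (auto simp: ccoef_def split: option.splits if_splits)
  show "ccoef i p p' = 0" using * by (simp add: ccoef_def)
  show "adapted i p = g p" using * by (rule adapted_None)
qed

lemma g_adapted:
  assumes "i \<in> {1, 2}" "b < N"
  shows "g b = adapted i b + (\<Sum>p<N. ccoef i b p \<cdot> adapted i p)"
proof -
  have "(\<Sum>p<N. ccoef i b p \<cdot> adapted i p) = (\<Sum>p<N. ccoef i b p \<cdot> g p)"
    using ccoef_ccoef(3)[OF assms] by (intro sum.cong refl) (metis coord.scale_zero_left)
  then show ?thesis by (simp add: adapted_def)
qed

text \<open>The coordinates in the adapted basis, according to the inverse \<open>1 + C\<close>.\<close>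

definition acoord :: "nat \<Rightarrow> (nat \<Rightarrow> qfield) \<Rightarrow> nat \<Rightarrow> qfield"
  where "acoord i c b = c b + (\<Sum>b'<N. c b' * ccoef i b' b)"

lemma combination_adapted:
  assumes "i \<in> {1, 2}"
  shows "(\<Sum>b<N. c b \<cdot> g b) = (\<Sum>b<N. acoord i c b \<cdot> adapted i b)"
proof -
  have "(\<Sum>b<N. c b \<cdot> g b) = (\<Sum>b<N. c b \<cdot> adapted i b + (\<Sum>p<N. (c b * ccoef i b p) \<cdot> adapted i p))"
    using assms g_adapted by (intro sum.cong) (auto simp: coord.scale_right_distrib coord.scale_sum_right)
  also have "\<dots> = (\<Sum>b<N. c b \<cdot> adapted i b) + (\<Sum>p<N. \<Sum>b<N. (c b * ccoef i b p) \<cdot> adapted i p)"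
    unfolding sum.distrib by (subst (2) sum.swap) (rule refl)
  also have "\<dots> = (\<Sum>b<N. acoord i c b \<cdot> adapted i b)"
    unfolding acoord_def coord.scale_left_distrib sum.distrib coord.scale_sum_left by (rule refl)
  finally show ?thesis .
qed

lemma adapted_combination:
  assumes "i \<in> {1, 2}"
  shows "(\<Sum>b<N. z b \<cdot> adapted i b) = (\<Sum>b<N. (z b - (\<Sum>b'<N. z b' * ccoef i b' b)) \<cdot> g b)"
proof -
  have "(\<Sum>b<N. z b \<cdot> adapted i b) = (\<Sum>b<N. z b \<cdot> g b - (\<Sum>p<N. (z b * ccoef i b p) \<cdot> g p))"
    by (intro sum.cong) (auto simp: adapted_def coord.scale_right_diff_distrib coord.scale_sum_right)
  also have "\<dots> = (\<Sum>b<N. z b \<cdot> g b) - (\<Sum>p<N. \<Sum>b<N. (z b * ccoef i b p) \<cdot> g p)"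
    unfolding sum_subtractf by (subst (2) sum.swap) (rule refl)
  also have "\<dots> = (\<Sum>b<N. (z b - (\<Sum>b'<N. z b' * ccoef i b' b)) \<cdot> g b)"
    unfolding coord.scale_left_diff_distrib sum_subtractf coord.scale_sum_left by (rule refl)
  finally show ?thesis .
qed

lemma adapted_indep:
  assumes "i \<in> {1, 2}" "(\<Sum>b<N. z b \<cdot> adapted i b) = 0" "b < N"
  shows "z b = 0"
proof -
  have z: "z b = (\<Sum>b'<N. z b' * ccoef i b' b)" if "b < N" for b
    using g_indep[OF assms(2)[unfolded adapted_combination[OF assms(1)]] that] by simp
  have z0: "z b = 0" if "b < N" "tcor T i b \<noteq> None" for b
  proof -
    have "ccoef i b' b = 0" if "b' < N" for b'
      using ccoef_ccoef(1)[OF assms(1) that, of b] \<open>tcor T i b \<noteq> None\<close> by auto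
    then show ?thesis using z[OF that(1)] by simp
  qed
  have "z b' * ccoef i b' b = 0" if "b' < N" for b'
    using z0[OF that] by (cases "tcor T i b'") (auto simp: ccoef_def)
  then have "(\<Sum>b'<N. z b' * ccoef i b' b) = 0" by (intro sum.neutral) simp
  then show ?thesis using z[OF assms(3)] by simp
qed

lemma acoord_reg0: "i \<in> {1, 2} \<Longrightarrow> b < N \<Longrightarrow> (\<And>b. b < N \<Longrightarrow> c b \<in> reg0) \<Longrightarrow> acoord i c b \<in> reg0"
  unfolding acoord_def by (intro reg0_add reg0_sum reg0_mult qreg_subset_reg0[OF ccoef_qreg]) auto

lemma acoord_minus_qreg: "i \<in> {1, 2} \<Longrightarrow> b < N \<Longrightarrow> (\<And>b. b < N \<Longrightarrow> c b \<in> reg0) \<Longrightarrow> acoord i c b - c b \<in> qreg"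
  unfolding acoord_def add_diff_cancel_left' by (intro qreg_sum qreg_mult ccoef_qreg) auto

lemma acoord_qreg: "i \<in> {1, 2} \<Longrightarrow> b < N \<Longrightarrow> (\<And>b. b < N \<Longrightarrow> c b \<in> qreg) \<Longrightarrow> acoord i c b \<in> qreg"
  unfolding acoord_def by (intro qreg_add qreg_sum qreg_mult ccoef_qreg qreg_subset_reg0) auto

lemma E_combination:
  assumes "i \<in> {1, 2}"
  shows "Eop M i (\<Sum>b<N. z b \<cdot> adapted i b) =
    (\<Sum>c<N. (case tf T i c of None \<Rightarrow> 0 | Some b \<Rightarrow> z b * qnum (int (tphi T i b + 1))) \<cdot> adapted i c)"
proof -
  have "Eop M i (\<Sum>b<N. z b \<cdot> adapted i b) = (\<Sum>b<N. z b \<cdot> Eop M i (adapted i b))"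
    by (rule linear_on_combination[OF sub lin_E[OF assms]]) (use assms adapted_in in auto)
  also have "\<dots> = (\<Sum>b<N. z b \<cdot> (case te T i b of None \<Rightarrow> 0 | Some c \<Rightarrow> qnum (int (tphi T i b + 1)) \<cdot> adapted i c))"
    using E_adapted(1)[OF assms] by (intro sum.cong) auto
  also have "\<dots> = (\<Sum>c<N. (case tf T i c of None \<Rightarrow> 0 | Some b \<Rightarrow> z b * qnum (int (tphi T i b + 1))) \<cdot> adapted i c)"
    by (rule partial_shift_sum) (use strings[OF assms] in blast)+
  finally show ?thesis .
qed

text \<open>
  \<open>E\<^sub>i\<close> sends distinct vectors of the adapted basis that are not at the top of a string to nonzero
  multiples of distinct vectors, so only the tops can occur in a vector that it annihilates.
\<close>

lemma E_kernel:
  assumes "i \<in> {1, 2}" "Eop M i (\<Sum>b<N. z b \<cdot> adapted i b) = 0" "b < N" "te T i b \<noteq> None"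
  shows "z b = 0"
proof -
  obtain c where c: "te T i b = Some c" using assms by auto
  then have "c < N" "tf T i c = Some b" using strings(4)[OF assms(1,3)] by auto
  moreover have "(case tf T i c of None \<Rightarrow> 0 | Some b \<Rightarrow> z b * qnum (int (tphi T i b + 1))) = 0"
    using assms(2) unfolding E_combination[OF assms(1)]
    by (rule adapted_indep[OF assms(1) _ \<open>c < N\<close>])
  ultimately show ?thesis by (simp add: qnum_nonzero)
qed

lemma reach:
  assumes "0 < b" "b < N"
  obtains i c where "i \<in> {1, 2}" "te T i b = Some c" "c < b" "adapted i b = g b" "adapted i c = g c"
proof -
  have "list_ex (\<lambda>i. case te T i b of None \<Rightarrow> False
     | Some c \<Rightarrow> c < b \<and> tcor T i b = None \<and> tcor T i c = None) [1, 2]"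
    using checks(6)[unfolded check_reach_def, THEN conjunct2, THEN list_allD, of b] assms by simp
  then obtain i where i: "i \<in> {1, 2}" "case te T i b of None \<Rightarrow> False
     | Some c \<Rightarrow> c < b \<and> tcor T i b = None \<and> tcor T i c = None" unfolding list_ex_iff by auto
  then obtain c where "te T i b = Some c" by (cases "te T i b") simp_all
  then show ?thesis using that[of i c] i adapted_None by simp
qed

lemma N_pos: "0 < N"
  using checks(6) by (simp add: check_reach_def)

text \<open>
  The reason is that the crystal has only one source. A singular vector without component at \<open>g 0\<close> can
  be scaled so that its coefficients are regular at \<open>q = 0\<close> and one of them, at \<open>d\<close> say, is 1. Modulo
  \<open>q\<close> its coefficients are its coordinates in each of the adapted bases. Since some string passes
  through \<open>d\<close> and does not begin there, the coordinate at \<open>d\<close> in the basis adapted to this string is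
  zero.
\<close>

lemma singular_vector:
  assumes "y \<in> V" "Eop M 1 y = 0" "Eop M 2 y = 0"
  shows "\<exists>c. y = c \<cdot> g 0"
proof -
  obtain c where c: "y = (\<Sum>b<N. c b \<cdot> g b)" using g_span assms by blast
  have "c b = 0" if "b \<noteq> 0" "b < N" for b
  proof (rule ccontr)
    assume "c b \<noteq> 0"
    then have "\<exists>b\<in>{0<..<N}. c b \<noteq> 0" using that by auto
    from reg0_dominating_coefficient[OF _ this] obtain d where
      d: "0 < d" "d < N" "c d \<noteq> 0" "\<And>b. 0 < b \<Longrightarrow> b < N \<Longrightarrow> c b / c d \<in> reg0" by auto
    \<comment> \<open>The multiple of \<open>g 0\<close> is removed, and the rest is divided by its dominating coefficient.\<close>
    define e where "e b = (if b = 0 then 0 else c b / c d)" for b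
    have e_reg0: "e b \<in> reg0" if "b < N" for b using d(4)[of b] that by (auto simp: e_def)
    define y' where "y' = (\<Sum>b<N. e b \<cdot> g b)"
    have y': "y' = inverse (c d) \<cdot> y + (- c 0 / c d) \<cdot> g 0"
    proof -
      have "y' = (\<Sum>b<N. (c b / c d) \<cdot> g b + (if b = 0 then (- c 0 / c d) \<cdot> g 0 else 0))"
        unfolding y'_def e_def by (intro sum.cong) (auto simp flip: coord.scale_left_distrib)
      also have "\<dots> = (\<Sum>b<N. (c b / c d) \<cdot> g b) + (- c 0 / c d) \<cdot> g 0"
        unfolding sum.distrib using N_pos by simp
      also have "(\<Sum>b<N. (c b / c d) \<cdot> g b) = inverse (c d) \<cdot> y"
        unfolding c by (simp add: coord.scale_sum_right divide_inverse mult.commute)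
      finally show ?thesis .
    qed
    obtain i c' where i: "i \<in> {1, 2}" "te T i d = Some c'" using reach[OF d(1,2)] by metis
    have "ecol T i 0 = []"
      using table_col_bounds(1)[OF checks(1) i(1) N_pos]
      by (cases "ecol T i 0") auto
    then have "Eop M i (g 0) = 0" using E_g[OF i(1) N_pos] by (simp add: qcol_def)
    moreover have "Eop M i y = 0" using assms i by auto
    moreover have "Eop M i y' = inverse (c d) \<cdot> Eop M i y + (- c 0 / c d) \<cdot> Eop M i (g 0)"
      using linear_onD(2,3)[OF lin_E[OF i(1)]] assms(1) g_in[OF N_pos] coord.subspace_scale[OF sub]
      unfolding y' by presburger
    ultimately have "Eop M i y' = 0" by (simp only: coord.scale_zero_right add_0)
    then have "acoord i e d = 0"
      unfolding y'_def combination_adapted[OF i(1)] using i d(2) by (intro E_kernel[of i]) auto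
    then have "- e d \<in> qreg" using acoord_minus_qreg[OF i(1) d(2) e_reg0, of "\<lambda>x. x"] by simp
    then have "1 \<in> qreg" using qreg_uminus[of "- e d"] d by (simp add: e_def)
    then show False using one_notin_qreg by simp
  qed
  then have "y = (\<Sum>b<N. if b = 0 then c 0 \<cdot> g 0 else 0)"
    unfolding c by (intro sum.cong) auto
  then have "y = c 0 \<cdot> g 0" using N_pos by simp
  then show ?thesis by blast
qed

text \<open>
  The \<open>E\<^sub>i\<close> lower the indices of basis vectors, so they can be applied to \<open>y\<close> only finitely often with a
  nonzero result.
\<close>

lemma exists_singular_vector:
  assumes "m \<le> N" "coord.subspace S" "\<And>i x. i \<in> {1, 2} \<Longrightarrow> x \<in> S \<Longrightarrow> Eop M i x \<in> S"
    and "y \<in> S" "y \<noteq> 0" "y \<in> coord.span (g ` {..<m})"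
  shows "\<exists>y\<in>S. y \<noteq> 0 \<and> Eop M 1 y = 0 \<and> Eop M 2 y = 0"
  using assms(1,4-)
proof (induction m arbitrary: y)
  case 0
  then show ?case by simp
next
  case (Suc m)
  have U: "y \<in> V \<and> Eop M i y \<in> coord.span (g ` {..<m})" if i: "i \<in> {1, 2}" for i
    using Suc.prems(4)
  proof (induction rule: coord.span_induct_alt)
    case base
    then show ?case
      using linear_on_0[OF lin_E[OF i] coord.subspace_0[OF sub]] coord.span_zero coord.subspace_0[OF sub] by simp
  next
    case (step c x z)
    from step(1) obtain b where "b \<in> {..<Suc m}" "x = g b" by blast
    then have b: "b \<le> m" "x = g b" by auto
    have bN: "b < N" using b Suc.prems by simp
    have zV: "z \<in> V" "c \<cdot> x + z \<in> V"
      using step(2) g_in[OF bN] b coord.subspace_add[OF sub] coord.subspace_scale[OF sub] by auto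
    then have "Eop M i (c \<cdot> x + z) = c \<cdot> Eop M i x + Eop M i z"
      using linear_onD[OF lin_E[OF i]] g_in[OF bN] coord.subspace_scale[OF sub] b by metis
    moreover have "Eop M i x \<in> coord.span (g ` {..<m})"
    proof -
      have "list_all (\<lambda>(c, n). c < m) (qcol (ecol T i b))" using b table_col_bounds(1)[OF checks(1) i bN]
        by (auto simp: qcol_def list_all_iff)
      then show ?thesis unfolding b E_g[OF i bN]
        by (rule subspace_lin[OF coord.subspace_span, rotated]) (auto intro: coord.span_base)
    qed
    ultimately show ?case using step zV by (auto intro: coord.span_add coord.span_scale)
  qed
  show ?case
  proof (cases "Eop M 1 y = 0 \<and> Eop M 2 y = 0")
    case True
    then show ?thesis using Suc.prems by blast
  next
    case False
    then obtain i where "i \<in> {1, 2}" "Eop M i y \<noteq> 0" by blast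
    then show ?thesis using Suc.IH[of "Eop M i y"] U Suc.prems assms(3) by simp
  qed
qed

lemma F_reach:
  assumes "0 < b" "b < N"
  obtains i c k where "i \<in> {1, 2}" "c < b" "g b = k \<cdot> Fop M i (g c)"
proof -
  obtain i c where i: "i \<in> {1, 2}" "te T i b = Some c" "c < b" "adapted i b = g b" "adapted i c = g c"
    using reach[OF assms] by blast
  have "tf T i c = Some b" using strings(4)[OF i(1) assms(2) i(2)] by simp
  then have "Fop M i (g c) = qnum (int (teps T i c + 1)) \<cdot> g b"
    using E_adapted(2)[of i c] i assms by simp
  then have "g b = inverse (qnum (int (teps T i c + 1))) \<cdot> Fop M i (g c)"
    by (simp add: qnum_nonzero)
  then show ?thesis using that i by blast
qed

lemma g_generates:
  assumes "coord.subspace S" "\<And>i x. i \<in> {1, 2} \<Longrightarrow> x \<in> S \<Longrightarrow> Fop M i x \<in> S" "g 0 \<in> S" "S \<subseteq> V"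
  shows "S = V"
proof -
  have gS: "g b \<in> S" if "b < N" for b
    using that
  proof (induction b rule: less_induct)
    case (less b)
    show ?case
    proof (cases "b = 0")
      case False
      then obtain i c k where "i \<in> {1, 2}" "c < b" "g b = k \<cdot> Fop M i (g c)" using F_reach less by blast
      then show ?thesis using less assms(1,2) by (simp add: coord.subspace_scale)
    qed (simp add: assms)
  qed
  have "y \<in> S" if y: "y \<in> V" for y
  proof -
    obtain c where "y = (\<Sum>b<N. c b \<cdot> g b)" using g_span[OF y] by blast
    then show ?thesis using subspace_combination[OF assms(1), of "{..<N}" g] gS by simp
  qed
  then show ?thesis using assms by blast
qed

lemma g_nonzero: "b < N \<Longrightarrow> g b \<noteq> 0"
proof
  assume *: "b < N" "g b = 0"
  have "(\<Sum>b'<N. (if b' = b then 1 else 0) \<cdot> g b') = (\<Sum>b'<N. if b' = b then g b' else 0)"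
    by (intro sum.cong) auto
  also have "\<dots> = 0" using * by simp
  finally have "(\<Sum>b'<N. (if b' = b then 1 else 0) \<cdot> g b') = 0" .
  from g_indep[OF this *(1)] show False by simp
qed

lemma irreducible: "irreducible_module M"
  unfolding irreducible_module_def
proof (intro conjI allI impI)
  show "is_uq_module M" by (rule is_uq_module)
  show "V \<noteq> {0}" using g_nonzero[OF N_pos] g_in[OF N_pos] by auto
  fix S assume S: "is_submodule M S"
  then have S': "coord.subspace S" "S \<subseteq> V" "\<And>i x. i \<in> {1, 2} \<Longrightarrow> x \<in> S \<Longrightarrow> Eop M i x \<in> S"
    "\<And>i x. i \<in> {1, 2} \<Longrightarrow> x \<in> S \<Longrightarrow> Fop M i x \<in> S" by (auto simp: is_submodule_def I_eq)
  show "S = {0} \<or> S = V"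
  proof (cases "S = {0}")
    case False
    then obtain y where y: "y \<in> S" "y \<noteq> 0" using coord.subspace_0[OF S'(1)] by blast
    then obtain c where c: "y = (\<Sum>b<N. c b \<cdot> g b)" using g_span S' by blast
    have "y \<in> coord.span (g ` {..<N})" unfolding c
      by (intro coord.span_sum coord.span_scale coord.span_base) auto
    from exists_singular_vector[OF order.refl S'(1,3) y this]
    obtain y' where y': "y' \<in> S" "y' \<noteq> 0" "Eop M 1 y' = 0" "Eop M 2 y' = 0" by blast
    then obtain c' where c': "y' = c' \<cdot> g 0" using singular_vector S'(2) by blast
    then have "c' \<noteq> 0" using y' by auto
    then have "g 0 = inverse c' \<cdot> y'" using c' by simp
    then have "g 0 \<in> S" using coord.subspace_scale[OF S'(1) y'(1)] by simp
    then show ?thesis using g_generates[OF S'(1,4) _ S'(2)] by simp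
  qed simp
qed

lemma hw_vector_g0: "hw_vector M (twt T 0) (g 0)"
proof -
  have "Eop M i (g 0) = 0" if i: "i \<in> {1, 2}" for i
  proof -
    have "ecol T i 0 = []"
      using table_col_bounds(1)[OF checks(1) i N_pos]
      by (cases "ecol T i 0") auto
    then show ?thesis using E_g[OF i N_pos] by (simp add: qcol_def)
  qed
  moreover have "Kop M i (g 0) = qi i powi twt T 0 i \<cdot> g 0" if "i \<in> {1, 2}" for i
    using K_g[OF that N_pos] qi_eq[of i] that by (simp add: I_eq)
  ultimately show ?thesis
    unfolding hw_vector_def wt_space_def I_eq using g_nonzero[OF N_pos] g_in[OF N_pos] by simp
qed

end

subsection \<open>Existence\<close>

definition unit :: "nat \<Rightarrow> qvec"
  where "unit b = (\<lambda>n. if n = b then 1 else 0)"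

definition seqs :: "nat \<Rightarrow> qvec set"
  where "seqs N = {x. \<forall>n\<ge>N. x n = 0}"

text \<open>The existence of a module with a given table: the columns of the table act on finite sequences.\<close>

definition model :: "table \<Rightarrow> uq_module" where
  "model T = \<lparr> mspace = seqs (tsize T),
     Kop = (\<lambda>i x. \<Sum>b<tsize T. x b \<cdot> qq powi twt T b i \<cdot> unit b),
     Eop = (\<lambda>i x. \<Sum>b<tsize T. x b \<cdot> lin unit (qcol (ecol T i b))),
     Fop = (\<lambda>i x. \<Sum>b<tsize T. x b \<cdot> lin unit (qcol (fcol T i b))) \<rparr>"

lemma subspace_seqs: "coord.subspace (seqs N)"
  by (auto simp: coord.subspace_def seqs_def smul_def plus_fun_def zero_fun_def)

lemma sum_fun_apply: "(\<Sum>b\<in>A. f b) n = (\<Sum>b\<in>A. f b n)" for f :: "'a \<Rightarrow> nat \<Rightarrow> 'b::comm_monoid_add"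
  by (induction A rule: infinite_finite_induct) (auto simp: plus_fun_def zero_fun_def)

lemma unit_combination: "(\<Sum>b<N. c b \<cdot> unit b) n = (if n < N then c n else 0)"
  by (auto simp: sum_fun_apply smul_def unit_def if_distrib[of "(*) _"] cong: if_cong)

lemma model_linear:
  assumes "\<And>b. b < N \<Longrightarrow> h b \<in> seqs N"
  shows "linear_on (seqs N) (\<lambda>x. \<Sum>b<N. x b \<cdot> h b)"
  using assms unfolding linear_on_def
  by (auto intro!: subspace_combination[OF subspace_seqs]
      simp: plus_fun_def[of _ "_ :: qvec"] coord.scale_left_distrib sum.distrib coord.scale_sum_right)
    (auto simp: smul_def fun_eq_iff sum_fun_apply plus_fun_def sum_distrib_left algebra_simps sum.distrib)

lemma unit_apply_combination:
  assumes "b < N"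
  shows "(\<Sum>b'<N. unit b b' \<cdot> h b') = (h b :: qvec)"
proof -
  have "(\<Sum>b'<N. unit b b' \<cdot> h b') = (\<Sum>b'<N. if b' = b then h b' else 0)"
    by (intro sum.cong) (auto simp: unit_def)
  then show ?thesis using assms by simp
qed

lemma (in cartan_A2) table_module_model:
  assumes "valid T"
  shows "table_module a T (model T) unit"
proof -
  have unit_in: "unit b \<in> seqs (tsize T)" if "b < tsize T" for b
    using that by (auto simp: unit_def seqs_def)
  have *: "check_weights T" using assms by (simp add: valid_def)
  have cols: "lin unit (qcol (ecol T i b)) \<in> seqs (tsize T)" "lin unit (qcol (fcol T i b)) \<in> seqs (tsize T)"
    if "i \<in> {1, 2}" "b < tsize T" for i b
  proof -
    have "list_all (\<lambda>(c, n). c < tsize T) (qcol (ecol T i b))" "list_all (\<lambda>(c, n). c < tsize T) (qcol (fcol T i b))"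
      using table_col_bounds[OF * that] that(2) unfolding qcol_def list_all_iff by fastforce+
    then show "lin unit (qcol (ecol T i b)) \<in> seqs (tsize T)" "lin unit (qcol (fcol T i b)) \<in> seqs (tsize T)"
      by (auto intro: subspace_lin[OF subspace_seqs unit_in])
  qed
  show ?thesis
  proof (unfold_locales, goal_cases)
    case 1 show ?case by (rule assms)
  next
    case 2 show ?case by (simp add: model_def subspace_seqs)
  next
    case 3 then show ?case by (simp add: model_def del: insert_iff One_nat_def) (intro model_linear cols)
  next
    case 4 then show ?case by (simp add: model_def del: insert_iff One_nat_def) (intro model_linear cols)
  next
    case 5 then show ?case
      by (simp add: model_def del: insert_iff One_nat_def coord.scale_scale)
        (intro model_linear coord.subspace_scale[OF subspace_seqs] unit_in)
  next
    case 6 then show ?case by (simp add: model_def unit_in)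
  next
    case (7 y)
    then have "y = (\<Sum>b<tsize T. y b \<cdot> unit b)"
      by (auto simp: fun_eq_iff unit_combination model_def seqs_def)
    then show ?case by blast
  next
    case (8 c b)
    then have "(\<Sum>b<tsize T. c b \<cdot> unit b) b = (0 :: qvec) b" by simp
    then show ?case using 8(2) unfolding unit_combination by (simp add: zero_fun_def)
  next
    case 9 then show ?case by (simp add: model_def unit_apply_combination)
  next
    case 10 then show ?case by (simp add: model_def unit_apply_combination)
  next
    case 11 then show ?case by (simp add: model_def unit_apply_combination del: coord.scale_scale)
  qed
qed

section \<open>Uniqueness of irreducible modules\<close>

text \<open>
  A formal combination of words in the \<open>F\<^sub>i\<close>, to be applied to a highest weight vector. The generators
  act on such combinations in a way that depends on the highest weight alone, and this is what relates
  two modules with the same highest weight.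
\<close>

type_synonym formal_sum = "(nat list \<times> qfield) list"

definition formal_scale :: "qfield \<Rightarrow> formal_sum \<Rightarrow> formal_sum"
  where "formal_scale d l = map (\<lambda>(w, c). (w, d * c)) l"

definition formal_F :: "nat \<Rightarrow> formal_sum \<Rightarrow> formal_sum"
  where "formal_F i l = map (\<lambda>(w, c). (i # w, c)) l"

definition word_vector :: "uq_module \<Rightarrow> qvec \<Rightarrow> nat list \<Rightarrow> qvec"
  where "word_vector M v w = foldr (Fop M) w v"

definition word_sum :: "uq_module \<Rightarrow> qvec \<Rightarrow> formal_sum \<Rightarrow> qvec"
  where "word_sum M v l = (\<Sum>(w, c)\<leftarrow>l. c \<cdot> word_vector M v w)"

definition formal_words :: "formal_sum \<Rightarrow> bool"
  where "formal_words l \<longleftrightarrow> (\<forall>(w, c)\<in>set l. set w \<subseteq> {1, 2})"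

definition word_weight :: "weight \<Rightarrow> nat list \<Rightarrow> nat \<Rightarrow> int"
  where "word_weight \<nu> w i = \<nu> i - (\<Sum>j\<leftarrow>w. entry_A2 i j)"

definition formal_K :: "weight \<Rightarrow> nat \<Rightarrow> formal_sum \<Rightarrow> formal_sum"
  where "formal_K \<nu> i l = map (\<lambda>(w, c). (w, qq powi word_weight \<nu> w i * c)) l"

definition formal_K_inv :: "weight \<Rightarrow> nat \<Rightarrow> formal_sum \<Rightarrow> formal_sum"
  where "formal_K_inv \<nu> i l = map (\<lambda>(w, c). (w, qq powi (- word_weight \<nu> w i) * c)) l"

text \<open>
  \<open>E\<^sub>i\<close> is moved through the word until it meets the highest weight vector. Each time it passes an
  \<open>F\<^sub>i\<close>, the commutator contributes the \<open>q\<close>-integer of the weight of the remaining word.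
\<close>

fun formal_E_word :: "weight \<Rightarrow> nat \<Rightarrow> nat list \<Rightarrow> formal_sum" where
  "formal_E_word \<nu> i [] = []"
| "formal_E_word \<nu> i (j # w) = formal_F j (formal_E_word \<nu> i w) @ (if i = j then [(w, qnum (word_weight \<nu> w i))] else [])"

definition formal_E :: "weight \<Rightarrow> nat \<Rightarrow> formal_sum \<Rightarrow> formal_sum"
  where "formal_E \<nu> i l = concat (map (\<lambda>(w, c). formal_scale c (formal_E_word \<nu> i w)) l)"

definition word_sum_comb :: "(nat \<Rightarrow> formal_sum) \<Rightarrow> (nat \<Rightarrow> qfield) \<Rightarrow> nat \<Rightarrow> formal_sum"
  where "word_sum_comb A c N = concat (map (\<lambda>b. formal_scale (c b) (A b)) [0..<N])"

lemma word_sum_simps [simp]: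
  "word_sum M v [] = 0" "word_sum M v ((w, c) # l) = c \<cdot> word_vector M v w + word_sum M v l"
  "word_sum M v (l @ l') = word_sum M v l + word_sum M v l'"
  by (simp_all add: word_sum_def)

lemma formal_words_simps [simp]:
  "formal_words []" "formal_words ((w, c) # l) \<longleftrightarrow> set w \<subseteq> {1, 2} \<and> formal_words l"
  "formal_words (l @ l') \<longleftrightarrow> formal_words l \<and> formal_words l'"
  by (auto simp: formal_words_def)

lemma formal_op_simps [simp]:
  "formal_scale d [] = []" "formal_scale d ((w, c) # l) = (w, d * c) # formal_scale d l"
  "formal_F i [] = []" "formal_F i ((w, c) # l) = (i # w, c) # formal_F i l"
  "formal_K \<nu> i [] = []" "formal_K \<nu> i ((w, c) # l) = (w, qq powi word_weight \<nu> w i * c) # formal_K \<nu> i l"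
  "formal_K_inv \<nu> i [] = []" "formal_K_inv \<nu> i ((w, c) # l) = (w, qq powi (- word_weight \<nu> w i) * c) # formal_K_inv \<nu> i l"
  "formal_E \<nu> i [] = []" "formal_E \<nu> i ((w, c) # l) = formal_scale c (formal_E_word \<nu> i w) @ formal_E \<nu> i l"
  by (simp_all add: formal_scale_def formal_F_def formal_K_def formal_K_inv_def formal_E_def)

lemma word_sum_formal_scale [simp]: "word_sum M v (formal_scale d l) = d \<cdot> word_sum M v l"
proof (induction l)
  case (Cons p l)
  then show ?case by (cases p) (simp add: coord.scale_right_distrib)
qed simp

lemma formal_words_formal_scale [simp]: "formal_words (formal_scale d l) \<longleftrightarrow> formal_words l"
  by (induction l) auto

lemma formal_words_formal_F: "i \<in> {1, 2} \<Longrightarrow> formal_words l \<Longrightarrow> formal_words (formal_F i l)"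
  by (induction l) auto

lemma formal_words_formal_K: "formal_words (formal_K \<nu> i l) \<longleftrightarrow> formal_words l" "formal_words (formal_K_inv \<nu> i l) \<longleftrightarrow> formal_words l"
  by (induction l) auto

lemma formal_words_formal_E_word: "i \<in> {1, 2} \<Longrightarrow> set w \<subseteq> {1, 2} \<Longrightarrow> formal_words (formal_E_word \<nu> i w)"
  by (induction w) (auto intro!: formal_words_formal_F)

lemma formal_words_formal_E: "i \<in> {1, 2} \<Longrightarrow> formal_words l \<Longrightarrow> formal_words (formal_E \<nu> i l)"
  by (induction l) (auto simp: formal_words_formal_E_word)

lemma word_sum_word_sum_comb: "word_sum M v (word_sum_comb A c N) = (\<Sum>b<N. c b \<cdot> word_sum M v (A b))"
  by (induction N) (auto simp: word_sum_comb_def add.commute)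

lemma formal_words_word_sum_comb: "(\<And>b. b < N \<Longrightarrow> formal_words (A b)) \<Longrightarrow> formal_words (word_sum_comb A c N)"
  by (induction N) (auto simp: word_sum_comb_def)

locale hw_module = cartan_A2 +
  fixes \<nu> :: weight and M :: uq_module and v :: qvec
  assumes uq: "is_uq_module M" and hw: "hw_vector M \<nu> v"
begin

abbreviation "V \<equiv> mspace M"

lemma sub: "coord.subspace V"
  and lin_E: "i \<in> {1, 2} \<Longrightarrow> linear_on V (Eop M i)"
  and lin_F: "i \<in> {1, 2} \<Longrightarrow> linear_on V (Fop M i)"
  and lin_K: "i \<in> {1, 2} \<Longrightarrow> linear_on V (Kop M i)"
  and bij_K: "i \<in> {1, 2} \<Longrightarrow> bij_betw (Kop M i) V V"
proof -
  note U = uq[unfolded is_uq_module_def I_eq]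
  show "coord.subspace V" using U by (rule conjunct1)
  have *: "\<forall>i\<in>{1, 2}. linear_on V (Kop M i) \<and> bij_betw (Kop M i) V V \<and>
      linear_on V (Eop M i) \<and> linear_on V (Fop M i)" using U by (elim conjE)
  show "linear_on V (Eop M i)" "linear_on V (Fop M i)" "linear_on V (Kop M i)" "bij_betw (Kop M i) V V"
    if "i \<in> {1, 2}" using bspec[OF * that] by simp_all
qed

lemma KF: "i \<in> {1, 2} \<Longrightarrow> j \<in> {1, 2} \<Longrightarrow> x \<in> V \<Longrightarrow> Kop M i (Fop M j x) = qq powi (- entry_A2 i j) \<cdot> Fop M j (Kop M i x)"
  using uq qi_eq[of i] a_entry_A2[of i j] unfolding is_uq_module_def I_eq by metis

lemma EF_neq: "i \<in> {1, 2} \<Longrightarrow> j \<in> {1, 2} \<Longrightarrow> x \<in> V \<Longrightarrow> i \<noteq> j \<Longrightarrow> Eop M i (Fop M j x) = Fop M j (Eop M i x)"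
  using uq unfolding is_uq_module_def I_eq by blast

lemma EF_eq: "i \<in> {1, 2} \<Longrightarrow> x \<in> V \<Longrightarrow> Eop M i (Fop M i x) =
    Fop M i (Eop M i x) + inverse (qq - inverse qq) \<cdot> (Kop M i x - inv_into V (Kop M i) x)"
proof -
  assume *: "i \<in> {1, 2}" "x \<in> V"
  then have "Eop M i (Fop M i x) - Fop M i (Eop M i x) =
    inverse (qi i - inverse (qi i)) \<cdot> (Kop M i x - inv_into V (Kop M i) x)"
    using uq unfolding is_uq_module_def I_eq by blast
  moreover have "qi i = qq" using * qi_eq[of i] by (simp add: I_eq)
  ultimately show ?thesis by (metis diff_add_cancel add.commute)
qed

lemma EF_weight:
  assumes "i \<in> {1, 2}" "x \<in> V" "Kop M i x = qq powi k \<cdot> x"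
  shows "Eop M i (Fop M i x) = Fop M i (Eop M i x) + qnum k \<cdot> x"
proof -
  have in_V: "qq powi (- k) \<cdot> x \<in> V" using coord.subspace_scale[OF sub assms(2)] .
  have "Kop M i (qq powi (- k) \<cdot> x) = x"
    using linear_onD(3)[OF lin_K[OF assms(1)] assms(2)] assms(3) by (simp add: power_int_minus)
  then have "inv_into V (Kop M i) x = qq powi (- k) \<cdot> x"
    using inv_into_f_eq[OF _ in_V] bij_K[OF assms(1)] by (auto simp: bij_betw_def)
  then show ?thesis unfolding EF_eq[OF assms(1,2)] assms(3)
    by (simp add: qnum_def divide_inverse mult.commute flip: coord.scale_left_diff_distrib)
qed

lemma v_in: "v \<in> V" and v_nonzero: "v \<noteq> 0"
  and E_v: "i \<in> {1, 2} \<Longrightarrow> Eop M i v = 0"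
  and K_v: "i \<in> {1, 2} \<Longrightarrow> Kop M i v = qq powi \<nu> i \<cdot> v"
  using hw qi_eq unfolding hw_vector_def wt_space_def I_eq by auto

lemma word_vector_in: "set w \<subseteq> {1, 2} \<Longrightarrow> word_vector M v w \<in> V"
  using linear_onD(1)[OF lin_F] by (induction w) (auto simp: word_vector_def v_in)

lemma word_sum_in: "formal_words l \<Longrightarrow> word_sum M v l \<in> V"
proof (induction l)
  case Nil
  then show ?case using coord.subspace_0[OF sub] by simp
next
  case (Cons p l)
  then show ?case using coord.subspace_add[OF sub] coord.subspace_scale[OF sub] word_vector_in
    by (cases p) simp
qed

lemma K_word_vector:
  assumes "i \<in> {1, 2}" "set w \<subseteq> {1, 2}"
  shows "Kop M i (word_vector M v w) = qq powi word_weight \<nu> w i \<cdot> word_vector M v w"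
  using assms(2)
proof (induction w)
  case Nil
  then show ?case using K_v[OF assms(1)] by (simp add: word_vector_def word_weight_def)
next
  case (Cons j w)
  have "word_vector M v (j # w) = Fop M j (word_vector M v w)" by (simp add: word_vector_def)
  moreover have "Kop M i (Fop M j (word_vector M v w)) = qq powi (- entry_A2 i j) \<cdot> Fop M j (qq powi word_weight \<nu> w i \<cdot> word_vector M v w)"
    using KF[of i j "word_vector M v w"] assms(1) Cons word_vector_in by simp
  moreover have "Fop M j (qq powi word_weight \<nu> w i \<cdot> word_vector M v w) = qq powi word_weight \<nu> w i \<cdot> Fop M j (word_vector M v w)"
    using linear_onD(3)[OF lin_F[of j]] Cons.prems word_vector_in by simp
  moreover have "qq powi (- entry_A2 i j) * qq powi word_weight \<nu> w i = qq powi word_weight \<nu> (j # w) i"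
    by (simp add: word_weight_def algebra_simps flip: power_int_add)
  ultimately show ?case by simp
qed

lemma F_word_sum:
  assumes "i \<in> {1, 2}" "formal_words l"
  shows "Fop M i (word_sum M v l) = word_sum M v (formal_F i l)"
  using assms(2)
proof (induction l)
  case Nil
  then show ?case using linear_on_0[OF lin_F[OF assms(1)] coord.subspace_0[OF sub]] by simp
next
  case (Cons p l)
  obtain w c where p: "p = (w, c)" by force
  have "Fop M i (c \<cdot> word_vector M v w + word_sum M v l) = c \<cdot> Fop M i (word_vector M v w) + Fop M i (word_sum M v l)"
    using Cons.prems p linear_onD(2,3)[OF lin_F[OF assms(1)]] word_sum_in word_vector_in coord.subspace_scale[OF sub] by simp
  then show ?case using Cons p by (simp add: word_vector_def)
qed

lemma K_word_sum:
  assumes "i \<in> {1, 2}" "formal_words l"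
  shows "Kop M i (word_sum M v l) = word_sum M v (formal_K \<nu> i l)"
  using assms(2)
proof (induction l)
  case Nil
  then show ?case using linear_on_0[OF lin_K[OF assms(1)] coord.subspace_0[OF sub]] by simp
next
  case (Cons p l)
  obtain w c where p: "p = (w, c)" by force
  have "Kop M i (c \<cdot> word_vector M v w + word_sum M v l) = c \<cdot> Kop M i (word_vector M v w) + Kop M i (word_sum M v l)"
    using Cons.prems p linear_onD(2,3)[OF lin_K[OF assms(1)]] word_sum_in word_vector_in coord.subspace_scale[OF sub] by simp
  then show ?case using Cons p K_word_vector[OF assms(1), of w] by (simp add: mult.commute)
qed

lemma E_word_vector:
  assumes "i \<in> {1, 2}" "set w \<subseteq> {1, 2}"
  shows "Eop M i (word_vector M v w) = word_sum M v (formal_E_word \<nu> i w)"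
  using assms(2)
proof (induction w)
  case Nil
  then show ?case using E_v[OF assms(1)] by (simp add: word_vector_def)
next
  case (Cons j w)
  then have j: "j \<in> {1, 2}" and w: "set w \<subseteq> {1, 2}" by auto
  have *: "word_vector M v (j # w) = Fop M j (word_vector M v w)" by (simp add: word_vector_def)
  have F: "Fop M j (Eop M i (word_vector M v w)) = word_sum M v (formal_F j (formal_E_word \<nu> i w))"
    using Cons.IH[OF w] F_word_sum[OF j formal_words_formal_E_word[OF assms(1) w]] by simp
  show ?case
  proof (cases "i = j")
    case True
    then show ?thesis
      using EF_weight[OF assms(1) word_vector_in[OF w] K_word_vector[OF assms(1) w]] F * by simp
  next
    case False
    then show ?thesis using EF_neq[OF assms(1) j word_vector_in[OF w]] F * by simp
  qed
qed

lemma E_word_sum: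
  assumes "i \<in> {1, 2}" "formal_words l"
  shows "Eop M i (word_sum M v l) = word_sum M v (formal_E \<nu> i l)"
  using assms(2)
proof (induction l)
  case Nil
  then show ?case using linear_on_0[OF lin_E[OF assms(1)] coord.subspace_0[OF sub]] by simp
next
  case (Cons p l)
  obtain w c where p: "p = (w, c)" by force
  have "Eop M i (c \<cdot> word_vector M v w + word_sum M v l) = c \<cdot> Eop M i (word_vector M v w) + Eop M i (word_sum M v l)"
    using Cons.prems p linear_onD(2,3)[OF lin_E[OF assms(1)]] word_sum_in word_vector_in coord.subspace_scale[OF sub] by simp
  then show ?case using Cons p E_word_vector[OF assms(1), of w] by simp
qed

text \<open>
  The product of the operators \<open>K\<^sub>1 K\<^sub>2 - q\<^sup>h\<^sup>-\<^sup>k\<close> over \<open>k = 1, \<dots>, n\<close>, where \<open>q\<^sup>h\<close> is the eigenvalue of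
  \<open>K\<^sub>1 K\<^sub>2\<close> at the highest weight vector. As each \<open>F\<^sub>j\<close> divides eigenvalues of \<open>K\<^sub>1 K\<^sub>2\<close> by \<open>q\<close>, the
  product annihilates the words of length \<open>1, \<dots>, n\<close>; the highest weight vector survives.
\<close>

fun kill :: "nat \<Rightarrow> qvec \<Rightarrow> qvec" where
  "kill 0 y = y"
| "kill (Suc n) y = Kop M 1 (Kop M 2 (kill n y)) - qq powi (\<nu> 1 + \<nu> 2 - int (Suc n)) \<cdot> kill n y"

lemma kill_linear: "linear_on V (kill n)"
proof (induction n)
  case 0
  then show ?case using linear_on_id by (simp add: linear_on_def)
next
  case (Suc n)
  have "linear_on V (\<lambda>y. Kop M 1 (Kop M 2 (kill n y)) - qq powi (\<nu> 1 + \<nu> 2 - int (Suc n)) \<cdot> kill n y)"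
    by (rule linear_on_diff[OF sub linear_on_compose[OF lin_K linear_on_compose[OF lin_K Suc]] linear_on_scale[OF sub Suc]])
      simp_all
  then show ?case by (simp add: linear_on_def)
qed

lemma kill_word_vector:
  assumes "set w \<subseteq> {1, 2}"
  shows "kill n (word_vector M v w) =
    (\<Prod>k\<in>{1..n}. qq powi (\<nu> 1 + \<nu> 2 - int (length w)) - qq powi (\<nu> 1 + \<nu> 2 - int k)) \<cdot> word_vector M v w"
proof (induction n)
  case (Suc n)
  let ?p = "\<Prod>k\<in>{1..n}. qq powi (\<nu> 1 + \<nu> 2 - int (length w)) - qq powi (\<nu> 1 + \<nu> 2 - int k)"
  have s: "(\<Sum>j\<leftarrow>w. entry_A2 1 j) + (\<Sum>j\<leftarrow>w. entry_A2 2 j) = int (length w)"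
    using assms by (induction w) (auto simp: entry_A2_def)
  have K: "Kop M i (c \<cdot> word_vector M v w) = (c * qq powi word_weight \<nu> w i) \<cdot> word_vector M v w" if "i \<in> {1, 2}" for i c
    using linear_onD(3)[OF lin_K[OF that] word_vector_in[OF assms]] K_word_vector[OF that assms] by simp
  have "Kop M 1 (Kop M 2 (?p \<cdot> word_vector M v w)) = (?p * (qq powi word_weight \<nu> w 2 * qq powi word_weight \<nu> w 1)) \<cdot> word_vector M v w"
    using K[of 1] K[of 2] by (simp add: mult.assoc)
  also have "qq powi word_weight \<nu> w 2 * qq powi word_weight \<nu> w 1 = qq powi (\<nu> 1 + \<nu> 2 - int (length w))"
    unfolding power_int_add[symmetric, OF disjI1[OF qq_nonzero]] using s
    by (simp add: word_weight_def algebra_simps)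
  finally have "kill (Suc n) (word_vector M v w) =
    (?p * qq powi (\<nu> 1 + \<nu> 2 - int (length w)) - qq powi (\<nu> 1 + \<nu> 2 - int (Suc n)) * ?p) \<cdot> word_vector M v w"
    unfolding kill.simps Suc.IH by (simp only: coord.scale_left_diff_distrib coord.scale_scale)
  moreover have "(\<Prod>k\<in>{1..Suc n}. qq powi (\<nu> 1 + \<nu> 2 - int (length w)) - qq powi (\<nu> 1 + \<nu> 2 - int k)) =
      ?p * (qq powi (\<nu> 1 + \<nu> 2 - int (length w)) - qq powi (\<nu> 1 + \<nu> 2 - int (Suc n)))"
    by (subst prod.nat_ivl_Suc', simp, rule mult.commute)
  ultimately show ?case by (simp only: right_diff_distrib mult.commute[of _ ?p])
qed simp

lemma lower_independent:
  assumes "formal_words l" "\<forall>(w, c)\<in>set l. w \<noteq> []" "c \<cdot> v + word_sum M v l = 0"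
  shows "c = 0"
proof -
  obtain n where n: "\<And>w c. (w, c) \<in> set l \<Longrightarrow> length w \<le> n"
    using finite_nat_set_iff_bounded_le[of "(\<lambda>(w, c). length w) ` set l"] by force
  have "kill n (word_sum M v l) = 0"
    using assms(1,2) n
  proof (induction l)
    case Nil
    then show ?case using linear_on_0[OF kill_linear coord.subspace_0[OF sub]] by simp
  next
    case (Cons p l)
    obtain w c where p: "p = (w, c)" by force
    have w: "set w \<subseteq> {1, 2}" "1 \<le> length w" "length w \<le> n" "formal_words l" using Cons.prems p by (auto simp: Suc_le_eq)
    have "kill n (c \<cdot> word_vector M v w + word_sum M v l) = c \<cdot> kill n (word_vector M v w) + kill n (word_sum M v l)"
      using w linear_onD(2,3)[OF kill_linear] word_sum_in word_vector_in coord.subspace_scale[OF sub] by simp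
    moreover have "kill n (word_vector M v w) = 0"
      unfolding kill_word_vector[OF w(1)] using w(2,3) by (auto intro!: prod_zero bexI[of _ "length w"])
    moreover have "kill n (word_sum M v l) = 0" using Cons p by auto
    ultimately show ?case by (simp add: p)
  qed
  moreover have "kill n (c \<cdot> v + word_sum M v l) = c \<cdot> kill n v + kill n (word_sum M v l)"
    using linear_onD(2,3)[OF kill_linear] word_sum_in[OF assms(1)] v_in coord.subspace_scale[OF sub] by simp
  moreover have "kill n 0 = 0" using linear_on_0[OF kill_linear coord.subspace_0[OF sub]] .
  ultimately have "c \<cdot> kill n v = 0" using assms(3) by simp
  moreover have "kill n v = (\<Prod>k\<in>{1..n}. qq powi (\<nu> 1 + \<nu> 2) - qq powi (\<nu> 1 + \<nu> 2 - int k)) \<cdot> v"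
    using kill_word_vector[of "[]" n] by (simp add: word_vector_def)
  moreover have "(\<Prod>k\<in>{1..n}. qq powi (\<nu> 1 + \<nu> 2) - qq powi (\<nu> 1 + \<nu> 2 - int k)) \<noteq> 0"
    by (simp add: qq_powi_inject)
  ultimately show ?thesis using v_nonzero by simp
qed

lemma word_sum_top:
  "word_sum M v l = (\<Sum>(w, c)\<leftarrow>l. if w = [] then c else 0) \<cdot> v + word_sum M v (filter (\<lambda>(w, c). w \<noteq> []) l)"
proof (induction l)
  case (Cons p l)
  obtain w c where p: "p = (w, c)" by force
  show ?case using Cons by (simp add: p word_vector_def coord.scale_left_distrib algebra_simps)
qed simp

text \<open>
  The inverses of the \<open>K\<^sub>i\<close> are required because a submodule is mapped onto itself by each \<open>K\<^sub>i\<close>.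
\<close>

lemma submodule_word_sum:
  assumes "\<And>l l'. P l \<Longrightarrow> P l' \<Longrightarrow> P (l @ l')" "\<And>l c. P l \<Longrightarrow> P (formal_scale c l)" "P []"
    and "\<And>i l. i \<in> {1, 2} \<Longrightarrow> P l \<Longrightarrow> P (formal_F i l) \<and> P (formal_E \<nu> i l) \<and> P (formal_K \<nu> i l) \<and> P (formal_K_inv \<nu> i l)"
    and "\<And>l. P l \<Longrightarrow> formal_words l"
  shows "is_submodule M {word_sum M v l |l. P l}" (is "is_submodule M ?S")
proof -
  have "coord.subspace ?S"
    unfolding coord.subspace_def
  proof safe
    show "\<exists>l. 0 = word_sum M v l \<and> P l" using assms(3) by (intro exI[of _ "[]"]) simp
    show "\<exists>l''. word_sum M v l + word_sum M v l' = word_sum M v l'' \<and> P l''" if "P l" "P l'" for l l'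
      using that assms(1) by (intro exI[of _ "l @ l'"]) simp
    show "\<exists>l'. c \<cdot> word_sum M v l = word_sum M v l' \<and> P l'" if "P l" for c l
      using that assms(2) by (intro exI[of _ "formal_scale c l"]) simp
  qed
  moreover have "?S \<subseteq> V" using word_sum_in assms(5) by blast
  moreover have "Kop M i ` ?S = ?S \<and> Eop M i ` ?S \<subseteq> ?S \<and> Fop M i ` ?S \<subseteq> ?S" if i: "i \<in> {1, 2}" for i
  proof (intro conjI subset_antisym)
    show "Kop M i ` ?S \<subseteq> ?S" "Eop M i ` ?S \<subseteq> ?S" "Fop M i ` ?S \<subseteq> ?S"
      using assms(4)[OF i] assms(5) K_word_sum[OF i] E_word_sum[OF i] F_word_sum[OF i] by blast+
    show "?S \<subseteq> Kop M i ` ?S"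
    proof safe
      fix l assume l: "P l"
      have "word_sum M v (formal_K \<nu> i (formal_K_inv \<nu> i l)) = word_sum M v l"
      proof (induction l)
        case (Cons p l)
        then show ?case by (cases p) (simp add: power_int_minus flip: mult.assoc)
      qed simp
      then have "word_sum M v l = Kop M i (word_sum M v (formal_K_inv \<nu> i l))"
        using K_word_sum[OF i] assms(4)[OF i l] assms(5) by metis
      then show "word_sum M v l \<in> Kop M i ` ?S" using assms(4)[OF i l] by blast
    qed
  qed
  ultimately show ?thesis unfolding is_submodule_def I_eq by simp
qed

text \<open>
  The values in \<open>M\<close> of those combinations that vanish in \<open>M'\<close> form a submodule. The highest weight
  vector is not among them, because the coefficient of the empty word can be recovered in both modules.
  By irreducibility this submodule is zero.
\<close>

lemma word_sum_zero_transfer: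
  assumes "irreducible_module M" "hw_module a \<nu> M' v'" "formal_words l" "word_sum M' v' l = 0"
  shows "word_sum M v l = 0"
proof -
  interpret M': hw_module a \<nu> M' v' by (rule assms)
  define P where "P l \<longleftrightarrow> formal_words l \<and> word_sum M' v' l = 0" for l
  let ?S = "{word_sum M v l |l. P l}"
  have 0: "Fop M' i 0 = 0" "Eop M' i 0 = 0" "Kop M' i 0 = 0" if "i \<in> {1, 2}" for i
    by (rule linear_on_0[OF M'.lin_F[OF that] coord.subspace_0[OF M'.sub]]
        linear_on_0[OF M'.lin_E[OF that] coord.subspace_0[OF M'.sub]]
        linear_on_0[OF M'.lin_K[OF that] coord.subspace_0[OF M'.sub]])+
  have K': "word_sum M' v' (formal_K_inv \<nu> i l) = 0" if "i \<in> {1, 2}" "P l" for i l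
  proof -
    have "word_sum M' v' (formal_K \<nu> i (formal_K_inv \<nu> i l)) = word_sum M' v' l"
    proof (induction l)
      case (Cons p l)
      then show ?case by (cases p) (simp add: power_int_minus flip: mult.assoc)
    qed simp
    then have "Kop M' i (word_sum M' v' (formal_K_inv \<nu> i l)) = Kop M' i 0"
      using that M'.K_word_sum[OF that(1), of "formal_K_inv \<nu> i l"] 0 by (simp add: P_def formal_words_formal_K)
    then show ?thesis using M'.bij_K[OF that(1)] M'.word_sum_in[of "formal_K_inv \<nu> i l"] that(2) coord.subspace_0[OF M'.sub]
      by (auto simp: bij_betw_def inj_on_def P_def formal_words_formal_K)
  qed
  have "is_submodule M ?S"
  proof (rule submodule_word_sum[where P = P])
    show "P (formal_F i l) \<and> P (formal_E \<nu> i l) \<and> P (formal_K \<nu> i l) \<and> P (formal_K_inv \<nu> i l)" if "i \<in> {1, 2}" "P l" for i l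
      using K'[OF that] that 0[OF that(1)] M'.F_word_sum[OF that(1), of l] M'.E_word_sum[OF that(1), of l] M'.K_word_sum[OF that(1), of l]
        formal_words_formal_F[OF that(1)] formal_words_formal_E[OF that(1)] by (simp add: P_def formal_words_formal_K)
  qed (auto simp: P_def)
  then have "?S = {0} \<or> ?S = V" using assms(1) by (simp add: irreducible_module_def)
  moreover have "?S \<noteq> V"
  proof
    assume "?S = V"
    then obtain l where l: "v = word_sum M v l" "formal_words l" "word_sum M' v' l = 0" using v_in by (auto simp: P_def)
    \<comment> \<open>The empty word is separated from the others, which give lower weights.\<close>
    let ?c = "\<Sum>(w, c)\<leftarrow>l. if w = [] then c else 0" and ?l = "filter (\<lambda>(w, c). w \<noteq> []) l"
    have ne: "formal_words ?l" "\<forall>(w, c)\<in>set ?l. w \<noteq> []" using l(2) by (auto simp: formal_words_def)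
    have "?c = 0" using M'.lower_independent[OF ne] M'.word_sum_top[of l] l(3) by simp
    then have "v = word_sum M v ?l" using word_sum_top[of l] l(1) by simp
    then have "(-1) \<cdot> v + word_sum M v ?l = 0" by simp
    from lower_independent[OF ne this] show False by simp
  qed
  ultimately show ?thesis using assms by (auto simp: P_def)
qed

end

context table_module
begin

lemma hw_module: "hw_module a (twt T 0) M (g 0)"
  by (rule hw_module.intro[OF cartan_A2_axioms hw_module_axioms.intro[OF is_uq_module hw_vector_g0]])

text \<open>
  Since the same formal combinations vanish in both modules, sending the value of a combination in \<open>M\<close>
  to its value in \<open>M'\<close> is an isomorphism. The basis \<open>g'\<close> is the image of \<open>g\<close>.
\<close>

lemma transport:
  assumes "irreducible_module M'" "hw_vector M' (twt T 0) v'"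
  shows "\<exists>g'. table_module a T M' g' \<and> g' 0 = v'"
proof -
  interpret M: hw_module a "twt T 0" M "g 0" by (rule hw_module)
  interpret M': hw_module a "twt T 0" M' v'
    by (rule hw_module.intro[OF cartan_A2_axioms hw_module_axioms.intro[OF _ assms(2)]],
        rule conjunct1[OF assms(1)[unfolded irreducible_module_def]])
  have zero: "word_sum M (g 0) l = 0 \<longleftrightarrow> word_sum M' v' l = 0" if "formal_words l" for l
    using M.word_sum_zero_transfer[OF irreducible M'.hw_module_axioms that]
      M'.word_sum_zero_transfer[OF assms(1) hw_module that] by blast
  have eq: "word_sum M (g 0) l = word_sum M (g 0) l' \<longleftrightarrow> word_sum M' v' l = word_sum M' v' l'" if "formal_words l" "formal_words l'" for l l'
    using zero[of "l @ formal_scale (-1) l'"] that by simp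
  have span: "\<exists>l. formal_words l \<and> y = word_sum M'' v'' l"
    if "hw_module a (twt T 0) M'' v''" "irreducible_module M''" "y \<in> mspace M''" for M'' v'' y
  proof -
    interpret X: hw_module a "twt T 0" M'' v'' by (rule that)
    have "is_submodule M'' {word_sum M'' v'' l |l. formal_words l}"
      by (rule X.submodule_word_sum) (auto simp: formal_words_formal_F formal_words_formal_E formal_words_formal_K)
    moreover have "v'' \<in> {word_sum M'' v'' l |l. formal_words l}"
      by (auto intro!: exI[of _ "[([], 1)]"] simp: word_vector_def)
    ultimately show ?thesis using that(2,3) X.v_nonzero unfolding irreducible_module_def by blast
  qed
  have "\<forall>b. \<exists>l. b < N \<longrightarrow> formal_words l \<and> g b = word_sum M (g 0) l"
    using span[OF hw_module irreducible] g_in by blast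
  then obtain A where A: "\<And>b. b < N \<Longrightarrow> formal_words (A b)" "\<And>b. b < N \<Longrightarrow> g b = word_sum M (g 0) (A b)" by metis
  define g' where "g' b = word_sum M' v' (A b)" for b
  have comb: "(\<Sum>b<N. c b \<cdot> g b) = word_sum M (g 0) (word_sum_comb A c N)" "(\<Sum>b<N. c b \<cdot> g' b) = word_sum M' v' (word_sum_comb A c N)"
    and val: "formal_words (word_sum_comb A c N)" for c
    unfolding word_sum_word_sum_comb g'_def by (auto intro!: sum.cong formal_words_word_sum_comb A simp flip: A(2))
  have act: "y' = lin g' l"
    if "y' = word_sum M' v' L" "y = word_sum M (g 0) L" "y = lin g l" "formal_words L" "list_all (\<lambda>(c, n). c < N) l"
    for y' y L l
  proof -
    have "word_sum M (g 0) L = word_sum M (g 0) (word_sum_comb A (\<lambda>b. leval (scoeff l b)) N)"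
      using that lin_coeffs[OF that(5), of g] comb(1) by simp
    then have "word_sum M' v' L = word_sum M' v' (word_sum_comb A (\<lambda>b. leval (scoeff l b)) N)"
      using eq that(4) val by blast
    then show ?thesis using that(1) lin_coeffs[OF that(5), of g'] comb(2) by simp
  qed
  have "table_module a T M' g'"
  proof (unfold_locales, goal_cases)
    case 1 show ?case by (rule valid)
  next
    case 2 show ?case by (rule M'.sub)
  next
    case 3 then show ?case by (rule M'.lin_E)
  next
    case 4 then show ?case by (rule M'.lin_F)
  next
    case 5 then show ?case by (rule M'.lin_K)
  next
    case 6 then show ?case using A M'.word_sum_in by (simp add: g'_def)
  next
    case (7 y)
    then obtain l where l: "formal_words l" "y = word_sum M' v' l" using span[OF M'.hw_module_axioms assms(1)] by blast
    obtain c where "word_sum M (g 0) l = (\<Sum>b<N. c b \<cdot> g b)" using g_span M.word_sum_in[OF l(1)] by blast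
    then have "word_sum M (g 0) l = word_sum M (g 0) (word_sum_comb A c N)" using comb by simp
    then have "y = (\<Sum>b<N. c b \<cdot> g' b)" unfolding comb l(2) using eq l(1) val by blast
    then show ?case by blast
  next
    case (8 c b)
    then have "(\<Sum>b<N. c b \<cdot> g b) = 0" unfolding comb using zero val by blast
    then show ?case using g_indep 8 by blast
  next
    case (9 i b)
    have "Eop M' i (word_sum M' v' (A b)) = word_sum M' v' (formal_E (twt T 0) i (A b))" by (rule M'.E_word_sum[OF 9(1) A(1)[OF 9(2)]])
    moreover have "Eop M i (g b) = word_sum M (g 0) (formal_E (twt T 0) i (A b))"
      using M.E_word_sum[OF 9(1) A(1)[OF 9(2)]] unfolding A(2)[OF 9(2), symmetric] .
    ultimately show ?case unfolding g'_def[of b]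
      by (rule act[OF _ _ E_g[OF 9] formal_words_formal_E[OF 9(1) A(1)[OF 9(2)]] qcol_bounds(1)[OF 9]])
  next
    case (10 i b)
    have "Fop M' i (word_sum M' v' (A b)) = word_sum M' v' (formal_F i (A b))" by (rule M'.F_word_sum[OF 10(1) A(1)[OF 10(2)]])
    moreover have "Fop M i (g b) = word_sum M (g 0) (formal_F i (A b))"
      using M.F_word_sum[OF 10(1) A(1)[OF 10(2)]] unfolding A(2)[OF 10(2), symmetric] .
    ultimately show ?case unfolding g'_def[of b]
      by (rule act[OF _ _ F_g[OF 10] formal_words_formal_F[OF 10(1) A(1)[OF 10(2)]] qcol_bounds(2)[OF 10]])
  next
    case (11 i b)
    have "word_sum M (g 0) (formal_K (twt T 0) i (A b)) = qq powi twt T b i \<cdot> g b"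
      using M.K_word_sum[OF 11(1) A(1)[OF 11(2)]] K_g[OF 11] unfolding A(2)[OF 11(2), symmetric] by simp
    also have "\<dots> = word_sum M (g 0) (formal_scale (qq powi twt T b i) (A b))"
      by (simp only: word_sum_formal_scale A(2)[OF 11(2), symmetric])
    finally have "word_sum M (g 0) (formal_K (twt T 0) i (A b)) = word_sum M (g 0) (formal_scale (qq powi twt T b i) (A b))" .
    then have "word_sum M' v' (formal_K (twt T 0) i (A b)) = word_sum M' v' (formal_scale (qq powi twt T b i) (A b))"
      by (rule iffD1[OF eq, rotated 2]) (simp_all only: formal_words_formal_K formal_words_formal_scale A(1)[OF 11(2)])
    then show ?case unfolding g'_def[of b] M'.K_word_sum[OF 11(1) A(1)[OF 11(2)]] word_sum_formal_scale .
  qed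
  moreover have "g' 0 = v'"
  proof -
    have "word_sum M (g 0) (A 0) = word_sum M (g 0) [([], 1)]" using A(2)[OF N_pos, symmetric] by (simp add: word_vector_def)
    then have "word_sum M' v' (A 0) = word_sum M' v' [([], 1)]" by (rule iffD1[OF eq, rotated 2]) (simp_all add: A(1) N_pos)
    then show ?thesis by (simp add: g'_def word_vector_def)
  qed
  ultimately show ?thesis by (intro exI[of _ g'] conjI)
qed

end

text \<open>
  The model ensures that there is a module to be chosen, and the choice does not matter because the
  basis is transported to it, with any highest weight vector at its beginning.
\<close>

theorem (in cartan_A2) irr_module_table:
  assumes "valid T"
  shows "\<exists>g. table_module a T (irr_module (twt T 0)) g \<and> g 0 = hw_vec (twt T 0)"
proof -
  interpret X: table_module a T "model T" unit by (rule table_module_model[OF assms])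
  have "irreducible_module (irr_module (twt T 0)) \<and> (\<exists>v. hw_vector (irr_module (twt T 0)) (twt T 0) v)"
    unfolding irr_module_def by (rule someI_ex) (use X.irreducible X.hw_vector_g0 in blast)
  then have *: "irreducible_module (irr_module (twt T 0))" "\<exists>v. hw_vector (irr_module (twt T 0)) (twt T 0) v"
    by (rule conjunct1, rule conjunct2)
  have "hw_vector (irr_module (twt T 0)) (twt T 0) (hw_vec (twt T 0))"
    unfolding hw_vec_def by (rule someI_ex[OF *(2)])
  then show ?thesis by (rule X.transport[OF *(1)])
qed

section \<open>Kashiwara operators and the crystals of the tables\<close>

context table_module
begin

lemma adapted_span:
  assumes "i \<in> {1, 2}" "y \<in> V"
  shows "\<exists>z. y = (\<Sum>b<N. z b \<cdot> adapted i b)"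
proof -
  obtain c where "y = (\<Sum>b<N. c b \<cdot> g b)" using g_span[OF assms(2)] by (rule exE)
  then show ?thesis unfolding combination_adapted[OF assms(1)] by (rule exI[of _ "acoord i c"])
qed

lemma adapted_combination_in: "i \<in> {1, 2} \<Longrightarrow> (\<Sum>b<N. z b \<cdot> adapted i b) \<in> V"
  by (intro subspace_combination[OF sub]) (simp add: adapted_in)

lemma adapted_coords_unique:
  assumes "i \<in> {1, 2}" "(\<Sum>b<N. c b \<cdot> adapted i b) = (\<Sum>b<N. d b \<cdot> adapted i b)" "b < N"
  shows "c b = d b"
proof -
  have "(\<Sum>b<N. (c b - d b) \<cdot> adapted i b) = 0"
    using assms(2) by (simp add: coord.scale_left_diff_distrib sum_subtractf)
  from adapted_indep[OF assms(1) this assms(3)] show ?thesis by simp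
qed

text \<open>
  The linear map with prescribed values on the adapted basis. It is zero outside the module, as the
  description of the Kashiwara operators demands.
\<close>

definition adapted_extension :: "nat \<Rightarrow> (nat \<Rightarrow> qvec) \<Rightarrow> qvec \<Rightarrow> qvec" where
  "adapted_extension i h y = (if y \<in> V then \<Sum>b<N. (SOME z. y = (\<Sum>b<N. z b \<cdot> adapted i b)) b \<cdot> h b else 0)"

lemma adapted_extension_combination:
  assumes "i \<in> {1, 2}"
  shows "adapted_extension i h (\<Sum>b<N. z b \<cdot> adapted i b) = (\<Sum>b<N. z b \<cdot> h b)"
proof -
  let ?y = "\<Sum>b<N. z b \<cdot> adapted i b"
  define z' where "z' = (SOME z. ?y = (\<Sum>b<N. z b \<cdot> adapted i b))"
  have "?y = (\<Sum>b<N. z' b \<cdot> adapted i b)" unfolding z'_def by (rule someI[of _ z]) simp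
  then have "z' b = z b" if "b < N" for b
    using adapted_coords_unique[OF assms _ that, of z z'] by simp
  then have "(\<Sum>b<N. z' b \<cdot> h b) = (\<Sum>b<N. z b \<cdot> h b)" by (intro sum.cong) simp_all
  then show ?thesis unfolding adapted_extension_def z'_def using adapted_combination_in[OF assms] by simp
qed

lemma adapted_extension_linear:
  assumes "i \<in> {1, 2}" "\<And>b. b < N \<Longrightarrow> h b \<in> V"
  shows "linear_on V (adapted_extension i h)"
  unfolding linear_on_def
proof (intro conjI ballI allI)
  show "adapted_extension i h ` V \<subseteq> V"
  proof safe
    fix y assume "y \<in> V"
    then obtain z where z: "y = (\<Sum>b<N. z b \<cdot> adapted i b)" using adapted_span[OF assms(1)] by blast
    show "adapted_extension i h y \<in> V" unfolding z adapted_extension_combination[OF assms(1)]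
      by (intro subspace_combination[OF sub]) (simp add: assms)
  qed
next
  fix x y assume "x \<in> V" "y \<in> V"
  then obtain z w where zw: "x = (\<Sum>b<N. z b \<cdot> adapted i b)" "y = (\<Sum>b<N. w b \<cdot> adapted i b)"
    using adapted_span[OF assms(1)] by meson
  have e: "x + y = (\<Sum>b<N. (z b + w b) \<cdot> adapted i b)"
    unfolding zw by (simp add: coord.scale_left_distrib sum.distrib)
  show "adapted_extension i h (x + y) = adapted_extension i h x + adapted_extension i h y"
    unfolding e unfolding zw adapted_extension_combination[OF assms(1)] by (simp add: coord.scale_left_distrib sum.distrib)
next
  fix c y assume "y \<in> V"
  then obtain z where z: "y = (\<Sum>b<N. z b \<cdot> adapted i b)" using adapted_span[OF assms(1)] by blast
  have e: "c \<cdot> y = (\<Sum>b<N. (c * z b) \<cdot> adapted i b)"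
    unfolding z by (simp add: coord.scale_sum_right)
  show "adapted_extension i h (c \<cdot> y) = c \<cdot> adapted_extension i h y"
    unfolding e unfolding z adapted_extension_combination[OF assms(1)] by (simp add: coord.scale_sum_right)
qed

lemma delta_combination: "b < N \<Longrightarrow> (\<Sum>b'<N. (if b' = b then 1 else 0) \<cdot> h b') = (h b :: qvec)"
proof -
  assume b: "b < N"
  have "(\<Sum>b'<N. (if b' = b then 1 else 0) \<cdot> h b') = (\<Sum>b'<N. if b' = b then h b' else 0)"
    by (intro sum.cong) simp_all
  then show ?thesis using b by simp
qed

lemma adapted_extension_adapted: "i \<in> {1, 2} \<Longrightarrow> b < N \<Longrightarrow> adapted_extension i h (adapted i b) = h b"
  using adapted_extension_combination[of i h "\<lambda>b'. if b' = b then 1 else 0"] delta_combination[of b] by simp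

primrec down :: "nat \<Rightarrow> nat \<Rightarrow> nat \<Rightarrow> nat option" where
  "down i 0 b = Some b"
| "down i (Suc n) b = Option.bind (down i n b) (tf T i)"

lemma down_top:
  assumes "i \<in> {1, 2}" "t < N" "teps T i t = 0"
  shows "down i n t = Some c \<Longrightarrow> c < N \<and> teps T i c = n \<and> tphi T i c + n = tphi T i t"
    "down i n t = None \<Longrightarrow> tphi T i t < n"
proof (induction n arbitrary: c)
  case (Suc n)
  {
    case 1
    then obtain d where d: "down i n t = Some d" "tf T i d = Some c" by (cases "down i n t") auto
    then have d': "d < N" "teps T i d = n" "tphi T i d + n = tphi T i t" using Suc.IH(1) by auto
    note s = strings(5)[OF assms(1) d'(1) d(2)]
    then have "te T i c = Some d" "c < N" by auto
    from strings(4)[OF assms(1) this(2,1)] show ?case using s d' by simp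
  next
    case 2
    show ?case
    proof (cases "down i n t")
      case None
      then show ?thesis using Suc.IH(2) by simp
    next
      case (Some d)
      then have "tf T i d = None" "d < N" "tphi T i d + n = tphi T i t" using 2 Suc.IH(1) by auto
      then show ?thesis using strings(3)[OF assms(1)] by simp
    qed
  }
qed (use assms in auto)

lemma down_exists:
  assumes "i \<in> {1, 2}" "b < N"
  shows "\<exists>t<N. teps T i t = 0 \<and> down i (teps T i b) t = Some b"
  using assms(2)
proof (induction "teps T i b" arbitrary: b)
  case 0
  then show ?case by (intro exI[of _ b]) simp
next
  case (Suc n)
  then obtain c where c: "te T i b = Some c" using strings(2)[OF assms(1) Suc.prems] by (cases "te T i b") auto
  note s = strings(4)[OF assms(1) Suc.prems c]
  then have "n = teps T i c" using Suc.hyps(2) by simp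
  from Suc.hyps(1)[OF this] s obtain t where t: "t < N" "teps T i t = 0" "down i (teps T i c) t = Some c" by auto
  have "down i (teps T i b) t = Some b" using s t by simp
  then show ?case using t by blast
qed

text \<open>The divided power removes the \<open>q\<close>-integers picked up on the way down the string.\<close>

lemma divpow_top:
  assumes "i \<in> {1, 2}" "t < N" "teps T i t = 0"
  shows "divpow (Fop M) i n (adapted i t) = (case down i n t of None \<Rightarrow> 0 | Some c \<Rightarrow> adapted i c)"
proof (induction n)
  case 0
  then show ?case using assms(1) by (simp add: divpow_eq I_eq qfactorial_small)
next
  case (Suc n)
  have iI: "i \<in> I" using assms(1) by (simp add: I_eq)
  have in_V: "(Fop M i ^^ n) (adapted i t) \<in> V"
    using linear_onD(1)[OF linear_on_funpow[OF lin_F[OF assms(1)]] adapted_in[OF assms(1,2)]] .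
  have "divpow (Fop M) i (Suc n) (adapted i t) =
      inverse (qnum (int (Suc n))) \<cdot> Fop M i (divpow (Fop M) i n (adapted i t))"
    unfolding divpow_eq[OF iI] linear_onD(3)[OF lin_F[OF assms(1)] in_V]
    by (simp add: qfactorial_Suc mult.commute)
  also have "\<dots> = (case down i (Suc n) t of None \<Rightarrow> 0 | Some c \<Rightarrow> adapted i c)"
  proof (cases "down i n t")
    case None
    then show ?thesis unfolding Suc.IH
      using linear_on_0[OF lin_F[OF assms(1)] coord.subspace_0[OF sub]] by simp
  next
    case (Some c)
    then have c: "c < N" "teps T i c = n" using down_top(1)[OF assms] by auto
    have "qnum (int (Suc n)) \<noteq> 0" by (simp add: qnum_nonzero del: of_nat_Suc)
    then show ?thesis unfolding Suc.IH using Some c E_adapted(2)[OF assms(1) c(1)]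
      by (cases "tf T i c") (simp_all del: of_nat_Suc)
  qed
  finally show ?case .
qed

lemma twt_weights: "twt T b \<in> weights"
  by (auto simp: weights_def twt_def I_eq)

lemma K_kernel:
  assumes "i \<in> {1, 2}" "y = (\<Sum>b<N. z b \<cdot> adapted i b)" "Kop M i y = qq powi k \<cdot> y" "b < N" "z b \<noteq> 0"
  shows "twt T b i = k"
proof -
  have "Kop M i y = (\<Sum>b<N. z b \<cdot> Kop M i (adapted i b))"
    unfolding assms(2) by (rule linear_on_combination[OF sub lin_K[OF assms(1)]]) (use assms adapted_in in auto)
  also have "\<dots> = (\<Sum>b<N. (z b * qq powi twt T b i) \<cdot> adapted i b)"
    by (intro sum.cong) (simp_all add: K_adapted[OF assms(1,1)])
  finally have "(\<Sum>b<N. (z b * qq powi twt T b i) \<cdot> adapted i b) = (\<Sum>b<N. (qq powi k * z b) \<cdot> adapted i b)"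
    using assms(3) unfolding assms(2) by (simp add: coord.scale_sum_right)
  from adapted_coords_unique[OF assms(1) this assms(4)] show ?thesis
    using assms(5) by (simp add: qq_powi_inject mult.commute)
qed

lemma divpow_linear: "i \<in> {1, 2} \<Longrightarrow> linear_on V (divpow (Fop M) i n)"
proof -
  assume i: "i \<in> {1, 2}"
  have "linear_on V (\<lambda>x. inverse (qfactorial n) \<cdot> (Fop M i ^^ n) x)"
    by (rule linear_on_scale[OF sub linear_on_funpow[OF lin_F[OF i]]])
  moreover have "divpow (Fop M) i n = (\<lambda>x. inverse (qfactorial n) \<cdot> (Fop M i ^^ n) x)"
    using divpow_eq[of i] i by (simp add: I_eq fun_eq_iff)
  ultimately show ?thesis by simp
qed

text \<open>
  The description of a Kashiwara operator prescribes the value \<open>R n x\<close> at \<open>F\<^sub>i\<^sup>(\<^sup>n\<^sup>) x\<close>. A vector \<open>x\<close> of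
  weight \<open>\<mu>\<close> that is annihilated by \<open>E\<^sub>i\<close> is a combination of tops of strings with \<open>\<mu> i\<close> steps, so that
  the extension of \<open>h\<close> has these values. Conversely, each vector of the adapted basis is a divided power
  of the top of its string, so that no other linear map has them.
\<close>

lemma kashiwara_the:
  assumes i: "i \<in> {1, 2}"
    and R: "\<And>n. linear_on V (R n)"
    and h: "\<And>t n c. t < N \<Longrightarrow> teps T i t = 0 \<Longrightarrow> down i n t = Some c \<Longrightarrow> R n (adapted i t) = h c"
  shows "(THE S. linear_on V S \<and> (\<forall>x. x \<notin> V \<longrightarrow> S x = 0) \<and>
    (\<forall>\<mu>\<in>weights. \<forall>x\<in>wt_space M \<mu>. Eop M i x = 0 \<longrightarrow> (\<forall>n. int n \<le> \<mu> i \<longrightarrow>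
       S (divpow (Fop M) i n x) = R n x))) = adapted_extension i h"
    (is "(THE S. ?P S) = _")
proof (rule the_equality)
  have h_in: "h b \<in> V" if b: "b < N" for b
  proof -
    obtain t where t: "t < N" "teps T i t = 0" "down i (teps T i b) t = Some b" using down_exists[OF i b] by blast
    show ?thesis unfolding h[OF t, symmetric] by (rule linear_onD(1)[OF R adapted_in[OF i t(1)]])
  qed
  have lin: "linear_on V (adapted_extension i h)" by (rule adapted_extension_linear[OF i h_in])
  show "?P (adapted_extension i h)"
  proof (intro conjI ballI allI impI lin)
    show "adapted_extension i h x = 0" if "x \<notin> V" for x using that by (simp add: adapted_extension_def)
    fix \<mu> y n assume *: "\<mu> \<in> weights" "y \<in> wt_space M \<mu>" "Eop M i y = 0" "int n \<le> \<mu> i"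
    then have yV: "y \<in> V" and K: "Kop M i y = qq powi \<mu> i \<cdot> y"
      using i qi_eq[of i] by (auto simp: wt_space_def I_eq)
    obtain z where z: "y = (\<Sum>b<N. z b \<cdot> adapted i b)" using adapted_span[OF i yV] by blast
    have top: "teps T i b = 0" "int n \<le> int (tphi T i b)" if "b < N" "z b \<noteq> 0" for b
    proof -
      show "teps T i b = 0" using E_kernel[OF i *(3)[unfolded z] that(1)] that(2) strings(2)[OF i that(1)] by blast
      then show "int n \<le> int (tphi T i b)"
        using K_kernel[OF i z K that] *(4) strings(1)[OF i that(1)] by simp
    qed
    have "adapted_extension i h (divpow (Fop M) i n y) = (\<Sum>b<N. z b \<cdot> adapted_extension i h (divpow (Fop M) i n (adapted i b)))"
      unfolding z
      by (rule linear_on_combination[OF sub linear_on_compose[OF lin divpow_linear[OF i]]]) (use i adapted_in in auto)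
    also have "\<dots> = (\<Sum>b<N. z b \<cdot> R n (adapted i b))"
    proof (rule sum.cong[OF refl])
      fix b assume "b \<in> {..<N}"
      then have b: "b < N" by simp
      show "z b \<cdot> adapted_extension i h (divpow (Fop M) i n (adapted i b)) = z b \<cdot> R n (adapted i b)"
      proof (cases "z b = 0")
        case False
        note t = top[OF b False]
        obtain c where c: "down i n b = Some c" using down_top(2)[OF i b t(1), of n] t(2) by (cases "down i n b") auto
        then have "c < N" using down_top(1)[OF i b t(1)] by blast
        then show ?thesis using divpow_top[OF i b t(1), of n] c h[OF b t(1) c] adapted_extension_adapted[OF i, of c h] by simp
      qed simp
    qed
    also have "\<dots> = R n y" unfolding z
      by (rule linear_on_combination[OF sub R, symmetric]) (use i adapted_in in auto)
    finally show "adapted_extension i h (divpow (Fop M) i n y) = R n y" .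
  qed
  fix S assume S: "?P S"
  then have S_lin: "linear_on V S" and S_out: "\<And>x. x \<notin> V \<Longrightarrow> S x = 0" by blast+
  have S_adapted: "S (adapted i b) = h b" if b: "b < N" for b
  proof -
    obtain t where t: "t < N" "teps T i t = 0" "down i (teps T i b) t = Some b" using down_exists[OF i b] by blast
    have wt: "adapted i t \<in> wt_space M (twt T t)"
      using K_adapted[OF i _ t(1)] adapted_in[OF i t(1)] qi_eq by (auto simp: wt_space_def I_eq)
    have "Eop M i (adapted i t) = 0" using E_adapted(1)[OF i t(1)] strings(2)[OF i t(1)] t(2) by simp
    moreover have "int (teps T i b) \<le> twt T t i"
      using down_top(1)[OF i t(1,2,3)] strings(1)[OF i t(1)] t(2) by simp
    ultimately have "S (divpow (Fop M) i (teps T i b) (adapted i t)) = R (teps T i b) (adapted i t)"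
      using S wt twt_weights by blast
    then show ?thesis using divpow_top[OF i t(1,2), of "teps T i b"] t(3) h[OF t] by simp
  qed
  show "S = adapted_extension i h"
  proof
    fix y show "S y = adapted_extension i h y"
    proof (cases "y \<in> V")
      case True
      then obtain z where z: "y = (\<Sum>b<N. z b \<cdot> adapted i b)" using adapted_span[OF i] by blast
      have "S y = (\<Sum>b<N. z b \<cdot> S (adapted i b))"
        unfolding z by (rule linear_on_combination[OF sub S_lin]) (use i adapted_in in auto)
      also have "\<dots> = adapted_extension i h y" unfolding z adapted_extension_combination[OF i] by (intro sum.cong) (simp_all add: S_adapted)
      finally show ?thesis .
    qed (simp add: S_out adapted_extension_def)
  qed
qed

definition shiftE :: "nat \<Rightarrow> nat \<Rightarrow> qvec"
  where "shiftE i b = (case te T i b of None \<Rightarrow> 0 | Some c \<Rightarrow> adapted i c)"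

definition shiftF :: "nat \<Rightarrow> nat \<Rightarrow> qvec"
  where "shiftF i b = (case tf T i b of None \<Rightarrow> 0 | Some c \<Rightarrow> adapted i c)"

lemma kashiwara_E_eq: "i \<in> {1, 2} \<Longrightarrow> kashiwara_E M i = adapted_extension i (shiftE i)"
  unfolding kashiwara_E_def
proof (rule kashiwara_the)
  assume i: "i \<in> {1, 2}"
  show "linear_on V (\<lambda>x. if n = 0 then 0 else divpow (Fop M) i (n - 1) x)" for n
    using divpow_linear[OF i] coord.subspace_0[OF sub] by (cases "n = 0") (auto simp: linear_on_def)
  fix t n c assume *: "t < N" "teps T i t = 0" "down i n t = Some c"
  show "(if n = 0 then 0 else divpow (Fop M) i (n - 1) (adapted i t)) = shiftE i c"
  proof (cases n)
    case 0
    then show ?thesis using * strings(2)[OF i *(1)] by (simp add: shiftE_def)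
  next
    case (Suc m)
    then obtain d where d: "down i m t = Some d" "tf T i d = Some c" using * by (cases "down i m t") auto
    then have "d < N" using down_top(1)[OF i *(1,2)] by blast
    then have "te T i c = Some d" using strings(5)[OF i] d by blast
    then show ?thesis using Suc d divpow_top[OF i *(1,2), of m] by (simp add: shiftE_def)
  qed
qed

lemma kashiwara_F_eq: "i \<in> {1, 2} \<Longrightarrow> kashiwara_F M i = adapted_extension i (shiftF i)"
  unfolding kashiwara_F_def
proof (rule kashiwara_the)
  assume i: "i \<in> {1, 2}"
  show "linear_on V (divpow (Fop M) i (n + 1))" for n by (rule divpow_linear[OF i])
  fix t n c assume *: "t < N" "teps T i t = 0" "down i n t = Some c"
  show "divpow (Fop M) i (n + 1) (adapted i t) = shiftF i c"
    using divpow_top[OF i *(1,2), of "n + 1"] * by (simp add: shiftF_def)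
qed

text \<open>This is going to be the crystal lattice, and the set defined next the multiple of it by \<open>q\<close>.\<close>

definition regular_span :: "qvec set"
  where "regular_span = {\<Sum>b<N. c b \<cdot> g b |c. \<forall>b<N. c b \<in> reg0}"

definition vanishing_span :: "qvec set"
  where "vanishing_span = {\<Sum>b<N. c b \<cdot> g b |c. \<forall>b<N. c b \<in> qreg}"

lemma regular_spanI: "(\<And>b. b < N \<Longrightarrow> c b \<in> reg0) \<Longrightarrow> (\<Sum>b<N. c b \<cdot> g b) \<in> regular_span"
  unfolding regular_span_def by (intro CollectI exI[of _ c]) simp

lemma vanishing_spanI: "(\<And>b. b < N \<Longrightarrow> c b \<in> qreg) \<Longrightarrow> (\<Sum>b<N. c b \<cdot> g b) \<in> vanishing_span"
  unfolding vanishing_span_def by (intro CollectI exI[of _ c]) simp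

lemma regular_spanE:
  assumes "x \<in> regular_span"
  obtains c where "x = (\<Sum>b<N. c b \<cdot> g b)" "\<forall>b<N. c b \<in> reg0"
  using assms unfolding regular_span_def by blast

lemma vanishing_spanE:
  assumes "x \<in> vanishing_span"
  obtains c where "x = (\<Sum>b<N. c b \<cdot> g b)" "\<forall>b<N. c b \<in> qreg"
  using assms unfolding vanishing_span_def by blast

lemma vanishing_span_add: "x \<in> vanishing_span \<Longrightarrow> y \<in> vanishing_span \<Longrightarrow> x + y \<in> vanishing_span"
  by (elim vanishing_spanE, hypsubst)
    (simp only: sum.distrib[symmetric] coord.scale_left_distrib[symmetric], intro vanishing_spanI qreg_add; simp)

lemma regular_span_add: "x \<in> regular_span \<Longrightarrow> y \<in> regular_span \<Longrightarrow> x + y \<in> regular_span"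
  by (elim regular_spanE, hypsubst)
    (simp only: sum.distrib[symmetric] coord.scale_left_distrib[symmetric], intro regular_spanI reg0_add; simp)

lemma regular_span_scale: "c \<in> reg0 \<Longrightarrow> x \<in> regular_span \<Longrightarrow> c \<cdot> x \<in> regular_span"
  by (elim regular_spanE, hypsubst) (simp only: coord.scale_sum_right coord.scale_scale, intro regular_spanI reg0_mult; simp)

lemma vanishing_span_scale: "c \<in> reg0 \<Longrightarrow> x \<in> vanishing_span \<Longrightarrow> c \<cdot> x \<in> vanishing_span"
  by (elim vanishing_spanE, hypsubst) (simp only: coord.scale_sum_right coord.scale_scale, intro vanishing_spanI qreg_mult; simp)

lemma regular_span_vanishing_span_scale: "c \<in> qreg \<Longrightarrow> x \<in> regular_span \<Longrightarrow> c \<cdot> x \<in> vanishing_span"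
  by (elim regular_spanE, hypsubst) (simp only: coord.scale_sum_right coord.scale_scale, intro vanishing_spanI qreg_mult'; simp)

lemma zero_vanishing_span: "0 \<in> vanishing_span" and zero_regular_span: "0 \<in> regular_span"
proof -
  show "0 \<in> vanishing_span" using vanishing_spanI[of "\<lambda>b. 0"] by simp
  show "0 \<in> regular_span" using regular_spanI[of "\<lambda>b. 0"] by simp
qed

lemma vanishing_span_uminus: "x \<in> vanishing_span \<Longrightarrow> - x \<in> vanishing_span"
  using vanishing_span_scale[of "-1" x] reg0_uminus[OF reg0_1] by simp

lemma regular_span_sum: "(\<And>x. x \<in> A \<Longrightarrow> f x \<in> regular_span) \<Longrightarrow> sum f A \<in> regular_span"
  by (induction A rule: infinite_finite_induct) (simp_all add: zero_regular_span regular_span_add)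

lemma vanishing_span_sum: "(\<And>x. x \<in> A \<Longrightarrow> f x \<in> vanishing_span) \<Longrightarrow> sum f A \<in> vanishing_span"
  by (induction A rule: infinite_finite_induct) (simp_all add: zero_vanishing_span vanishing_span_add)

lemma g_regular_span: "b < N \<Longrightarrow> g b \<in> regular_span"
  using regular_spanI[of "\<lambda>b'. if b' = b then 1 else 0"] delta_combination[of b g] by simp

lemma regular_span_in_V: "regular_span \<subseteq> V"
  by (auto elim!: regular_spanE simp: combination_in)

lemma adapted_minus_g: "i \<in> {1, 2} \<Longrightarrow> b < N \<Longrightarrow> adapted i b - g b \<in> vanishing_span"
proof -
  assume *: "i \<in> {1, 2}" "b < N"
  have "(\<Sum>p<N. ccoef i b p \<cdot> g p) \<in> vanishing_span" by (intro vanishing_spanI ccoef_qreg *)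
  moreover have "adapted i b - g b = - (\<Sum>p<N. ccoef i b p \<cdot> g p)" by (simp add: adapted_def)
  ultimately show ?thesis using vanishing_span_uminus by simp
qed

lemma vanishing_span_subset_regular_span: "vanishing_span \<subseteq> regular_span"
  by (auto elim!: vanishing_spanE intro!: regular_spanI qreg_subset_reg0)

lemma adapted_regular_span: "i \<in> {1, 2} \<Longrightarrow> b < N \<Longrightarrow> adapted i b \<in> regular_span"
  using regular_span_add[of "adapted i b - g b" "g b"] adapted_minus_g[of i b] vanishing_span_subset_regular_span g_regular_span[of b] by auto

text \<open>
  The basis \<open>g\<close> and the adapted one span the same lattice and agree modulo \<open>q\<close>, so modulo \<open>q\<close> the
  values on the one are the values on the other.
\<close>

lemma adapted_extension_regular_span:
  assumes "i \<in> {1, 2}" "\<forall>b<N. h b \<in> regular_span"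
  shows "y \<in> regular_span \<Longrightarrow> adapted_extension i h y \<in> regular_span" "y \<in> vanishing_span \<Longrightarrow> adapted_extension i h y \<in> vanishing_span" "b < N \<Longrightarrow> adapted_extension i h (g b) - h b \<in> vanishing_span"
proof -
  show "adapted_extension i h y \<in> regular_span" if "y \<in> regular_span"
  proof -
    obtain c where c: "y = (\<Sum>b<N. c b \<cdot> g b)" "\<forall>b<N. c b \<in> reg0" using \<open>y \<in> regular_span\<close> by (rule regular_spanE)
    show ?thesis unfolding c(1) combination_adapted[OF assms(1)] adapted_extension_combination[OF assms(1)]
      using c(2) assms by (intro regular_span_sum regular_span_scale acoord_reg0) auto
  qed
  show Q: "adapted_extension i h y \<in> vanishing_span" if "y \<in> vanishing_span" for y
  proof -
    obtain c where c: "y = (\<Sum>b<N. c b \<cdot> g b)" "\<forall>b<N. c b \<in> qreg" using \<open>y \<in> vanishing_span\<close> by (rule vanishing_spanE)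
    show ?thesis unfolding c(1) combination_adapted[OF assms(1)] adapted_extension_combination[OF assms(1)]
      using c(2) assms by (intro vanishing_span_sum regular_span_vanishing_span_scale acoord_qreg) auto
  qed
  show "adapted_extension i h (g b) - h b \<in> vanishing_span" if b: "b < N"
  proof -
    have hV: "\<And>b. b < N \<Longrightarrow> h b \<in> V" using assms(2) regular_span_in_V by blast
    have "adapted_extension i h (adapted i b - g b) = adapted_extension i h (adapted i b) - adapted_extension i h (g b)"
    proof -
      have "adapted_extension i h (adapted i b + (-1) \<cdot> g b) = adapted_extension i h (adapted i b) + (-1) \<cdot> adapted_extension i h (g b)"
        using linear_onD(2,3)[OF adapted_extension_linear[OF assms(1) hV]] adapted_in[OF assms(1) b] g_in[OF b]
          coord.subspace_scale[OF sub g_in[OF b]] by presburger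
      then show ?thesis by simp
    qed
    then have "h b - adapted_extension i h (g b) \<in> vanishing_span"
      using Q[OF adapted_minus_g[OF assms(1) b]] adapted_extension_adapted[OF assms(1) b] by simp
    from vanishing_span_uminus[OF this] show ?thesis by simp
  qed
qed

lemma shift_regular_span:
  assumes "i \<in> {1, 2}"
  shows "\<forall>b<N. shiftE i b \<in> regular_span" "\<forall>b<N. shiftF i b \<in> regular_span"
proof -
  show "\<forall>b<N. shiftE i b \<in> regular_span"
  proof (intro allI impI)
    fix b assume b: "b < N"
    show "shiftE i b \<in> regular_span"
      using strings(4)[OF assms b] adapted_regular_span[OF assms] by (cases "te T i b") (simp_all add: shiftE_def zero_regular_span)
  qed
  show "\<forall>b<N. shiftF i b \<in> regular_span"
  proof (intro allI impI)
    fix b assume b: "b < N"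
    show "shiftF i b \<in> regular_span"
      using strings(5)[OF assms b] adapted_regular_span[OF assms] by (cases "tf T i b") (simp_all add: shiftF_def zero_regular_span)
  qed
qed

lemma shiftE_minus: "i \<in> {1, 2} \<Longrightarrow> b < N \<Longrightarrow> shiftE i b - (case te T i b of None \<Rightarrow> 0 | Some c \<Rightarrow> g c) \<in> vanishing_span"
  using strings(4)[of i b] adapted_minus_g[of i] by (cases "te T i b") (simp_all add: shiftE_def zero_vanishing_span)

lemma shiftF_minus: "i \<in> {1, 2} \<Longrightarrow> b < N \<Longrightarrow> shiftF i b - (case tf T i b of None \<Rightarrow> 0 | Some c \<Rightarrow> g c) \<in> vanishing_span"
  using strings(5)[of i b] adapted_minus_g[of i] by (cases "tf T i b") (simp_all add: shiftF_def zero_vanishing_span)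

lemma g_notin_vanishing_span: "b < N \<Longrightarrow> g b \<notin> vanishing_span"
proof
  assume b: "b < N" "g b \<in> vanishing_span"
  then obtain c where c: "g b = (\<Sum>b<N. c b \<cdot> g b)" "\<forall>b<N. c b \<in> qreg" unfolding vanishing_span_def by blast
  have "(\<Sum>b'<N. (if b' = b then 1 else 0) \<cdot> g b') = (\<Sum>b<N. c b \<cdot> g b)"
    using c(1) delta_combination[OF b(1), of g] by simp
  from g_coords_unique[OF this b(1)] have "c b = 1" by simp
  then show False using c(2) b(1) one_notin_qreg by auto
qed

lemma g_cong_vanishing_span:
  assumes "b < N" "c < N" "g b - g c \<in> vanishing_span"
  shows "b = c"
proof (rule ccontr)
  assume ne: "b \<noteq> c"
  obtain d where d: "g b - g c = (\<Sum>b<N. d b \<cdot> g b)" "\<forall>b<N. d b \<in> qreg" using assms(3) by (rule vanishing_spanE)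
  have "(\<Sum>b'<N. ((if b' = b then 1 else 0) - (if b' = c then 1 else 0)) \<cdot> g b') = (\<Sum>b<N. d b \<cdot> g b)"
    unfolding d(1)[symmetric] coord.scale_left_diff_distrib sum_subtractf
      delta_combination[OF assms(1), of g] delta_combination[OF assms(2), of g] ..
  from g_coords_unique[OF this assms(1)] have "d b = 1" using ne by simp
  then show False using d(2) assms(1) one_notin_qreg by auto
qed

end

definition tcrystal :: "table \<Rightarrow> nat crystal"
  where "tcrystal T = \<lparr> elts = {..<tsize T}, Et = te T, Ft = tf T, wt = twt T \<rparr>"

locale table_crystal = table_module a T "cartan_datum.irr_module 2 a (twt T 0)" g for a T g +
  assumes g0: "g 0 = cartan_datum.hw_vec 2 a (twt T 0)"
begin

abbreviation "\<nu> \<equiv> twt T 0"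

lemma g_orbit: "b < N \<Longrightarrow> g b \<in> hw_orbit \<nu>"
proof (induction b rule: less_induct)
  case (less b)
  show ?case
  proof (cases "b = 0")
    case True
    have "g 0 = foldr (kashiwara_F (irr_module \<nu>)) [] (hw_vec \<nu>)" by (simp add: g0)
    then show ?thesis unfolding True hw_orbit_def by (intro image_eqI[of _ _ "[]"]) simp_all
  next
    case False
    then obtain i c where i: "i \<in> {1, 2}" "te T i b = Some c" "c < b" "adapted i b = g b" "adapted i c = g c"
      using reach less.prems by blast
    have c: "c < N" "tf T i c = Some b" using strings(4)[OF i(1) less.prems i(2)] by auto
    have "kashiwara_F (irr_module \<nu>) i (g c) = g b"
      unfolding kashiwara_F_eq[OF i(1)] using adapted_extension_adapted[OF i(1) c(1), of "shiftF i"] c i by (simp add: shiftF_def)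
    moreover obtain w where w: "w \<in> lists I" "g c = foldr (kashiwara_F (irr_module \<nu>)) w (hw_vec \<nu>)"
      using less.IH[OF i(3) c(1)] unfolding hw_orbit_def by blast
    ultimately have "g b = foldr (kashiwara_F (irr_module \<nu>)) (i # w) (hw_vec \<nu>)" by simp
    moreover have "i # w \<in> lists I" using w i(1) by (simp add: I_eq)
    ultimately show ?thesis unfolding hw_orbit_def by (rule image_eqI)
  qed
qed

text \<open>
  Modulo \<open>q\<close>, the Kashiwara operators send basis vectors to basis vectors or to zero, so the orbit of
  \<open>g 0\<close> cannot leave the basis.
\<close>

lemma orbit_cases: "x \<in> hw_orbit \<nu> \<Longrightarrow> x \<in> regular_span \<and> (x \<in> vanishing_span \<or> (\<exists>b<N. x - g b \<in> vanishing_span))"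
proof -
  assume "x \<in> hw_orbit \<nu>"
  then obtain w where w: "w \<in> lists I" "x = foldr (kashiwara_F (irr_module \<nu>)) w (hw_vec \<nu>)"
    unfolding hw_orbit_def by blast
  have "foldr (kashiwara_F (irr_module \<nu>)) w (hw_vec \<nu>) \<in> regular_span \<and> (foldr (kashiwara_F (irr_module \<nu>)) w (hw_vec \<nu>) \<in> vanishing_span \<or>
    (\<exists>b<N. foldr (kashiwara_F (irr_module \<nu>)) w (hw_vec \<nu>) - g b \<in> vanishing_span))" (is "?P w")
    using w(1)
  proof (induction w)
    case Nil
    show ?case using g_regular_span[OF N_pos] zero_vanishing_span N_pos by (auto simp: g0[symmetric] intro!: exI[of _ 0])
  next
    case (Cons i w)
    define y where "y = foldr (kashiwara_F (irr_module \<nu>)) w (hw_vec \<nu>)"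
    have i: "i \<in> {1, 2}" and y: "y \<in> regular_span" "y \<in> vanishing_span \<or> (\<exists>b<N. y - g b \<in> vanishing_span)" using Cons by (auto simp: I_eq y_def)
    note l = adapted_extension_regular_span[OF i shift_regular_span(2)[OF i]]
    have "adapted_extension i (shiftF i) y \<in> vanishing_span \<or> (\<exists>b<N. adapted_extension i (shiftF i) y - g b \<in> vanishing_span)"
    proof (cases "y \<in> vanishing_span")
      case True
      then show ?thesis using l by blast
    next
      case False
      then obtain b where b: "b < N" "y - g b \<in> vanishing_span" using y by blast
      have V: "\<And>b. b < N \<Longrightarrow> shiftF i b \<in> mspace (irr_module \<nu>)" using shift_regular_span(2)[OF i] regular_span_in_V by blast
      have "adapted_extension i (shiftF i) (y - g b + g b) = adapted_extension i (shiftF i) (y - g b) + adapted_extension i (shiftF i) (g b)"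
        using b vanishing_span_subset_regular_span regular_span_in_V g_in by (intro linear_onD(2)[OF adapted_extension_linear[OF i V]]) blast+
      then have e: "adapted_extension i (shiftF i) y = adapted_extension i (shiftF i) (y - g b) + adapted_extension i (shiftF i) (g b)" by simp
      let ?c = "case tf T i b of None \<Rightarrow> 0 | Some c \<Rightarrow> g c"
      have "adapted_extension i (shiftF i) y - ?c = adapted_extension i (shiftF i) (y - g b) + (adapted_extension i (shiftF i) (g b) - shiftF i b) + (shiftF i b - ?c)"
        unfolding e by simp
      also have "\<dots> \<in> vanishing_span" by (rule vanishing_span_add[OF vanishing_span_add[OF l(2)[OF b(2)] l(3)[OF b(1)]] shiftF_minus[OF i b(1)]])
      finally have *: "adapted_extension i (shiftF i) y - ?c \<in> vanishing_span" .
      show ?thesis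
      proof (cases "tf T i b")
        case None
        then show ?thesis using * by simp
      next
        case (Some c)
        then show ?thesis using * strings(5)[OF i b(1) Some] by auto
      qed
    qed
    then show ?case using l(1)[OF y(1)] unfolding foldr.simps comp_apply kashiwara_F_eq[OF i] y_def by simp
  qed
  then show ?thesis unfolding w(2) .
qed

lemma lattice_eq: "lattice \<nu> = regular_span"
proof (intro subset_antisym subsetI)
  fix x assume "x \<in> lattice \<nu>"
  then obtain S c where *: "x = (\<Sum>x\<in>S. c x \<cdot> x)" "finite S" "S \<subseteq> hw_orbit \<nu>" "c ` S \<subseteq> reg0"
    unfolding lattice_def by blast
  then have "c y \<cdot> y \<in> regular_span" if "y \<in> S" for y using that orbit_cases by (intro regular_span_scale) blast+
  then show "x \<in> regular_span" unfolding *(1) by (rule regular_span_sum)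
next
  fix x assume "x \<in> regular_span"
  then obtain c where c: "x = (\<Sum>b<N. c b \<cdot> g b)" "\<forall>b<N. c b \<in> reg0" unfolding regular_span_def by blast
  have inj: "inj_on g {..<N}" using g_cong_vanishing_span zero_vanishing_span by (intro inj_onI) simp
  define c' where "c' = c \<circ> inv_into {..<N} g"
  have "(\<Sum>y\<in>g ` {..<N}. c' y \<cdot> y) = (\<Sum>b<N. c' (g b) \<cdot> g b)"
    by (rule sum.reindex_cong[OF inj refl refl])
  also have "\<dots> = x" unfolding c(1) by (intro sum.cong) (simp_all add: c'_def inv_into_f_f[OF inj])
  finally have x: "x = (\<Sum>y\<in>g ` {..<N}. c' y \<cdot> y)" ..
  have "g ` {..<N} \<subseteq> hw_orbit \<nu>" using g_orbit by blast
  moreover have "c' ` g ` {..<N} \<subseteq> reg0" using c(2) by (auto simp: c'_def inv_into_f_f[OF inj])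
  ultimately show "x \<in> lattice \<nu>" unfolding lattice_def using x by blast
qed

lemma qlattice_eq: "qlattice \<nu> = vanishing_span"
  unfolding qlattice_def lattice_eq
proof (intro subset_antisym subsetI)
  fix x assume "x \<in> (\<lambda>x. qq \<cdot> x) ` regular_span"
  moreover have "qq \<in> qreg" unfolding qreg_def by (rule image_eqI[of _ _ 1]) simp_all
  ultimately show "x \<in> vanishing_span" using regular_span_vanishing_span_scale by blast
next
  fix x assume "x \<in> vanishing_span"
  then obtain c where c: "x = (\<Sum>b<N. c b \<cdot> g b)" "\<forall>b<N. c b \<in> qreg" unfolding vanishing_span_def by blast
  then obtain d where d: "\<And>b. b < N \<Longrightarrow> c b = qq * d b \<and> d b \<in> reg0" unfolding qreg_def image_iff by metis
  have "x = qq \<cdot> (\<Sum>b<N. d b \<cdot> g b)" unfolding c(1) coord.scale_sum_right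
    using d by (intro sum.cong) simp_all
  moreover have "(\<Sum>b<N. d b \<cdot> g b) \<in> regular_span" using d by (intro regular_spanI) simp
  ultimately show "x \<in> (\<lambda>x. qq \<cdot> x) ` regular_span" by (rule image_eqI)
qed

definition coset :: "qvec \<Rightarrow> qvec set"
  where "coset x = {x + y |y. y \<in> vanishing_span}"

lemma coset_eq: "coset x = coset y \<longleftrightarrow> x - y \<in> vanishing_span"
proof
  assume "coset x = coset y"
  moreover have "x \<in> coset x" unfolding coset_def using zero_vanishing_span by (intro CollectI exI[of _ 0]) simp
  ultimately obtain z where "x = y + z" "z \<in> vanishing_span" unfolding coset_def by blast
  then show "x - y \<in> vanishing_span" by simp
next
  have sub: "coset x \<subseteq> coset y" if "x - y \<in> vanishing_span" for x y
  proof
    fix z assume "z \<in> coset x"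
    then obtain w where "z = x + w" "w \<in> vanishing_span" unfolding coset_def by blast
    then have "z = y + (x - y + w)" "x - y + w \<in> vanishing_span" using that vanishing_span_add by simp_all
    then show "z \<in> coset y" unfolding coset_def by blast
  qed
  assume "x - y \<in> vanishing_span"
  moreover from vanishing_span_uminus[OF this] have "y - x \<in> vanishing_span" by simp
  ultimately show "coset x = coset y" using sub by blast
qed

lemma coset_0: "coset 0 = vanishing_span"
  unfolding coset_def by simp

lemma coset_vanishing_span: "coset x = vanishing_span \<longleftrightarrow> x \<in> vanishing_span"
  using coset_eq[of x 0] coset_0 by simp

definition node :: "nat \<Rightarrow> qvec set"
  where "node b = coset (g b)"

lemma elts_B: "elts (B \<nu>) = node ` {..<N}"
proof -
  have "elts (B \<nu>) = coset ` hw_orbit \<nu> - {vanishing_span}"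
    unfolding B_def qlattice_eq by (auto simp: coset_def image_def)
  also have "\<dots> = node ` {..<N}"
  proof (intro subset_antisym subsetI)
    fix X assume "X \<in> coset ` hw_orbit \<nu> - {vanishing_span}"
    then obtain x where x: "X = coset x" "x \<in> hw_orbit \<nu>" "x \<notin> vanishing_span" using coset_vanishing_span by blast
    then obtain b where "b < N" "x - g b \<in> vanishing_span" using orbit_cases by blast
    then show "X \<in> node ` {..<N}" unfolding x(1) node_def using coset_eq by blast
  next
    fix X assume "X \<in> node ` {..<N}"
    then obtain b where b: "b < N" "X = coset (g b)" unfolding node_def by blast
    then show "X \<in> coset ` hw_orbit \<nu> - {vanishing_span}" using g_orbit g_notin_vanishing_span coset_vanishing_span by blast
  qed
  finally show ?thesis .
qed

lemma node_inj: "inj_on node {..<N}"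
  using g_cong_vanishing_span coset_eq by (intro inj_onI) (auto simp: node_def)

lemma induced_node:
  assumes "i \<in> {1, 2}" "b < N" "\<forall>b<N. h b \<in> regular_span" "h b - (case o' of None \<Rightarrow> 0 | Some c \<Rightarrow> g c) \<in> vanishing_span"
    "\<And>c. o' = Some c \<Longrightarrow> c < N"
  shows "induced \<nu> (adapted_extension i h) (node b) = map_option node o'"
proof -
  note l = adapted_extension_regular_span[OF assms(1,3)]
  let ?c = "case o' of None \<Rightarrow> 0 | Some c \<Rightarrow> g c"
  have V: "\<And>b. b < N \<Longrightarrow> h b \<in> mspace (irr_module \<nu>)" using assms(3) regular_span_in_V by blast
  have lin: "adapted_extension i h (g b + y) = adapted_extension i h (g b) + adapted_extension i h y" if "y \<in> vanishing_span" for y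
    using that vanishing_span_subset_regular_span regular_span_in_V g_in[OF assms(2)] by (intro linear_onD(2)[OF adapted_extension_linear[OF assms(1) V]]) blast+
  have "{adapted_extension i h x + y |x y. x \<in> node b \<and> y \<in> vanishing_span} = coset (adapted_extension i h (g b))"
  proof (intro subset_antisym subsetI)
    fix z assume "z \<in> {adapted_extension i h x + y |x y. x \<in> node b \<and> y \<in> vanishing_span}"
    then obtain y w where z: "z = adapted_extension i h (g b + w) + y" "y \<in> vanishing_span" "w \<in> vanishing_span" unfolding node_def coset_def by blast
    have "z = adapted_extension i h (g b) + (adapted_extension i h w + y)" unfolding z(1) lin[OF z(3)] by (rule add.assoc)
    moreover have "adapted_extension i h w + y \<in> vanishing_span" by (rule vanishing_span_add[OF l(2)[OF z(3)] z(2)])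
    ultimately show "z \<in> coset (adapted_extension i h (g b))" unfolding coset_def by blast
  next
    fix z assume "z \<in> coset (adapted_extension i h (g b))"
    then obtain y where y: "z = adapted_extension i h (g b) + y" "y \<in> vanishing_span" unfolding coset_def by blast
    have "g b \<in> node b" unfolding node_def coset_def using zero_vanishing_span by (intro CollectI exI[of _ 0]) simp
    then show "z \<in> {adapted_extension i h x + y |x y. x \<in> node b \<and> y \<in> vanishing_span}" using y by blast
  qed
  moreover have "coset (adapted_extension i h (g b)) = coset ?c"
  proof -
    have "(adapted_extension i h (g b) - h b) + (h b - ?c) \<in> vanishing_span" by (rule vanishing_span_add[OF l(3)[OF assms(2)] assms(4)])
    then show ?thesis unfolding coset_eq by simp
  qed
  ultimately show ?thesis unfolding induced_def qlattice_eq Let_def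
    using assms(5) g_notin_vanishing_span by (cases o') (simp_all add: coset_0 node_def coset_vanishing_span)
qed

text \<open>
  A vector congruent to \<open>g b\<close> has a coefficient at \<open>b\<close> congruent to 1, so it can be a weight vector
  only for the weight of \<open>g b\<close>.
\<close>

lemma wt_node:
  assumes "b < N"
  shows "wt (B \<nu>) (node b) = twt T b"
proof -
  have K: "x \<in> wt_space (irr_module \<nu>) \<mu> \<longleftrightarrow> x \<in> mspace (irr_module \<nu>) \<and> (\<forall>i\<in>{1, 2}. Kop (irr_module \<nu>) i x = qq powi \<mu> i \<cdot> x)" for x \<mu>
    unfolding wt_space_def I_eq using qi_eq[of 1] qi_eq[of 2] by (simp add: I_eq)
  have "wt (B \<nu>) (node b) = (THE \<mu>. \<mu> \<in> weights \<and> node b \<inter> wt_space (irr_module \<nu>) \<mu> \<noteq> {})"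
    by (simp add: B_def)
  also have "\<dots> = twt T b"
  proof (rule the_equality)
    have "g b \<in> node b" unfolding node_def coset_def using zero_vanishing_span by (intro CollectI exI[of _ 0]) simp
    moreover have "g b \<in> wt_space (irr_module \<nu>) (twt T b)" unfolding K using g_in[OF assms] K_g[OF _ assms] by blast
    ultimately show "twt T b \<in> weights \<and> node b \<inter> wt_space (irr_module \<nu>) (twt T b) \<noteq> {}" using twt_weights by blast
  next
    fix \<mu> assume "\<mu> \<in> weights \<and> node b \<inter> wt_space (irr_module \<nu>) \<mu> \<noteq> {}"
    then obtain y where \<mu>: "\<mu> \<in> weights" and y: "y \<in> vanishing_span" "g b + y \<in> wt_space (irr_module \<nu>) \<mu>"
      unfolding node_def coset_def by blast
    obtain c where c: "y = (\<Sum>b<N. c b \<cdot> g b)" "\<forall>b<N. c b \<in> qreg" using y(1) by (rule vanishing_spanE)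
    define d where "d b' = (if b' = b then 1 else 0) + c b'" for b'
    have d: "g b + y = (\<Sum>b<N. d b \<cdot> g b)"
      unfolding c(1) d_def coord.scale_left_distrib sum.distrib delta_combination[OF assms, of g] ..
    have "d b \<noteq> 0"
    proof
      assume "d b = 0"
      then have "1 = - c b" by (simp add: d_def eq_neg_iff_add_eq_0)
      then show False using one_notin_qreg qreg_uminus c(2) assms by metis
    qed
    have "\<mu> i = twt T b i" if i: "i \<in> {1, 2}" for i
    proof -
      have "(\<Sum>b<N. (qq powi twt T b i * d b) \<cdot> g b) = (\<Sum>b<N. (qq powi \<mu> i * d b) \<cdot> g b)"
        using y(2) i unfolding K d K_combination[OF i, symmetric] by (auto simp: coord.scale_sum_right)
      from g_coords_unique[OF this assms] show ?thesis using \<open>d b \<noteq> 0\<close> by (simp add: qq_powi_inject)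
    qed
    moreover have "\<mu> i = twt T b i" if "i \<notin> {1, 2}" for i using \<mu> that by (simp add: weights_def I_eq twt_def)
    ultimately show "\<mu> = twt T b" by blast
  qed
  finally show ?thesis .
qed

theorem crystal_iso_node: "crystal_iso node (tcrystal T) (B \<nu>)"
  unfolding crystal_iso_def
proof (intro conjI ballI)
  show "bij_betw node (elts (tcrystal T)) (elts (B \<nu>))"
    using node_inj elts_B by (simp add: bij_betw_def tcrystal_def)
  fix b assume "b \<in> elts (tcrystal T)"
  then have b: "b < N" by (simp add: tcrystal_def)
  show "wt (B \<nu>) (node b) = wt (tcrystal T) b" using wt_node[OF b] by (simp add: tcrystal_def)
  fix i assume "i \<in> I"
  then have i: "i \<in> {1, 2}" by (simp add: I_eq)
  have "Et (B \<nu>) i (node b) = induced \<nu> (adapted_extension i (shiftE i)) (node b)" by (simp add: B_def kashiwara_E_eq[OF i])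
  also have "\<dots> = map_option node (te T i b)"
    by (rule induced_node[OF i b shift_regular_span(1)[OF i], where o' = "te T i b", OF shiftE_minus[OF i b]])
      (use strings(4)[OF i b] in blast)
  finally show "Et (B \<nu>) i (node b) = map_option node (Et (tcrystal T) i b)" by (simp add: tcrystal_def)
  have "Ft (B \<nu>) i (node b) = induced \<nu> (adapted_extension i (shiftF i)) (node b)" by (simp add: B_def kashiwara_F_eq[OF i])
  also have "\<dots> = map_option node (tf T i b)"
    by (rule induced_node[OF i b shift_regular_span(2)[OF i], where o' = "tf T i b", OF shiftF_minus[OF i b]])
      (use strings(5)[OF i b] in blast)
  finally show "Ft (B \<nu>) i (node b) = map_option node (Ft (tcrystal T) i b)" by (simp add: tcrystal_def)
qed

end

theorem (in cartan_A2) crystal_iso_table: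
  assumes "valid T"
  shows "\<exists>f. crystal_iso f (tcrystal T) (B (twt T 0))"
proof -
  obtain g where g: "table_module a T (irr_module (twt T 0)) g" "g 0 = hw_vec (twt T 0)"
    using irr_module_table[OF assms] by blast
  interpret X: table_crystal a T g
    by (intro table_crystal.intro table_crystal_axioms.intro g)
  show ?thesis using X.crystal_iso_node by (rule exI[where x = X.node])
qed

section \<open>Cartan components of tensor products\<close>

context cartan_datum
begin

definition closed_crystal :: "'b crystal \<Rightarrow> bool"
  where "closed_crystal C \<longleftrightarrow> (\<forall>b\<in>elts C. \<forall>i\<in>I. \<forall>c. (Et C i b = Some c \<longrightarrow> c \<in> elts C) \<and> (Ft C i b = Some c \<longrightarrow> c \<in> elts C))"

lemma closed_crystalD:
  assumes "closed_crystal C" "b \<in> elts C" "i \<in> I"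
  shows "Et C i b = Some c \<Longrightarrow> c \<in> elts C" "Ft C i b = Some c \<Longrightarrow> c \<in> elts C"
  using assms unfolding closed_crystal_def by blast+

lemma iter_Suc: "iter f (Suc k) b = Option.bind (iter f k b) f"
  by (simp add: iter_def)

lemma iter_0: "iter f 0 b = Some b"
  by (simp add: iter_def)

lemma iter_map:
  assumes "\<forall>b\<in>X. \<forall>c. f b = Some c \<longrightarrow> c \<in> X" "\<forall>b\<in>X. f' (h b) = map_option h (f b)" "b \<in> X"
  shows "iter f' k (h b) = map_option h (iter f k b) \<and> (\<forall>c. iter f k b = Some c \<longrightarrow> c \<in> X)"
proof (induction k)
  case 0
  then show ?case using assms(3) by (simp add: iter_0)
next
  case (Suc k)
  then show ?case using assms(1,2) by (cases "iter f k b") (auto simp: iter_Suc)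
qed

lemma eps_phi_iso:
  assumes "crystal_iso h C D" "closed_crystal C" "b \<in> elts C" "i \<in> I"
  shows "eps D i (h b) = eps C i b" "phi D i (h b) = phi C i b"
proof -
  have c: "\<forall>x\<in>elts C. \<forall>y. Et C i x = Some y \<longrightarrow> y \<in> elts C"
    "\<forall>x\<in>elts C. \<forall>y. Ft C i x = Some y \<longrightarrow> y \<in> elts C"
    using closed_crystalD[OF assms(2) _ assms(4)] by blast+
  have e: "\<forall>x\<in>elts C. Et D i (h x) = map_option h (Et C i x)"
    "\<forall>x\<in>elts C. Ft D i (h x) = map_option h (Ft C i x)"
    using assms(1,4) by (simp_all add: crystal_iso_def)
  have "iter (Et D i) k (h b) = map_option h (iter (Et C i) k b)"
    "iter (Ft D i) k (h b) = map_option h (iter (Ft C i) k b)" for k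
    using iter_map[OF c(1) e(1) assms(3), of k] iter_map[OF c(2) e(2) assms(3), of k] by simp_all
  then show "eps D i (h b) = eps C i b" "phi D i (h b) = phi C i b" by (simp_all add: eps_def phi_def)
qed

lemma tensor_iso:
  assumes "crystal_iso h C D" "closed_crystal C" "crystal_iso h' C' D'" "closed_crystal C'"
  shows "crystal_iso (map_prod h h') (C \<otimes> C') (D \<otimes> D')"
  unfolding crystal_iso_def
proof (intro conjI ballI)
  show "bij_betw (map_prod h h') (elts (C \<otimes> C')) (elts (D \<otimes> D'))"
    using assms(1,3) bij_betw_map_prod[of h "elts C" "elts D" h' "elts C'" "elts D'"]
    by (simp add: tensor_def crystal_iso_def)
  fix x assume "x \<in> elts (C \<otimes> C')"
  then obtain b b' where x: "x = (b, b')" "b \<in> elts C" "b' \<in> elts C'" by (auto simp: tensor_def)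
  show "wt (D \<otimes> D') (map_prod h h' x) = wt (C \<otimes> C') x"
    using assms x by (simp add: tensor_def crystal_iso_def)
  fix i assume i: "i \<in> I"
  have e: "Et D i (h b) = map_option h (Et C i b)" "Ft D i (h b) = map_option h (Ft C i b)"
    "Et D' i (h' b') = map_option h' (Et C' i b')" "Ft D' i (h' b') = map_option h' (Ft C' i b')"
    using assms(1,3) x i by (simp_all add: crystal_iso_def)
  note p = eps_phi_iso[OF assms(1,2) x(2) i] eps_phi_iso[OF assms(3,4) x(3) i]
  show "Et (D \<otimes> D') i (map_prod h h' x) = map_option (map_prod h h') (Et (C \<otimes> C') i x)"
    "Ft (D \<otimes> D') i (map_prod h h' x) = map_option (map_prod h h') (Ft (C \<otimes> C') i x)"
    by (simp_all add: tensor_def x(1) p e option.map_comp comp_def)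
qed

text \<open>An embedding of crystals that commutes strictly with the Kashiwara operators.\<close>

definition compatible :: "('b \<Rightarrow> 'c) \<Rightarrow> 'b crystal \<Rightarrow> 'c crystal \<Rightarrow> bool"
  where "compatible f A Q \<longleftrightarrow> inj_on f (elts A) \<and> f ` elts A \<subseteq> elts Q \<and> (\<forall>b\<in>elts A. wt Q (f b) = wt A b \<and>
    (\<forall>i\<in>I. Et Q i (f b) = map_option f (Et A i b) \<and> Ft Q i (f b) = map_option f (Ft A i b)))"

definition reaches :: "'b crystal \<Rightarrow> 'b \<Rightarrow> bool"
  where "reaches A a0 \<longleftrightarrow> a0 \<in> elts A \<and> (\<forall>b\<in>elts A. (a0, b) \<in> (arrows A)\<^sup>*)"

definition invertible :: "'b crystal \<Rightarrow> bool"
  where "invertible Q \<longleftrightarrow> (\<forall>x\<in>elts Q. \<forall>i\<in>I. \<forall>y. Ft Q i x = Some y \<longrightarrow> Et Q i y = Some x)"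

lemma compatible_iso: "compatible f A Q \<Longrightarrow> crystal_iso f A (Q\<lparr>elts := f ` elts A\<rparr>)"
  by (auto simp: compatible_def crystal_iso_def bij_betw_def)

text \<open>
  The image is closed under the arrows that leave it. It is also closed under those that enter it,
  since a reversed arrow of \<open>Q\<close> is a step of some raising operator.
\<close>

lemma compatible_component:
  assumes "compatible f A Q" "closed_crystal A" "reaches A a0" "invertible Q"
  shows "f ` elts A \<in> components Q"
proof -
  let ?R = "(arrows Q \<union> (arrows Q)\<inverse>)\<^sup>*"
  have a0: "a0 \<in> elts A" using assms(3) by (simp add: reaches_def)
  have fw: "(f x, f y) \<in> arrows Q" if xy: "(x, y) \<in> arrows A" for x y
  proof -
    obtain i where "x \<in> elts A" "y \<in> elts A" "i \<in> I" "Ft A i x = Some y" using xy by (auto simp: arrows_def)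
    then show ?thesis using assms(1) unfolding compatible_def arrows_def by force
  qed
  have "(f a0, f b) \<in> ?R" if b: "b \<in> elts A" for b
  proof -
    have "(a0, b) \<in> (arrows A)\<^sup>*" using assms(3) b by (simp add: reaches_def)
    then show ?thesis
    proof (induction rule: rtrancl_induct)
      case (step y z)
      then show ?case using fw by (meson UnI1 rtrancl.rtrancl_into_rtrancl)
    qed simp
  qed
  moreover have "y \<in> f ` elts A" if y: "(f a0, y) \<in> ?R" for y
    using y
  proof (induction rule: rtrancl_induct)
    case base
    then show ?case using a0 by simp
  next
    case (step y z)
    then obtain b where b: "b \<in> elts A" "y = f b" by blast
    from step(2) show ?case
    proof
      assume "(y, z) \<in> arrows Q"
      then obtain i where i: "i \<in> I" "Ft Q i y = Some z" by (auto simp: arrows_def)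
      then obtain c where "Ft A i b = Some c" "z = f c" using assms(1) b by (auto simp: compatible_def)
      then show ?thesis using closed_crystalD[OF assms(2) b(1) i(1)] by blast
    next
      assume "(y, z) \<in> (arrows Q)\<inverse>"
      then obtain i where i: "i \<in> I" "Ft Q i z = Some y" "z \<in> elts Q" by (auto simp: arrows_def)
      then have "Et Q i y = Some z" using assms(4) by (simp add: invertible_def)
      then obtain c where "Et A i b = Some c" "z = f c" using assms(1) b i by (auto simp: compatible_def)
      then show ?thesis using closed_crystalD[OF assms(2) b(1) i(1)] by blast
    qed
  qed
  ultimately have "f ` elts A = ?R `` {f a0}" by blast
  moreover have "f a0 \<in> elts Q" using assms(1) a0 by (auto simp: compatible_def)
  ultimately show ?thesis unfolding components_def by (simp add: quotientI)
qed

text \<open>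
  The weight of \<open>a0\<close> leaves only one choice for its image, and all other elements are reached from
  \<open>a0\<close> by lowering operators.
\<close>

lemma iso_unique:
  assumes "compatible f A Q" "closed_crystal A" "reaches A a0"
    and "\<And>x. x \<in> elts Q \<Longrightarrow> wt Q x = wt A a0 \<Longrightarrow> x = f a0"
    and "crystal_iso h A (Q\<lparr>elts := X\<rparr>)" "X \<subseteq> elts Q"
  shows "\<And>b. b \<in> elts A \<Longrightarrow> h b = f b" "X = f ` elts A"
proof -
  have a0: "a0 \<in> elts A" using assms(3) by (simp add: reaches_def)
  have X: "X = h ` elts A" using assms(5) by (simp add: crystal_iso_def bij_betw_def)
  have "h a0 \<in> elts Q" using X assms(6) a0 by blast
  moreover have "wt Q (h a0) = wt A a0" using assms(5) a0 by (simp add: crystal_iso_def)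
  ultimately have start: "h a0 = f a0" by (rule assms(4))
  show *: "h b = f b" if b: "b \<in> elts A" for b
  proof -
    have "(a0, b) \<in> (arrows A)\<^sup>*" using assms(3) b by (simp add: reaches_def)
    then show ?thesis
    proof (induction rule: rtrancl_induct)
      case base
      show ?case by (rule start)
    next
      case (step y z)
      then obtain i where i: "y \<in> elts A" "i \<in> I" "Ft A i y = Some z" by (auto simp: arrows_def)
      have "Ft Q i (h y) = Some (h z)" using assms(5) i by (simp add: crystal_iso_def)
      moreover have "Ft Q i (f y) = Some (f z)" using assms(1) i by (simp add: compatible_def)
      ultimately show ?case using step by simp
    qed
  qed
  then show "X = f ` elts A" unfolding X by (intro image_cong) simp_all
qed

lemma iso_restrict:
  assumes "crystal_iso f A D" "closed_crystal A"
  shows "crystal_iso (restrict f (elts A)) A D"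
  unfolding crystal_iso_def
proof (intro conjI ballI)
  let ?r = "restrict f (elts A)"
  show "bij_betw ?r (elts A) (elts D)"
    using assms(1) bij_betw_cong[of "elts A" ?r f] by (simp add: crystal_iso_def)
  fix b assume b: "b \<in> elts A"
  show "wt D (?r b) = wt A b" using assms(1) b by (simp add: crystal_iso_def)
  fix i assume i: "i \<in> I"
  have r: "map_option ?r z = map_option f z" if "\<forall>c. z = Some c \<longrightarrow> c \<in> elts A" for z
    using that by (cases z) simp_all
  have "\<forall>c. Et A i b = Some c \<longrightarrow> c \<in> elts A" "\<forall>c. Ft A i b = Some c \<longrightarrow> c \<in> elts A"
    using closed_crystalD[OF assms(2) b i] by blast+
  from this[THEN r] show "Et D i (?r b) = map_option ?r (Et A i b)" "Ft D i (?r b) = map_option ?r (Ft A i b)"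
    using assms(1) b i by (simp_all add: crystal_iso_def)
qed

lemma components_subset: "X \<in> components Q \<Longrightarrow> X \<subseteq> elts Q"
proof
  fix x assume X: "X \<in> components Q" "x \<in> X"
  then obtain q where q: "q \<in> elts Q" "(q, x) \<in> (arrows Q \<union> (arrows Q)\<inverse>)\<^sup>*"
    unfolding components_def quotient_def by blast
  from q(2) show "x \<in> elts Q"
    by (induction rule: rtrancl_induct) (auto simp: q(1) arrows_def)
qed

text \<open>Both definite descriptions, of the component and of the inclusion, are met by \<open>f\<close> and by nothing else.\<close>

lemma cartan_eqI:
  fixes \<nu> \<mu> :: weight
  defines "A \<equiv> B (\<nu> + \<mu>)" and "Q \<equiv> B \<nu> \<otimes> B \<mu>"
  assumes "compatible f A Q" "closed_crystal A" "reaches A a0" "invertible Q"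
    and "\<And>x. x \<in> elts Q \<Longrightarrow> wt Q x = wt A a0 \<Longrightarrow> x = f a0"
  shows "cartan_component \<nu> \<mu> = f ` elts A" "b \<in> elts A \<Longrightarrow> cartan_inclusion \<nu> \<mu> b = f b"
proof -
  have unique: "b \<in> elts A \<Longrightarrow> h b = f b" "X = f ` elts A"
    if "X \<in> components Q" "crystal_iso h A (Q\<lparr>elts := X\<rparr>)" for X h b
    using iso_unique[OF assms(3-5,7) that(2) components_subset[OF that(1)]] by blast+
  have comp: "f ` elts A \<in> components Q" by (rule compatible_component[OF assms(3-6)])
  have iso: "crystal_iso f A (Q\<lparr>elts := f ` elts A\<rparr>)" by (rule compatible_iso[OF assms(3)])
  show cc: "cartan_component \<nu> \<mu> = f ` elts A"
    unfolding cartan_component_def A_def[symmetric] Q_def[symmetric]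
    by (rule the_equality) (use comp iso unique(2) in blast)+
  have "cartan_inclusion \<nu> \<mu> = restrict f (elts A)"
    unfolding cartan_inclusion_def cc A_def[symmetric] Q_def[symmetric]
  proof (rule the_equality)
    show "restrict f (elts A) \<in> extensional (elts A) \<and> crystal_iso (restrict f (elts A)) A (Q\<lparr>elts := f ` elts A\<rparr>)"
      using iso_restrict[OF iso assms(4)] by simp
    fix h assume h: "h \<in> extensional (elts A) \<and> crystal_iso h A (Q\<lparr>elts := f ` elts A\<rparr>)"
    then show "h = restrict f (elts A)"
      using unique(1)[OF comp] by (intro extensionalityI[of _ "elts A"]) simp_all
  qed
  then show "b \<in> elts A \<Longrightarrow> cartan_inclusion \<nu> \<mu> b = f b" by simp
qed

end

subsection \<open>Cartan components from tables\<close>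

definition tensor_te :: "table \<Rightarrow> table \<Rightarrow> nat \<Rightarrow> nat \<times> nat \<Rightarrow> (nat \<times> nat) option" where
  "tensor_te T1 T2 i = (\<lambda>(b, b'). if tphi T1 i b \<ge> teps T2 i b'
     then map_option (\<lambda>x. (x, b')) (te T1 i b) else map_option (\<lambda>y. (b, y)) (te T2 i b'))"

definition tensor_tf :: "table \<Rightarrow> table \<Rightarrow> nat \<Rightarrow> nat \<times> nat \<Rightarrow> (nat \<times> nat) option" where
  "tensor_tf T1 T2 i = (\<lambda>(b, b'). if tphi T1 i b > teps T2 i b'
     then map_option (\<lambda>x. (x, b')) (tf T1 i b) else map_option (\<lambda>y. (b, y)) (tf T2 i b'))"

text \<open>
  The list \<open>m\<close> contains the images of the elements. The last two conditions concern the whole tensor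
  product: its raising operators invert the lowering ones, and its highest weight occurs only once.
\<close>

definition check_embedding :: "table \<Rightarrow> table \<Rightarrow> table \<Rightarrow> (nat \<times> nat) list \<Rightarrow> bool" where
  "check_embedding T T1 T2 m \<longleftrightarrow> length m = tsize T \<and> distinct m \<and>
     list_all (\<lambda>(b1, b2). b1 < tsize T1 \<and> b2 < tsize T2) m \<and>
     list_all (\<lambda>j. twt T 0 j = twt T1 0 j + twt T2 0 j) [1, 2] \<and>
     list_all (\<lambda>b. list_all (\<lambda>i. twt T1 (fst (m ! b)) i + twt T2 (snd (m ! b)) i = twt T b i \<and>
        tensor_te T1 T2 i (m ! b) = map_option (\<lambda>c. m ! c) (te T i b) \<and>
        tensor_tf T1 T2 i (m ! b) = map_option (\<lambda>c. m ! c) (tf T i b)) [1, 2]) [0..<tsize T] \<and>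
     list_all (\<lambda>b1. list_all (\<lambda>b2.
        list_all (\<lambda>i. case tensor_tf T1 T2 i (b1, b2) of None \<Rightarrow> True | Some y \<Rightarrow> tensor_te T1 T2 i y = Some (b1, b2)) [1, 2] \<and>
        (list_all (\<lambda>i. twt T1 b1 i + twt T2 b2 i = twt T 0 i) [1, 2] \<longrightarrow> (b1, b2) = m ! 0))
       [0..<tsize T2]) [0..<tsize T1]"

context cartan_A2
begin

lemma iter_max:
  assumes "\<And>b. b < N \<Longrightarrow> f b = None \<longleftrightarrow> d b = (0::nat)" "\<And>b c. b < N \<Longrightarrow> f b = Some c \<Longrightarrow> c < N \<and> d b = Suc (d c)" "b < N"
  shows "Max {k. iter f k b \<noteq> None} = d b"
proof -
  have *: "(k \<le> d b \<longrightarrow> (\<exists>c. iter f k b = Some c \<and> c < N \<and> d c + k = d b)) \<and> (k > d b \<longrightarrow> iter f k b = None)" for k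
  proof (induction k)
    case 0
    then show ?case using assms(3) by (simp add: iter_0)
  next
    case (Suc k)
    show ?case
    proof (cases "k \<le> d b")
      case True
      then obtain c where c: "iter f k b = Some c" "c < N" "d c + k = d b" using Suc by blast
      show ?thesis
      proof (cases "f c")
        case None
        then show ?thesis using c assms(1) by (simp add: iter_Suc)
      next
        case (Some c')
        then show ?thesis using c assms(2)[OF c(2) Some] by (simp add: iter_Suc)
      qed
    next
      case False
      then show ?thesis using Suc by (simp add: iter_Suc)
    qed
  qed
  have "iter f k b \<noteq> None \<longleftrightarrow> k \<le> d b" for k using *[of k] by (cases "k \<le> d b") auto
  then have "{k. iter f k b \<noteq> None} = {..d b}" by blast
  moreover have "Max {..d b} = d b" by (intro Max_eqI) auto
  ultimately show ?thesis by simp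
qed

lemma eps_tcrystal:
  assumes "check_strings T" "i \<in> {1, 2}" "b < tsize T"
  shows "eps (tcrystal T) i b = teps T i b" "phi (tcrystal T) i b = tphi T i b"
proof -
  note D = check_strings_D[OF assms(1,2)]
  have "Max {k. iter (te T i) k b \<noteq> None} = teps T i b"
  proof (rule iter_max[OF D(1) _ assms(3)])
    show "c < tsize T \<and> teps T i b = Suc (teps T i c)" if "b < tsize T" "te T i b = Some c" for b c
      using D(3)[OF that] by simp
  qed
  then show "eps (tcrystal T) i b = teps T i b" by (simp add: eps_def tcrystal_def)
  have "Max {k. iter (tf T i) k b \<noteq> None} = tphi T i b"
  proof (rule iter_max[OF D(2) _ assms(3)])
    show "c < tsize T \<and> tphi T i b = Suc (tphi T i c)" if "b < tsize T" "tf T i b = Some c" for b c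
      using D(4)[OF that] by simp
  qed
  then show "phi (tcrystal T) i b = tphi T i b" by (simp add: phi_def tcrystal_def)
qed

lemma closed_tcrystal: "check_strings T \<Longrightarrow> closed_crystal (tcrystal T)"
  using check_strings_D(3,4)[of T] unfolding closed_crystal_def I_eq tcrystal_def crystal.simps by blast

lemma closed_iso:
  assumes "crystal_iso h C D" "closed_crystal C"
  shows "closed_crystal D"
  unfolding closed_crystal_def
proof (intro ballI allI)
  fix x i c assume x: "x \<in> elts D" and i: "i \<in> I"
  have bij: "bij_betw h (elts C) (elts D)" using assms(1) by (simp add: crystal_iso_def)
  then obtain b where b: "b \<in> elts C" "x = h b" using x by (auto simp: bij_betw_def)
  have "Et D i x = map_option h (Et C i b)" "Ft D i x = map_option h (Ft C i b)"
    using assms(1) b i by (simp_all add: crystal_iso_def)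
  then show "(Et D i x = Some c \<longrightarrow> c \<in> elts D) \<and> (Ft D i x = Some c \<longrightarrow> c \<in> elts D)"
    using closed_crystalD[OF assms(2) b(1) i] bij
    by (cases "Et C i b"; cases "Ft C i b") (auto simp: bij_betw_def)
qed

lemma reaches_tcrystal:
  assumes "check_strings T" "check_reach T"
  shows "reaches (tcrystal T) 0"
  unfolding reaches_def
proof (intro conjI ballI)
  show "0 \<in> elts (tcrystal T)" using assms(2) by (simp add: tcrystal_def check_reach_def)
  fix b assume "b \<in> elts (tcrystal T)"
  then have "b < tsize T" by (simp add: tcrystal_def)
  then show "(0, b) \<in> (arrows (tcrystal T))\<^sup>*"
  proof (induction b rule: less_induct)
    case (less b)
    show ?case
    proof (cases "b = 0")
      case False
      then have "list_ex (\<lambda>i. case te T i b of None \<Rightarrow> False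
         | Some c \<Rightarrow> c < b \<and> tcor T i b = None \<and> tcor T i c = None) [1, 2]"
        using assms(2)[unfolded check_reach_def, THEN conjunct2, THEN list_allD, of b] less.prems by simp
      then obtain i where i: "i \<in> {1, 2}" "case te T i b of None \<Rightarrow> False
         | Some c \<Rightarrow> c < b \<and> tcor T i b = None \<and> tcor T i c = None" unfolding list_ex_iff by auto
      then obtain c where c: "te T i b = Some c" "c < b" by (cases "te T i b") simp_all
      then have "c < tsize T" "tf T i c = Some b" using check_strings_D(3)[OF assms(1) i(1) less.prems] by auto
      then have "(c, b) \<in> arrows (tcrystal T)"
        using i(1) less.prems by (auto simp: arrows_def tcrystal_def I_eq)
      then show ?thesis using less.IH[OF c(2) \<open>c < tsize T\<close>] by (meson rtrancl.rtrancl_into_rtrancl)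
    qed simp
  qed
qed

lemma reaches_iso:
  assumes "crystal_iso h C D" "reaches C c0"
  shows "reaches D (h c0)"
  unfolding reaches_def
proof (intro conjI ballI)
  have bij: "bij_betw h (elts C) (elts D)" using assms(1) by (simp add: crystal_iso_def)
  show "h c0 \<in> elts D" using bij assms(2) by (auto simp: bij_betw_def reaches_def)
  have step: "(h x, h y) \<in> arrows D" if xy: "(x, y) \<in> arrows C" for x y
  proof -
    obtain i where i: "x \<in> elts C" "y \<in> elts C" "i \<in> I" "Ft C i x = Some y" using xy by (auto simp: arrows_def)
    then have "Ft D i (h x) = Some (h y)" using assms(1) by (simp add: crystal_iso_def)
    then show ?thesis using i bij by (auto simp: arrows_def bij_betw_def)
  qed
  fix d assume "d \<in> elts D"
  then obtain c where c: "c \<in> elts C" "d = h c" using bij by (auto simp: bij_betw_def)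
  have "(c0, c) \<in> (arrows C)\<^sup>*" using assms(2) c by (simp add: reaches_def)
  then show "(h c0, d) \<in> (arrows D)\<^sup>*" unfolding c(2)
  proof (induction rule: rtrancl_induct)
    case (step y z)
    then show ?case using \<open>\<And>x y. (x, y) \<in> arrows C \<Longrightarrow> (h x, h y) \<in> arrows D\<close> by (meson rtrancl.rtrancl_into_rtrancl)
  qed simp
qed

theorem cartan_table:
  assumes "valid T" "valid T1" "valid T2" "check_embedding T T1 T2 m"
    and f: "crystal_iso f (tcrystal T) (B (twt T 0))"
    and f1: "crystal_iso f1 (tcrystal T1) (B (twt T1 0))"
    and f2: "crystal_iso f2 (tcrystal T2) (B (twt T2 0))"
  shows "cartan_component (twt T1 0) (twt T2 0) = (\<lambda>b. map_prod f1 f2 (m ! b)) ` {..<tsize T}"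
    "b < tsize T \<Longrightarrow> cartan_inclusion (twt T1 0) (twt T2 0) (f b) = map_prod f1 f2 (m ! b)"
proof -
  have chk: "check_strings T" "check_strings T1" "check_strings T2" "check_reach T"
    using assms(1-3) by (simp_all add: valid_def)
  define P where "P = tcrystal T1 \<otimes> tcrystal T2"
  note chk_m = assms(4)[unfolded check_embedding_def]
  have E: "length m = tsize T" "distinct m" by (rule chk_m[THEN conjunct1] chk_m[THEN conjunct2, THEN conjunct1])+
  have "list_all (\<lambda>(b1, b2). b1 < tsize T1 \<and> b2 < tsize T2) m"
    by (rule chk_m[THEN conjunct2, THEN conjunct2, THEN conjunct1])
  then have Eb: "fst (m ! b) < tsize T1 \<and> snd (m ! b) < tsize T2" if "b < tsize T" for b
    using that E(1) by (simp add: list_all_length split_beta)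
  have Ew: "twt T 0 j = twt T1 0 j + twt T2 0 j" if "j \<in> {1, 2}" for j
    using chk_m[THEN conjunct2, THEN conjunct2, THEN conjunct2, THEN conjunct1, THEN list_allD, of j] that by simp
  have E1: "twt T1 (fst (m ! b)) i + twt T2 (snd (m ! b)) i = twt T b i"
      "tensor_te T1 T2 i (m ! b) = map_option (\<lambda>c. m ! c) (te T i b)"
      "tensor_tf T1 T2 i (m ! b) = map_option (\<lambda>c. m ! c) (tf T i b)" if "i \<in> {1, 2}" "b < tsize T" for i b
    using chk_m[THEN conjunct2, THEN conjunct2, THEN conjunct2, THEN conjunct2,
        THEN conjunct1, THEN list_allD, of b, THEN list_allD, of i] that by simp_all
  have E2: "case tensor_tf T1 T2 i (b1, b2) of None \<Rightarrow> True | Some y \<Rightarrow> tensor_te T1 T2 i y = Some (b1, b2)"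
    if "i \<in> {1, 2}" "b1 < tsize T1" "b2 < tsize T2" for i b1 b2
    using chk_m[THEN conjunct2, THEN conjunct2, THEN conjunct2, THEN conjunct2,
        THEN conjunct2, THEN list_allD, of b1, THEN list_allD, of b2, THEN conjunct1, THEN list_allD, of i] that by simp
  have E3: "(\<forall>i\<in>{1, 2}. twt T1 b1 i + twt T2 b2 i = twt T 0 i) \<longrightarrow> (b1, b2) = m ! 0"
    if "b1 < tsize T1" "b2 < tsize T2" for b1 b2
    using chk_m[THEN conjunct2, THEN conjunct2, THEN conjunct2, THEN conjunct2,
        THEN conjunct2, THEN list_allD, of b1, THEN list_allD, of b2, THEN conjunct2] that by simp
  have P_elts: "elts P = {..<tsize T1} \<times> {..<tsize T2}" by (simp add: P_def tensor_def tcrystal_def)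
  have P_ops: "Et P i x = tensor_te T1 T2 i x" "Ft P i x = tensor_tf T1 T2 i x" if "i \<in> {1, 2}" "x \<in> elts P" for i x
  proof -
    obtain b b' where x: "x = (b, b')" "b < tsize T1" "b' < tsize T2" using \<open>x \<in> elts P\<close> P_elts by blast
    show "Et P i x = tensor_te T1 T2 i x" "Ft P i x = tensor_tf T1 T2 i x"
      unfolding x(1) P_def tensor_def tensor_te_def tensor_tf_def
      using eps_tcrystal(2)[OF chk(2) that(1) x(2)] eps_tcrystal(1)[OF chk(3) that(1) x(3)]
      by (simp_all add: tcrystal_def)
  qed
  have comp_m: "compatible (\<lambda>b. m ! b) (tcrystal T) P"
    unfolding compatible_def
  proof (intro conjI ballI)
    show "inj_on (\<lambda>b. m ! b) (elts (tcrystal T))"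
      using E(1,2) by (auto simp: tcrystal_def inj_on_def nth_eq_iff_index_eq)
    show in_P: "(\<lambda>b. m ! b) ` elts (tcrystal T) \<subseteq> elts P"
      using Eb by (intro image_subsetI) (simp add: tcrystal_def P_elts mem_Times_iff)
    fix b assume b: "b \<in> elts (tcrystal T)"
    then have bN: "b < tsize T" by (simp add: tcrystal_def)
    have mb: "m ! b \<in> elts P" using in_P b by blast
    show "wt P (m ! b) = wt (tcrystal T) b"
    proof
      fix j
      have "wt P (m ! b) j = twt T1 (fst (m ! b)) j + twt T2 (snd (m ! b)) j"
        by (simp add: P_def tensor_def tcrystal_def plus_fun_def split_beta)
      then show "wt P (m ! b) j = wt (tcrystal T) b j"
        using E1(1)[of j b] bN by (cases "j \<in> {1, 2}") (auto simp: tcrystal_def twt_def)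
    qed
    fix i assume "i \<in> I"
    then have i: "i \<in> {1, 2}" by (simp add: I_eq)
    show "Et P i (m ! b) = map_option (\<lambda>b. m ! b) (Et (tcrystal T) i b)"
      "Ft P i (m ! b) = map_option (\<lambda>b. m ! b) (Ft (tcrystal T) i b)"
      using P_ops[OF i mb] E1(2,3)[OF i bN] by (simp_all add: tcrystal_def)
  qed
  define Q where "Q = B (twt T1 0) \<otimes> B (twt T2 0)"
  have PQ: "crystal_iso (map_prod f1 f2) P Q"
    unfolding P_def Q_def by (rule tensor_iso[OF f1 closed_tcrystal[OF chk(2)] f2 closed_tcrystal[OF chk(3)]])
  have PQ_img: "elts Q = map_prod f1 f2 ` elts P" using PQ by (simp add: crystal_iso_def bij_betw_def)
  have PQ_wt: "wt Q (map_prod f1 f2 p) = wt P p" if "p \<in> elts P" for p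
    using PQ that by (simp add: crystal_iso_def)
  have PQ_ops: "Et Q i (map_prod f1 f2 p) = map_option (map_prod f1 f2) (Et P i p)"
    "Ft Q i (map_prod f1 f2 p) = map_option (map_prod f1 f2) (Ft P i p)" if "p \<in> elts P" "i \<in> I" for p i
    using PQ that by (simp_all add: crystal_iso_def)
  have inv_P: "invertible P" unfolding invertible_def
  proof (intro ballI allI impI)
    fix x i y assume *: "x \<in> elts P" "i \<in> I" "Ft P i x = Some y"
    then have i: "i \<in> {1, 2}" by (simp add: I_eq)
    obtain b1 b2 where x: "x = (b1, b2)" "b1 < tsize T1" "b2 < tsize T2" using *(1) P_elts by blast
    have y: "tensor_tf T1 T2 i (b1, b2) = Some y" using P_ops(2)[OF i *(1)] *(3) x by simp
    then have "tensor_te T1 T2 i y = Some x" using E2[OF i x(2,3)] x(1) by simp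
    moreover have "y \<in> elts P" using y x check_strings_D(4)[OF chk(2) i x(2)] check_strings_D(4)[OF chk(3) i x(3)]
      by (auto simp: tensor_tf_def P_elts split: if_splits)
    ultimately show "Et P i y = Some x" using P_ops(1)[OF i] by simp
  qed
  have inv_Q: "invertible Q" unfolding invertible_def
  proof (intro ballI allI impI)
    fix x i y assume *: "x \<in> elts Q" "i \<in> I" "Ft Q i x = Some y"
    obtain p where p: "p \<in> elts P" "x = map_prod f1 f2 p" using *(1) unfolding PQ_img by (rule imageE) simp
    have "Ft Q i x = map_option (map_prod f1 f2) (Ft P i p)" unfolding p(2) by (rule PQ_ops(2)[OF p(1) *(2)])
    then obtain r where r: "Ft P i p = Some r" "y = map_prod f1 f2 r" using *(3) by (cases "Ft P i p") simp_all
    have e: "Et P i r = Some p" using inv_P p r *(2) unfolding invertible_def by blast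
    have "r \<in> elts P"
    proof -
      have i: "i \<in> {1, 2}" using *(2) by (simp add: I_eq)
      obtain b1 b2 where x: "p = (b1, b2)" "b1 < tsize T1" "b2 < tsize T2" using p(1) P_elts by blast
      have "tensor_tf T1 T2 i (b1, b2) = Some r" using P_ops(2)[OF i p(1)] r x by simp
      then show ?thesis using x check_strings_D(4)[OF chk(2) i x(2)] check_strings_D(4)[OF chk(3) i x(3)]
        by (auto simp: tensor_tf_def P_elts split: if_splits)
    qed
    then have "Et Q i y = map_option (map_prod f1 f2) (Et P i r)" unfolding r(2) by (rule PQ_ops(1)[OF _ *(2)])
    then show "Et Q i y = Some x" using e p(2) by simp
  qed
  define A where "A = B (twt T 0)"
  have bij_f: "bij_betw f (elts (tcrystal T)) (elts A)" using f by (simp add: crystal_iso_def A_def)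
  have eA: "elts A = f ` {..<tsize T}" using bij_f by (simp add: bij_betw_def tcrystal_def)
  have inj_f: "inj_on f {..<tsize T}" using bij_f by (simp add: bij_betw_def tcrystal_def)
  define F where "F x = map_prod f1 f2 (m ! inv_into {..<tsize T} f x)" for x
  have F_f: "F (f b) = map_prod f1 f2 (m ! b)" if "b < tsize T" for b
    using that by (simp add: F_def inv_into_f_f[OF inj_f])
  have sum: "twt T1 0 + twt T2 0 = twt T 0"
  proof
    fix j show "(twt T1 0 + twt T2 0) j = twt T 0 j"
      using Ew[of j] by (cases "j \<in> {1, 2}") (auto simp: plus_fun_def twt_def)
  qed
  have inj_12: "inj_on (map_prod f1 f2) (elts P)" using PQ by (simp add: crystal_iso_def bij_betw_def)
  have m_P: "m ! b \<in> elts P" if "b < tsize T" for b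
    using comp_m that unfolding compatible_def tcrystal_def by auto
  have comp: "compatible F A Q"
    unfolding compatible_def
  proof (intro conjI ballI)
    show "inj_on F (elts A)"
    proof (rule inj_onI)
      fix x y assume *: "x \<in> elts A" "y \<in> elts A" "F x = F y"
      then obtain b c where bc: "x = f b" "b < tsize T" "y = f c" "c < tsize T" unfolding eA by blast
      then have "map_prod f1 f2 (m ! b) = map_prod f1 f2 (m ! c)" using *(3) F_f by simp
      then have "m ! b = m ! c" by (rule inj_onD[OF inj_12 _ m_P[OF bc(2)] m_P[OF bc(4)]])
      then show "x = y" using bc E(1,2) by (simp add: nth_eq_iff_index_eq)
    qed
    show "F ` elts A \<subseteq> elts Q" unfolding eA image_image PQ_img
      by (intro image_subsetI) (simp add: F_f m_P)
    fix x assume "x \<in> elts A"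
    then obtain b where b: "x = f b" "b < tsize T" unfolding eA by blast
    then have bT: "b \<in> elts (tcrystal T)" by (simp add: tcrystal_def)
    have "wt Q (F x) = wt P (m ! b)" unfolding b(1) F_f[OF b(2)] by (rule PQ_wt[OF m_P[OF b(2)]])
    also have "\<dots> = wt (tcrystal T) b" using comp_m bT by (simp add: compatible_def)
    also have "\<dots> = wt A x" using f bT b(1) by (simp add: crystal_iso_def A_def)
    finally show "wt Q (F x) = wt A x" .
    fix i assume i: "i \<in> I"
    then have i': "i \<in> {1, 2}" by (simp add: I_eq)
    have Fm: "map_option F (map_option f z) = map_option (map_prod f1 f2) (map_option (\<lambda>b. m ! b) z)"
      if "\<And>c. z = Some c \<Longrightarrow> c < tsize T" for z using that F_f by (cases z) simp_all
    have "Et Q i (F x) = map_option (map_prod f1 f2) (Et P i (m ! b))"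
      "Ft Q i (F x) = map_option (map_prod f1 f2) (Ft P i (m ! b))"
      unfolding b(1) F_f[OF b(2)] by (rule PQ_ops[OF m_P[OF b(2)] i])+
    moreover have "Et P i (m ! b) = map_option (\<lambda>b. m ! b) (te T i b)" "Ft P i (m ! b) = map_option (\<lambda>b. m ! b) (tf T i b)"
      using comp_m bT i by (simp_all add: compatible_def tcrystal_def)
    moreover have "Et A i x = map_option f (te T i b)" "Ft A i x = map_option f (tf T i b)"
      using f bT b(1) i by (simp_all add: crystal_iso_def A_def tcrystal_def)
    ultimately show "Et Q i (F x) = map_option F (Et A i x)" "Ft Q i (F x) = map_option F (Ft A i x)"
      using Fm[of "te T i b"] Fm[of "tf T i b"] check_strings_D(3,4)[OF chk(1) i' b(2)] by simp_all
  qed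
  have closed: "closed_crystal A" unfolding A_def by (rule closed_iso[OF f closed_tcrystal[OF chk(1)]])
  have reach: "reaches A (f 0)" unfolding A_def by (rule reaches_iso[OF f reaches_tcrystal[OF chk(1,4)]])
  have N0: "0 < tsize T" using chk(4) by (simp add: check_reach_def)
  have unique: "x = F (f 0)" if x: "x \<in> elts Q" "wt Q x = wt A (f 0)" for x
  proof -
    obtain p where p: "p \<in> elts P" "x = map_prod f1 f2 p" using x(1) unfolding PQ_img by (rule imageE) simp
    obtain b1 b2 where b: "p = (b1, b2)" "b1 < tsize T1" "b2 < tsize T2" using p(1) P_elts by blast
    have "wt P p = wt Q x" unfolding p(2) by (rule PQ_wt[OF p(1), symmetric])
    also have "\<dots> = twt T 0" using x(2) f N0 by (simp add: crystal_iso_def A_def tcrystal_def)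
    finally have "twt T1 b1 i + twt T2 b2 i = twt T 0 i" for i
      unfolding b(1) by (simp add: P_def tensor_def tcrystal_def plus_fun_def fun_eq_iff)
    then have "(b1, b2) = m ! 0" using E3[OF b(2,3)] by blast
    then show ?thesis using p(2) b(1) F_f[OF N0] by simp
  qed
  have Au: "B (twt T1 0 + twt T2 0) = A" unfolding A_def sum ..
  note c = cartan_eqI[of F "twt T1 0" "twt T2 0" "f 0", unfolded Au Q_def[symmetric],
      OF comp closed reach inv_Q unique]
  have "cartan_component (twt T1 0) (twt T2 0) = F ` f ` {..<tsize T}" using c(1) unfolding eA .
  also have "\<dots> = (\<lambda>b. map_prod f1 f2 (m ! b)) ` {..<tsize T}"
    unfolding image_image by (intro image_cong) (simp_all add: F_f)
  finally show "cartan_component (twt T1 0) (twt T2 0) = (\<lambda>b. map_prod f1 f2 (m ! b)) ` {..<tsize T}" .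
  show "cartan_inclusion (twt T1 0) (twt T2 0) (f b) = map_prod f1 f2 (m ! b)" if b: "b < tsize T"
    using c(2)[of "f b"] unfolding F_f[OF b] eA using b by blast
qed

end

text \<open>
  In the names, the factors of the tensor product are listed: \<open>w1\<close> and \<open>w2\<close> stand for the fundamental
  weights. The images are found from \<open>(0, 0)\<close> by applying the lowering operators on both sides.
\<close>

definition emb_w2_w1 where "emb_w2_w1 = [(0, 0), (1, 0), (0, 1), (1, 1), (2, 0), (1, 2), (2, 1), (2::nat, 2::nat)]"
definition emb_w1_w2 where "emb_w1_w2 = [(0, 0), (0, 1), (1, 0), (2, 0), (1, 1), (2, 1), (1, 2), (2::nat, 2::nat)]"
definition emb_2w2_w1 where "emb_2w2_w1 = [(0, 0), (1, 0), (0, 1), (2, 0), (1, 1), (3, 0), (2, 1), (4, 0), (3, 1), (2, 2), (4, 1), (5, 0), (4, 2), (5, 1), (5::nat, 2::nat)]"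
definition emb_rho_w2 where "emb_rho_w2 = [(0, 0), (1, 0), (2, 0), (1, 1), (3, 0), (4, 0), (5, 0), (4, 1), (6, 0), (5, 1), (7, 0), (6, 1), (7, 1), (6, 2), (7::nat, 2::nat)]"

lemma embeddings:
  "check_embedding V11 V01 V10 emb_w2_w1"
  "check_embedding V11 V10 V01 emb_w1_w2"
  "check_embedding V12 V02 V10 emb_2w2_w1"
  "check_embedding V12 V11 V01 emb_rho_w2"
  by code_simp+

section \<open>The missing edge\<close>

context cartan_A2
begin

definition weight_coords :: "int \<Rightarrow> int \<Rightarrow> weight"
  where "weight_coords x y = (\<lambda>j. if j = 1 then x else if j = 2 then y else 0)"

lemma weight_coords_inject: "weight_coords x y = weight_coords x' y' \<longleftrightarrow> x = x' \<and> y = y'"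
proof
  assume "weight_coords x y = weight_coords x' y'"
  from fun_cong[OF this, of 1] fun_cong[OF this, of 2] show "x = x' \<and> y = y'" by (simp add: weight_coords_def)
qed simp

lemma twt_weight_coords: "twt T b = weight_coords (fst (twts T ! b)) (snd (twts T ! b))"
  by (simp add: twt_def weight_coords_def fun_eq_iff)

lemma fund_weight_coords: "fund 1 = weight_coords 1 0" "fund 2 = weight_coords 0 1"
  by (simp_all add: fund_def weight_coords_def fun_eq_iff)

lemma weight_coords_add: "weight_coords x y + weight_coords x' y' = weight_coords (x + x') (y + y')" and weight_coords_diff: "weight_coords x y - weight_coords x' y' = weight_coords (x - x') (y - y')"
  by (auto simp: weight_coords_def fun_eq_iff plus_fun_def fun_diff_def)

lemma rho_weight_coords: "rho = weight_coords 1 1"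
proof -
  have "rho = fund 1 + fund 2" unfolding rho_def I_eq by simp
  then show ?thesis unfolding fund_weight_coords weight_coords_add by simp
qed

lemma refl_weight_coords: "refl 1 (weight_coords x y) = weight_coords (- x) (x + y)" "refl 2 (weight_coords x y) = weight_coords (x + y) (- y)"
  by (auto simp: refl_def weight_coords_def simple_root_def I_eq fun_eq_iff)

lemma table_weights_eq:
  "twt V10 0 = fund 1" "twt V01 0 = fund 2" "twt V11 0 = rho"
  "twt V02 0 = rho + fund 2 - fund 1" "twt V12 0 = rho + fund 2"
  unfolding twt_weight_coords rho_weight_coords fund_weight_coords weight_coords_add weight_coords_diff weight_coords_inject
  by (simp_all add: V10_def V01_def V11_def V02_def V12_def)

lemma word_simps: "word [] = id" "word (i # is) = refl i \<circ> word is"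
  by (simp_all add: word_def)

text \<open>No word of length at most two maps \<open>\<rho>\<close> to \<open>- \<rho>\<close>.\<close>

lemma len_less: "len (refl 1 \<circ> refl 2) < len (refl 2 \<circ> (refl 1 \<circ> refl 2))"
proof -
  have "len (refl 1 \<circ> refl 2) \<le> 2" unfolding len_def
    by (rule Least_le) (auto simp: I_eq word_simps intro!: bexI[of _ "[1, 2]"])
  moreover have "3 \<le> len (refl 2 \<circ> (refl 1 \<circ> refl 2))"
  proof -
    let ?w = "refl 2 \<circ> (refl 1 \<circ> refl 2)"
    have "\<exists>n. \<exists>is\<in>lists I. length is = n \<and> word is = ?w"
      by (auto simp: I_eq word_simps intro!: bexI[of _ "[2, 1, 2]"])
    from LeastI_ex[OF this] obtain "is" where i: "is \<in> lists I" "length is = len ?w" "word is = ?w"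
      unfolding len_def by blast
    have w: "word is (weight_coords 1 1) = weight_coords (-1) (-1)" unfolding i(3) by (simp add: refl_weight_coords del: One_nat_def)
    show ?thesis
    proof (rule ccontr)
      assume "\<not> ?thesis"
      then have "length is \<le> 2" using i(2) by simp
      then consider "is = []" | i where "is = [i]" | i j where "is = [i, j]"
        by (cases "is"; cases "tl is"; cases "tl (tl is)") auto
      then show False
      proof cases
        case 1
        then show ?thesis using w by (simp add: word_simps weight_coords_inject)
      next
        case 2
        then have "i = 1 \<or> i = 2" using i(1) by (simp add: I_eq)
        then show ?thesis using w 2 by (auto simp: word_simps refl_weight_coords weight_coords_inject simp del: One_nat_def)
      next
        case 3
        then have "i = 1 \<or> i = 2" "j = 1 \<or> j = 2" using i(1) by (simp_all add: I_eq)
        then show ?thesis using w 3 by (auto simp: word_simps refl_weight_coords weight_coords_inject simp del: One_nat_def)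
      qed
    qed
  qed
  ultimately show ?thesis by simp
qed

lemma extremal_table:
  assumes "crystal_iso f (tcrystal T) (B (twt T 0))" "k < tsize T" "w (twt T 0) = twt T k"
    and "\<And>b. b < tsize T \<Longrightarrow> twt T b = twt T k \<Longrightarrow> b = k"
  shows "extremal w (twt T 0) = f k"
proof -
  have f: "elts (B (twt T 0)) = f ` {..<tsize T}" "\<And>b. b < tsize T \<Longrightarrow> wt (B (twt T 0)) (f b) = twt T b"
    using assms(1) by (simp_all add: crystal_iso_def bij_betw_def tcrystal_def)
  show ?thesis unfolding extremal_def assms(3)
  proof (rule the_equality)
    show "f k \<in> elts (B (twt T 0)) \<and> wt (B (twt T 0)) (f k) = twt T k" using f assms(2) by simp
    fix x assume x: "x \<in> elts (B (twt T 0)) \<and> wt (B (twt T 0)) x = twt T k"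
    then obtain b where b: "b < tsize T" "x = f b" unfolding f(1) by blast
    then have "twt T b = twt T k" using x f(2)[OF b(1)] by simp
    then show "x = f k" using assms(4)[OF b(1)] b(2) by simp
  qed
qed

lemma weights_V11:
  assumes "b < tsize V11"
  shows "twt V11 b = twt V11 6 \<Longrightarrow> b = 6" "twt V11 b = twt V11 7 \<Longrightarrow> b = 7"
proof -
  have "list_all (\<lambda>b. (twts V11 ! b = twts V11 ! 6 \<longrightarrow> b = 6) \<and> (twts V11 ! b = twts V11 ! 7 \<longrightarrow> b = 7)) [0..<tsize V11]"
    by code_simp
  from list_allD[OF this, of b] show "twt V11 b = twt V11 6 \<Longrightarrow> b = 6" "twt V11 b = twt V11 7 \<Longrightarrow> b = 7"
    using assms by (simp_all add: twt_weight_coords weight_coords_inject prod_eq_iff)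
qed

text \<open>
  The elements 6 and 7 of \<open>V11\<close> have the weights \<open>s\<^sub>1 s\<^sub>2 \<rho>\<close> and \<open>- \<rho>\<close>. The first two conditions
  single out the elements \<open>x\<close> whose left factor is the lowest one; by the third, the right factor is
  lowest too. This leaves the lowest element of \<open>V12\<close>, whose remaining right end is lowest, in contrast
  to that of the element 6.
\<close>

lemma final_check:
  "list_all (\<lambda>x. snd (emb_w2_w1 ! fst (emb_rho_w2 ! x)) = snd (emb_w2_w1 ! 7) \<and>
     snd (emb_w1_w2 ! fst (emb_rho_w2 ! x)) = snd (emb_w1_w2 ! 7) \<and>
     snd (emb_rho_w2 ! x) = snd (emb_w1_w2 ! 6) \<longrightarrow>
     snd (emb_2w2_w1 ! x) \<noteq> snd (emb_w2_w1 ! 6)) [0..<tsize V12]"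
  by code_simp

text \<open>
  Each right end is the second component of a Cartan inclusion, hence given by one of the four
  embeddings. The two ends of the edge yield conditions on the number \<open>x\<close> of \<open>c \<otimes> b\<close> that contradict
  each other.
\<close>

theorem no_embedding: "\<not> cgraph_embedding left_weak_bruhat skeleton iota_W eM"
proof
  assume emb: "cgraph_embedding left_weak_bruhat skeleton iota_W eM"
  obtain f10 where f10: "crystal_iso f10 (tcrystal V10) (B (twt V10 0))" using crystal_iso_table[OF valid_V10] by (rule exE)
  obtain f01 where f01: "crystal_iso f01 (tcrystal V01) (B (twt V01 0))" using crystal_iso_table[OF valid_V01] by (rule exE)
  obtain f11 where f11: "crystal_iso f11 (tcrystal V11) (B (twt V11 0))" using crystal_iso_table[OF valid_V11] by (rule exE)
  obtain f02 where f02: "crystal_iso f02 (tcrystal V02) (B (twt V02 0))" using crystal_iso_table[OF valid_V02] by (rule exE)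
  obtain f12 where f12: "crystal_iso f12 (tcrystal V12) (B (twt V12 0))" using crystal_iso_table[OF valid_V12] by (rule exE)
  note C1 = cartan_table[OF valid_V11 valid_V01 valid_V10 embeddings(1) f11 f01 f10, unfolded table_weights_eq]
  note C2 = cartan_table[OF valid_V11 valid_V10 valid_V01 embeddings(2) f11 f10 f01, unfolded table_weights_eq]
  note C3 = cartan_table[OF valid_V12 valid_V02 valid_V10 embeddings(3) f12 f02 f10, unfolded table_weights_eq]
  note C4 = cartan_table[OF valid_V12 valid_V11 valid_V01 embeddings(4) f12 f11 f01, unfolded table_weights_eq]
  have inj: "inj_on f10 {..<tsize V10}" "inj_on f01 {..<tsize V01}" "inj_on f11 {..<tsize V11}" "inj_on f12 {..<tsize V12}"
    using f10 f01 f11 f12 by (simp_all add: crystal_iso_def bij_betw_def tcrystal_def)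
  have el: "elts (B rho) = f11 ` {..<tsize V11}" "elts (B (rho + fund 2)) = f12 ` {..<tsize V12}"
    using f11 f12 by (simp_all add: crystal_iso_def bij_betw_def tcrystal_def table_weights_eq)
  have diffs: "rho - fund 1 = fund 2" "rho - fund 2 = fund 1" "rho + fund 2 - fund 2 = rho"
    unfolding rho_weight_coords fund_weight_coords weight_coords_add weight_coords_diff by simp_all
  have R1: "right_ends rho (f11 b) 1 = f10 (snd (emb_w2_w1 ! b))"
    and R2: "right_ends rho (f11 b) 2 = f01 (snd (emb_w1_w2 ! b))" if "b < tsize V11" for b
    using C1(2)[OF that] C2(2)[OF that] by (simp_all add: right_ends_def right_end_def I_eq diffs del: One_nat_def)
  have R3: "right_ends (rho + fund 2) (f12 b) 1 = f10 (snd (emb_2w2_w1 ! b))"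
    and R4: "right_ends (rho + fund 2) (f12 b) 2 = f01 (snd (emb_rho_w2 ! b))" if "b < tsize V12" for b
    using C3(2)[OF that] C4(2)[OF that] by (simp_all add: right_ends_def right_end_def I_eq diffs(3) del: One_nat_def)
  have bounds: "snd (emb_w2_w1 ! b) < tsize V10" "snd (emb_w1_w2 ! b) < tsize V01" if "b < tsize V11" for b
  proof -
    have "list_all (\<lambda>b. snd (emb_w2_w1 ! b) < tsize V10 \<and> snd (emb_w1_w2 ! b) < tsize V01) [0..<tsize V11]" by code_simp
    from list_allD[OF this, of b] that show "snd (emb_w2_w1 ! b) < tsize V10" "snd (emb_w1_w2 ! b) < tsize V01" by simp_all
  qed
  have bounds': "snd (emb_2w2_w1 ! b) < tsize V10" "snd (emb_rho_w2 ! b) < tsize V01" "fst (emb_rho_w2 ! b) < tsize V11"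
    if "b < tsize V12" for b
  proof -
    have "list_all (\<lambda>b. snd (emb_2w2_w1 ! b) < tsize V10 \<and> snd (emb_rho_w2 ! b) < tsize V01 \<and> fst (emb_rho_w2 ! b) < tsize V11) [0..<tsize V12]"
      by code_simp
    from list_allD[OF this, of b] that show "snd (emb_2w2_w1 ! b) < tsize V10" "snd (emb_rho_w2 ! b) < tsize V01"
      "fst (emb_rho_w2 ! b) < tsize V11" by simp_all
  qed
  have n: "6 < tsize V11" "7 < tsize V11" by (simp_all add: V11_def)
  \<comment> \<open>The edge under consideration goes from \<open>u\<close> to \<open>w\<close>.\<close>
  define u where "u = refl 1 \<circ> refl 2"
  define w where "w = refl 2 \<circ> u"
  have "u (twt V11 0) = twt V11 6" unfolding twt_weight_coords u_def
    by (simp add: V11_def refl_weight_coords del: One_nat_def)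
  from extremal_table[of f11 V11 6 u, OF f11 n(1) this weights_V11(1)]
  have ext_u: "extremal u rho = f11 6" by (simp add: table_weights_eq)
  have "w (twt V11 0) = twt V11 7" unfolding twt_weight_coords w_def u_def
    by (simp add: V11_def refl_weight_coords del: One_nat_def)
  from extremal_table[of f11 V11 7 w, OF f11 n(2) this weights_V11(2)]
  have ext_w: "extremal w rho = f11 7" by (simp add: table_weights_eq)
  let ?e = "(u, 2, w)"
  have "u \<in> weyl" unfolding weyl_def by (rule image_eqI[of _ _ "[1, 2]"]) (simp_all add: u_def word_simps I_eq)
  moreover have "w \<in> weyl" unfolding weyl_def
    by (rule image_eqI[of _ _ "[2, 1, 2]"]) (simp_all add: u_def w_def word_simps I_eq)
  moreover have "len u < len w" unfolding w_def u_def by (rule len_less)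
  ultimately have e: "?e \<in> edges left_weak_bruhat" by (simp add: left_weak_bruhat_def w_def I_eq)
  have "eM ?e \<in> edges skeleton" "tail skeleton (eM ?e) = iota_W (tail left_weak_bruhat ?e)"
    "head skeleton (eM ?e) = iota_W (head left_weak_bruhat ?e)" "colour skeleton (eM ?e) = colour left_weak_bruhat ?e"
    using emb e unfolding cgraph_embedding_def by blast+
  then have fe: "eM ?e \<in> paths \<Gamma>" "source_of \<Gamma> (eM ?e) = iota_W u" "range_of \<Gamma> (eM ?e) = iota_W w"
    "degree_of \<Gamma> (eM ?e) = fund 2"
    by (simp_all add: skeleton_def left_weak_bruhat_def)
  obtain \<nu> v b where p: "eM ?e = (\<nu>, v, b)" by (metis prod_cases3)
  have nv: "\<nu> = fund 2" "v = iota_W w" using fe(3,4) p by (simp_all add: \<Gamma>_def)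
  \<comment> \<open>The same element \<open>c\<close> that enters the definition of the source.\<close>
  define c where "c = (SOME c. lifts (fund 2, v, b) c)"
  have "\<exists>c. lifts (fund 2, v, b) c" using fe(1) p nv by (simp add: \<Gamma>_def)
  then have "lifts (fund 2, v, b) c" unfolding c_def by (rule someI_ex)
  then have c: "c \<in> elts (B rho)" "right_ends rho c = v" "(c, b) \<in> cartan_component rho (fund 2)"
    by (simp_all add: lifts_def)
  have src: "right_ends (rho + fund 2) (the (cartan_projection rho (fund 2) (c, b))) = iota_W u"
    using fe(2) p nv(1) by (simp add: \<Gamma>_def c_def Let_def)
  obtain x where x: "x < tsize V12" "(c, b) = map_prod f11 f01 (emb_rho_w2 ! x)"
    using c(3) unfolding C4(1) by blast
  have cx: "c = f11 (fst (emb_rho_w2 ! x))" "b = f01 (snd (emb_rho_w2 ! x))"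
    using x(2) by (simp_all add: map_prod_def split_beta)
  have "inv_into (elts (B (rho + fund 2))) (cartan_inclusion rho (fund 2)) (c, b) = f12 x"
  proof (rule inv_into_f_eq)
    show "cartan_inclusion rho (fund 2) (f12 x) = (c, b)" using C4(2)[OF x(1)] x(2) by simp
    show "f12 x \<in> elts (B (rho + fund 2))" using x(1) el by simp
    show "inj_on (cartan_inclusion rho (fund 2)) (elts (B (rho + fund 2)))"
    proof (rule inj_onI)
      fix y z assume *: "y \<in> elts (B (rho + fund 2))" "z \<in> elts (B (rho + fund 2))"
        "cartan_inclusion rho (fund 2) y = cartan_inclusion rho (fund 2) z"
      obtain i where i: "y = f12 i" "i < tsize V12" using *(1) unfolding el(2) by blast
      obtain j where j: "z = f12 j" "j < tsize V12" using *(2) unfolding el(2) by blast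
      note ij = i j
      have "map_prod f11 f01 (emb_rho_w2 ! i) = map_prod f11 f01 (emb_rho_w2 ! j)"
        using *(3) C4(2)[OF ij(2)] C4(2)[OF ij(4)] ij by simp
      then have q: "f11 (fst (emb_rho_w2 ! i)) = f11 (fst (emb_rho_w2 ! j))" "f01 (snd (emb_rho_w2 ! i)) = f01 (snd (emb_rho_w2 ! j))"
        by (simp_all add: map_prod_def split_beta)
      have "fst (emb_rho_w2 ! i) = fst (emb_rho_w2 ! j)"
        by (rule inj_onD[OF inj(3) q(1)]) (simp_all only: lessThan_iff bounds' ij)
      moreover have "snd (emb_rho_w2 ! i) = snd (emb_rho_w2 ! j)"
        by (rule inj_onD[OF inj(2) q(2)]) (simp_all only: lessThan_iff bounds' ij)
      ultimately have "emb_rho_w2 ! i = emb_rho_w2 ! j" by (rule prod_eqI)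
      moreover have "distinct emb_rho_w2" "length emb_rho_w2 = tsize V12" by code_simp+
      ultimately have "i = j" using ij by (simp add: nth_eq_iff_index_eq)
      then show "y = z" using ij by simp
    qed
  qed
  then have proj: "the (cartan_projection rho (fund 2) (c, b)) = f12 x"
    using c(3) by (simp add: cartan_projection_def)
  have iu: "right_ends (rho + fund 2) (f12 x) = right_ends rho (f11 6)" using src unfolding proj iota_W_def ext_u .
  have iw: "right_ends rho (f11 (fst (emb_rho_w2 ! x))) = right_ends rho (f11 7)"
    using c(2) unfolding nv(2) iota_W_def ext_w cx(1) .
  note b = bounds'[OF x(1)] bounds[OF n(1)] bounds[OF n(2)] bounds[OF bounds'(3)[OF x(1)]]
  have "snd (emb_w2_w1 ! fst (emb_rho_w2 ! x)) = snd (emb_w2_w1 ! 7)"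
    using fun_cong[OF iw, of 1] unfolding R1[OF b(3)] R1[OF n(2)] by (rule inj_onD[OF inj(1)]) (simp_all only: lessThan_iff b)
  moreover have "snd (emb_w1_w2 ! fst (emb_rho_w2 ! x)) = snd (emb_w1_w2 ! 7)"
    using fun_cong[OF iw, of 2] unfolding R2[OF b(3)] R2[OF n(2)] by (rule inj_onD[OF inj(2)]) (simp_all only: lessThan_iff b)
  moreover have "snd (emb_rho_w2 ! x) = snd (emb_w1_w2 ! 6)"
    using fun_cong[OF iu, of 2] unfolding R4[OF x(1)] R2[OF n(1)] by (rule inj_onD[OF inj(2)]) (simp_all only: lessThan_iff b)
  moreover have "snd (emb_2w2_w1 ! x) = snd (emb_w2_w1 ! 6)"
    using fun_cong[OF iu, of 1] unfolding R3[OF x(1)] R1[OF n(1)] by (rule inj_onD[OF inj(1)]) (simp_all only: lessThan_iff b)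
  ultimately show False using list_allD[OF final_check, of x] x(1) by simp
qed

end

theorem proposition5p2:
  shows "\<exists>(g :: lie_alg) (H :: cvec set) (r :: nat) (\<alpha> :: nat \<Rightarrow> cvec \<Rightarrow> complex).
    semisimple g \<and> finite_dimensional g \<and> cartan_subalgebra g H \<and> simple_roots g H r \<alpha> \<and>
    (let a = cartan_matrix g H \<alpha> in
      \<not> (\<exists>fE. cgraph_embedding
           (cartan_datum.left_weak_bruhat r a) (cartan_datum.skeleton r a) (cartan_datum.iota_W r a) fE))"
proof (intro exI conjI)
  interpret cartan_A2 "cartan_matrix sl3 diag alpha"
    by unfold_locales (simp add: cartan_matrix_sl3 entry_A2_def)
  show "let a = cartan_matrix sl3 diag alpha in
    \<not> (\<exists>fE. cgraph_embedding
      (cartan_datum.left_weak_bruhat 2 a) (cartan_datum.skeleton 2 a) (cartan_datum.iota_W 2 a) fE)"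
    unfolding Let_def using no_embedding by (intro notI) (elim exE, blast)
qed (rule semisimple_sl3 finite_dimensional_sl3 cartan_subalgebra_sl3 simple_roots_sl3)+

end
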